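(* Let $R$ be a measurable function on the unit circle $\mathbb T$ with $|R(t)|\le 1$ a.e. and $\log(1-|R|)\in L^1(\mathbb T)$. With the vectors $\check K_{n,m},\widetilde{\check K}_{n,m}\in L^R$ and the functions $\check a_j,\check b_j,\check\omega_j$ defined in the context (identified with their boundary values on $\mathbb T$), for all $n,m\in\mathbb Z$ one has, almost everywhere on $\mathbb T$, $$\check K_{n,m}(t)=\begin{bmatrix}\dfrac{t^n\,\overline{\check a_{n+m}(t)}}{1-\overline{\check\omega_{n+m}(t)}\,\overline{\check b_{n+m}(t)}}\\[3mm] \dfrac{\overline t^{\,m}\,\check a_{n+m}(t)\,\check\omega_{n+m}(t)}{1-\check b_{n+m}(t)\check\omega_{n+m}(t)}\end{bmatrix},\qquad \widetilde{\check K}_{n,m}(t)=\overline t\begin{bmatrix}\dfrac{t^n\,\overline{\check a_{n+m}(t)}\,\overline{\check\omega_{n+m}(t)}}{1-\overline{\check\omega_{n+m}(t)}\,\overline{\check b_{n+m}(t)}}\\[3mm] \dfrac{\overline t^{\,m}\,\check a_{n+m}(t)}{1-\check b_{n+m}(t)\check\omega_{n+m}(t)}\end{bmatrix}.$$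
   Context: $L^R$ is the Hilbert space of (classes of) measurable functions $f=\begin{bmatrix}f_1\\ f_2\end{bmatrix}:\mathbb T\to\mathbb C^2$ with finite norm for the inner product $\langle f,g\rangle=\int_{\mathbb T} g(t)^*\begin{bmatrix}1&\overline{R(t)}\\R(t)&1\end{bmatrix}^{-1}f(t)\,dm(t)$, $m$ the normalized Lebesgue measure. $U_R$ is the unitary operator of multiplication by the independent variable $t$ on $L^R$. $L^2=L^2(\mathbb T)$, $H^2_+$ is the Hardy space of the disk, $H^2_-=L^2\ominus H^2_+$. For $n,m\in\mathbb Z$ let $\check{\mathcal H}_{n,m}$ be the closure in $L^R$ of $\left\{\begin{bmatrix}1&\overline R\\R&1\end{bmatrix}\begin{bmatrix}t^n h_+\\ \overline t^{\,m}h_-\end{bmatrix}: h_+\in H^2_+,\ h_-\in H^2_-\right\}$. The subspaces $\check{\mathcal H}_{n+1,m}$ and $\check{\mathcal H}_{n,m+1}$ have codimension one in $\check{\mathcal H}_{n,m}$, and $U_R$ maps $\check{\mathcal H}_{n,m+1}$ onto $\check{\mathcal H}_{n+1,m}$. Let $\check K_{n,m}$ be the unit vector in $\check{\mathcal H}_{n,m}\ominus\check{\mathcal H}_{n+1,m}$ normalized by $\left\langle\begin{bmatrix}1\\R\end{bmatrix}t^n,\check K_{n,m}\right\rangle>0$, and let $\widetilde{\check K}_{n,m}$ be the unit vector in $\check{\mathcal H}_{n,m}\ominus\check{\mathcal H}_{n,m+1}$ normalized by $\left\langle\widetilde{\check K}_{n,m},\begin{bmatrix}\overline R\\1\end{bmatrix}\overline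 t^{\,m+1}\right\rangle>0$. Let $A_0=A_{0,n,m}:\check{\mathcal H}_{n,m}\to\check{\mathcal H}_{n,m}$, $A_0h=U_RP_{\check{\mathcal H}_{n,m+1}}h$, where $P$ denotes orthogonal projection. For $|\zeta|<1$ put $$\check b_{n+m}(\zeta)=\zeta\left\langle(I-\zeta A_0^* )^{-1}\widetilde{\check K}_{n,m},\check K_{n,m}\right\rangle,\qquad \check a_{n+m}(\zeta)=\left\langle(I-\zeta A_0^* )^{-1}\begin{bmatrix}1\\R\end{bmatrix}t^n,\check K_{n,m}\right\rangle .$$ Let $P_\perp$ be the orthogonal projection of $L^R$ onto $\check{\mathcal H}_{n,m}^\perp$ and $A_\perp=P_\perp U_R^*|_{\check{\mathcal H}_{n,m}^\perp}$; put $$\check\omega_{n+m}(\zeta)=\left\langle U_R^*\check K_{n,m},\widetilde{\check K}_{n,m}\right\rangle+\zeta\left\langle U_R^*(I-\zeta A_\perp)^{-1}P_\perp U_R^*\check K_{n,m},\widetilde{\check K}_{n,m}\right\rangle .$$ (So $\check b_{n+m}$ and $\check\omega_{n+m}$ are the characteristic functions of the adjoints of the unitary colligations whose feedback coupling is $U_R$.) These functions depend only on the sum $n+m$; they are analytic and bounded by $1$ in the disk, $\check b_{n+m}(0)=0$, and $\check a_{n+m}$ is outer with $\check a_{n+m}(0)>0$. *)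

theory Defs
  imports "HOL-Complex_Analysis.Complex_Analysis"
begin

text \<open>
  Elements of the spaces \<open>L\<^sup>2\<close> and \<open>L\<^sup>R\<close> are represented by measurable functions on the circle, and
  equality of classes is equality almost everywhere. All subspaces below are saturated under
  almost-everywhere equality, so a choice operator selects a representative of a class.
\<close>

section \<open>The circle, boundary values, Hardy spaces\<close>

text \<open>Normalized Lebesgue measure, completed so that "measurable" means Lebesgue measurable.\<close>

definition circle :: "complex measure" where
  "circle = completion (distr (restrict_space lborel {0..<1}) (restrict_space borel (sphere 0 1))
              (\<lambda>x::real. cis (2 * pi * x)))"

definition log_integrable :: "'a measure \<Rightarrow> ('a \<Rightarrow> real) \<Rightarrow> bool" where
  \<comment> \<open>positivity must be stated, since \<open>ln\<close> of a nonpositive real is not \<open>-\<infinity>\<close> here\<close>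
  "log_integrable M f \<longleftrightarrow> (AE t in M. 0 < f t) \<and> integrable M (\<lambda>t. ln (f t))"

definition bval :: "(complex \<Rightarrow> complex) \<Rightarrow> complex \<Rightarrow> complex" where
  \<comment> \<open>radial boundary value\<close>
  "bval F t = Lim (at_left 1) (\<lambda>r::real. F (of_real r * t))"

definition L2 :: "(complex \<Rightarrow> complex) set" where
  "L2 = {f \<in> borel_measurable circle. integrable circle (\<lambda>t. (cmod (f t))\<^sup>2)}"

definition L2_inner :: "(complex \<Rightarrow> complex) \<Rightarrow> (complex \<Rightarrow> complex) \<Rightarrow> complex" where
  "L2_inner f g = (\<integral>t. cnj (g t) * f t \<partial>circle)"

definition H2_disk :: "(complex \<Rightarrow> complex) set" where
  "H2_disk = {F. F holomorphic_on ball 0 1 \<and>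
     (\<exists>C. \<forall>r::real. 0 \<le> r \<and> r < 1 \<longrightarrow> (\<integral>t. (cmod (F (of_real r * t)))\<^sup>2 \<partial>circle) \<le> C)}"

definition H2_plus :: "(complex \<Rightarrow> complex) set" where
  \<comment> \<open>the Hardy space of the disk, identified with the boundary values of its elements\<close>
  "H2_plus = {h \<in> L2. \<exists>F \<in> H2_disk.
     AE t in circle. ((\<lambda>r::real. F (of_real r * t)) \<longlongrightarrow> h t) (at_left 1)}"

definition H2_minus :: "(complex \<Rightarrow> complex) set" where
  "H2_minus = {h \<in> L2. \<forall>g \<in> H2_plus. L2_inner h g = 0}"

section \<open>The space \<open>L\<^sup>R\<close>\<close>

type_synonym vfun = "complex \<Rightarrow> complex^2"

definition weight :: "(complex \<Rightarrow> complex) \<Rightarrow> complex \<Rightarrow> complex^2^2" where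
  "weight R t = vector [vector [1, cnj (R t)], vector [R t, 1]]"

definition LR_form :: "(complex \<Rightarrow> complex) \<Rightarrow> vfun \<Rightarrow> vfun \<Rightarrow> complex \<Rightarrow> complex" where
  \<comment> \<open>\<open>g(t)\<^sup>* W(t)\<^sup>-\<^sup>1 f(t)\<close>, with \<open>W(t)\<close> the matrix \<open>weight R t\<close>\<close>
  "LR_form R f g t = (\<Sum>i\<in>UNIV. cnj (g t $ i) * (matrix_inv (weight R t) *v f t) $ i)"

definition LR :: "(complex \<Rightarrow> complex) \<Rightarrow> vfun set" where
  "LR R = {f \<in> borel_measurable circle. integrable circle (LR_form R f f)}"

definition LR_inner :: "(complex \<Rightarrow> complex) \<Rightarrow> vfun \<Rightarrow> vfun \<Rightarrow> complex" where
  "LR_inner R f g = (\<integral>t. LR_form R f g t \<partial>circle)"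

definition LR_norm :: "(complex \<Rightarrow> complex) \<Rightarrow> vfun \<Rightarrow> real" where
  "LR_norm R f = sqrt (Re (LR_inner R f f))"

definition LR_closure :: "(complex \<Rightarrow> complex) \<Rightarrow> vfun set \<Rightarrow> vfun set" where
  "LR_closure R S = {f \<in> LR R. \<forall>e>0. \<exists>g\<in>S. LR_norm R (\<lambda>t. f t - g t) < e}"

definition LR_ominus :: "(complex \<Rightarrow> complex) \<Rightarrow> vfun set \<Rightarrow> vfun set \<Rightarrow> vfun set" where
  "LR_ominus R V W = {f \<in> V. \<forall>g\<in>W. LR_inner R f g = 0}"

definition LR_proj :: "(complex \<Rightarrow> complex) \<Rightarrow> vfun set \<Rightarrow> vfun \<Rightarrow> vfun" where
  \<comment> \<open>orthogonal projection of \<open>L\<^sup>R\<close> onto a closed subspace \<open>W\<close>\<close>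
  "LR_proj R W f = (SOME p. p \<in> W \<and> (\<forall>g\<in>W. LR_inner R (\<lambda>t. f t - p t) g = 0))"

definition LR_adjoint :: "(complex \<Rightarrow> complex) \<Rightarrow> vfun set \<Rightarrow> (vfun \<Rightarrow> vfun) \<Rightarrow> vfun \<Rightarrow> vfun" where
  \<comment> \<open>adjoint of a bounded operator \<open>A\<close> on a closed subspace \<open>W\<close>\<close>
  "LR_adjoint R W A g = (SOME h. h \<in> W \<and> (\<forall>f\<in>W. LR_inner R (A f) g = LR_inner R f h))"

definition resolvent :: "vfun set \<Rightarrow> (vfun \<Rightarrow> vfun) \<Rightarrow> complex \<Rightarrow> vfun \<Rightarrow> vfun" where
  \<comment> \<open>\<open>(I - \<zeta> A)\<^sup>-\<^sup>1 v\<close> for an operator \<open>A\<close> on \<open>W\<close> and \<open>v \<in> W\<close>\<close>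
  "resolvent W A \<zeta> v = (SOME x. x \<in> W \<and> (AE t in circle. x t - \<zeta> *s A x t = v t))"

definition UR :: "vfun \<Rightarrow> vfun" where
  "UR f = (\<lambda>t. t *s f t)"

definition U_star :: "(complex \<Rightarrow> complex) \<Rightarrow> vfun \<Rightarrow> vfun" where
  "U_star R = LR_adjoint R (LR R) UR"

section \<open>The subspaces and their defect vectors\<close>

definition Hc :: "(complex \<Rightarrow> complex) \<Rightarrow> int \<Rightarrow> int \<Rightarrow> vfun set" where
  "Hc R n m = LR_closure R
     {\<lambda>t. weight R t *v vector [t powi n * hp t, cnj t powi m * hm t] | hp hm.
        hp \<in> H2_plus \<and> hm \<in> H2_minus}"

definition e_plus :: "(complex \<Rightarrow> complex) \<Rightarrow> int \<Rightarrow> vfun" where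
  "e_plus R n = (\<lambda>t. (t powi n) *s vector [1, R t])"

definition e_minus :: "(complex \<Rightarrow> complex) \<Rightarrow> int \<Rightarrow> vfun" where
  "e_minus R m = (\<lambda>t. (cnj t powi (m + 1)) *s vector [cnj (R t), 1])"

definition cpos :: "complex \<Rightarrow> bool" where
  "cpos z \<longleftrightarrow> z \<in> \<real> \<and> 0 < Re z"

definition Kc :: "(complex \<Rightarrow> complex) \<Rightarrow> int \<Rightarrow> int \<Rightarrow> vfun" where
  "Kc R n m = (SOME K. K \<in> LR_ominus R (Hc R n m) (Hc R (n + 1) m) \<and> LR_norm R K = 1 \<and>
                 cpos (LR_inner R (e_plus R n) K))"

definition Kc_tilde :: "(complex \<Rightarrow> complex) \<Rightarrow> int \<Rightarrow> int \<Rightarrow> vfun" where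
  "Kc_tilde R n m = (SOME K. K \<in> LR_ominus R (Hc R n m) (Hc R n (m + 1)) \<and> LR_norm R K = 1 \<and>
                       cpos (LR_inner R K (e_minus R m)))"

section \<open>The analytic functions on the disk\<close>

text \<open>
  These functions depend only on \<open>n + m\<close>, but each definition is relative to a particular pair.
\<close>

definition A0 :: "(complex \<Rightarrow> complex) \<Rightarrow> int \<Rightarrow> int \<Rightarrow> vfun \<Rightarrow> vfun" where
  "A0 R n m h = UR (LR_proj R (Hc R n (m + 1)) h)"

definition A0_star :: "(complex \<Rightarrow> complex) \<Rightarrow> int \<Rightarrow> int \<Rightarrow> vfun \<Rightarrow> vfun" where
  "A0_star R n m = LR_adjoint R (Hc R n m) (A0 R n m)"

definition bc :: "(complex \<Rightarrow> complex) \<Rightarrow> int \<Rightarrow> int \<Rightarrow> complex \<Rightarrow> complex" where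
  "bc R n m \<zeta> = \<zeta> * LR_inner R (resolvent (Hc R n m) (A0_star R n m) \<zeta> (Kc_tilde R n m)) (Kc R n m)"

definition ac :: "(complex \<Rightarrow> complex) \<Rightarrow> int \<Rightarrow> int \<Rightarrow> complex \<Rightarrow> complex" where
  "ac R n m \<zeta> = LR_inner R (resolvent (Hc R n m) (A0_star R n m) \<zeta> (e_plus R n)) (Kc R n m)"

definition H_perp :: "(complex \<Rightarrow> complex) \<Rightarrow> int \<Rightarrow> int \<Rightarrow> vfun set" where
  "H_perp R n m = LR_ominus R (LR R) (Hc R n m)"

definition A_perp :: "(complex \<Rightarrow> complex) \<Rightarrow> int \<Rightarrow> int \<Rightarrow> vfun \<Rightarrow> vfun" where
  "A_perp R n m h = LR_proj R (H_perp R n m) (U_star R h)"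

definition omegac :: "(complex \<Rightarrow> complex) \<Rightarrow> int \<Rightarrow> int \<Rightarrow> complex \<Rightarrow> complex" where
  "omegac R n m \<zeta> =
     LR_inner R (U_star R (Kc R n m)) (Kc_tilde R n m) +
     \<zeta> * LR_inner R
           (U_star R (resolvent (H_perp R n m) (A_perp R n m) \<zeta>
              (LR_proj R (H_perp R n m) (U_star R (Kc R n m)))))
           (Kc_tilde R n m)"

end

theory Submission
  imports Defs "HOL-Library.Function_Algebras"
begin

text \<open>
  Write \<open>H\<close> for the closure with index \<open>(n, m)\<close>, \<open>K\<close> and \<open>K'\<close> for its two defect vectors, and
  \<open>U\<close> for \<open>U\<^sub>R\<close>. Orthogonality of \<open>K \<in> H\<close> to the closure with index \<open>(n + 1, m)\<close> forces
  \<open>K = (t\<^sup>n cnj \<phi>, cnj t\<^sup>m \<psi>)\<close> with \<open>\<phi>\<close> and \<open>\<psi>\<close> in the Hardy space. Their Cauchy integrals are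
  inner products of resolvents of \<open>U\<close> with \<open>(1, R) t\<^sup>n\<close> and \<open>(cnj R, 1) cnj t\<^sup>m\<^sup>+\<^sup>1\<close>. Decomposing these along
  \<open>H\<close> and its complement gives \<open>\<phi> = a k\<close> and \<open>\<psi> = a p\<close> in the disk, where \<open>k\<close> and \<open>p\<close> are the resolvent entries at
  \<open>(K, K)\<close> and \<open>(K, K')\<close>, and the feedback coupling of the two colligations gives \<open>p = k \<omega>\<close> and
  \<open>k = 1 + p b\<close>. Hence \<open>\<phi> (1 - \<omega> b) = a\<close> and \<open>\<psi> = \<omega> \<phi>\<close>, and radial limits give the formula for
  \<open>K\<close>; these exist almost everywhere by Fatou's theorem, and \<open>\<phi> \<noteq> 0\<close> almost everywhere. The formula for \<open>K'\<close> follows from a conjugation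
  of \<open>L\<^sup>R\<close> exchanging the two defect vectors, and multiplication by a power of \<open>t\<close>
  reduces everything to one pair of indices with given sum.
\<close>

section \<open>Lebesgue differentiation on the line\<close>

text \<open>Vectors are functions, so every object chosen by \<open>SOME\<close> (projections,
  adjoints, resolvents, the vectors \<open>Kc\<close> and \<open>Kc_tilde\<close>) is determined
  only up to a null set, and the inner product is only semidefinite. Identities between vectors are
  therefore stated as vanishing \<open>nrm\<close> of a difference, and operators are compared
  through inner products. Neither the codimension-one property of the subspaces nor existence and
  uniqueness of the two unit vectors is assumed; the integrability of log (1 - |R|) enters there,
  through an outer function of modulus 1 - |R| that keeps \<open>e_plus\<close> out of the smaller
  subspace. Boundary values of a and b come from square-summable Taylor coefficients, supplied by
  the energy balance of the colligation. For \<omega> no such bound is established: its radial limit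
  is that of the quotient of the Cauchy integrals of \<psi> and \<phi>. The denominator 1 - \<omega>
  b is nonzero almost everywhere because a is.\<close>

lemma negligible_symmetric_average_defect:
  fixes f :: "real \<Rightarrow> 'a::euclidean_space"
  assumes f: "f integrable_on cbox a b" and "\<eta> > 0"
  shows "negligible {x \<in> {a<..<b}. \<forall>\<delta>>0. \<exists>h. 0 < h \<and> h < \<delta> \<and>
           norm (integral {x-h..x+h} f - (2 * h) *\<^sub>R f x) > \<eta> * h}" (is "negligible ?E")
  unfolding negligible_outer_le
proof (intro allI impI)
  fix \<epsilon> :: real assume "\<epsilon> > 0"
  \<comment> \<open>Balls of radius 5 h have length 10 h, and \<eta> times the sum of the radii will
    be at most e; the 10 makes the enlarged balls cover \<open>E\<close> with total length at most
    \<epsilon>.\<close>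
  define e where "e = \<epsilon> * \<eta> / 10"
  have "e > 0" using \<open>\<epsilon> > 0\<close> \<open>\<eta> > 0\<close> by (simp add: e_def)
  \<comment> \<open>The Henstock lemma bounds the summed defect of any fine partial division by e. A
    disjoint Vitali subfamily of bad intervals is such a division, and each member contributes more
    than \<eta> h, so the bad intervals have small total length.\<close>
  obtain \<gamma> where \<gamma>: "gauge \<gamma>"
    and fine: "\<And>p. \<lbrakk>p tagged_partial_division_of (cbox a b); \<gamma> fine p\<rbrakk> \<Longrightarrow>
             sum (\<lambda>(x,k). norm(measure lborel k *\<^sub>R f x - integral k f)) p < e"
    using Henstock_lemma[OF f \<open>e > 0\<close>] by blast
  define E where "E = ?E"
  \<comment> \<open>The radius is small enough for the interval to lie inside the gauge at its
    centre; the Vitali lemma also needs the radii to be bounded.\<close>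
  have ex: "\<exists>h. 0 < h \<and> h < 1 \<and> cball x h \<subseteq> \<gamma> x \<inter> {a<..<b} \<and>
          norm (integral {x-h..x+h} f - (2 * h) *\<^sub>R f x) > \<eta> * h" if xE: "x \<in> E" for x
  proof -
    have xs: "a < x" "x < b" "\<And>\<delta>. \<delta> > 0 \<Longrightarrow> \<exists>h. 0 < h \<and> h < \<delta> \<and>
           norm (integral {x-h..x+h} f - (2 * h) *\<^sub>R f x) > \<eta> * h"
      using xE unfolding E_def by auto
    have "open (\<gamma> x \<inter> {a<..<b})" "x \<in> \<gamma> x \<inter> {a<..<b}"
      using \<gamma> xs by (auto simp: gauge_def)
    then obtain d where d: "d > 0" "cball x d \<subseteq> \<gamma> x \<inter> {a<..<b}"
      by (meson open_contains_cball)
    have "min d 1 > 0" using d by simp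
    then obtain h where h: "0 < h" "h < min d 1" "norm (integral {x-h..x+h} f - (2 * h) *\<^sub>R f x) > \<eta> * h"
      using xs(3) by blast
    moreover have "cball x h \<subseteq> cball x d" using h by (intro subset_cball) auto
    ultimately show ?thesis using d by (intro exI[of _ h]) auto
  qed
  then obtain h where h: "\<And>x. x \<in> E \<Longrightarrow> 0 < h x \<and> h x < 1 \<and> cball x (h x) \<subseteq> \<gamma> x \<inter> {a<..<b} \<and>
          norm (integral {x-h x..x+h x} f - (2 * h x) *\<^sub>R f x) > \<eta> * h x"
    using ex by metis
  obtain C where C: "countable C" "C \<subseteq> E"
      "pairwise (\<lambda>i j. disjnt (cball i (h i)) (cball j (h j))) C"
      "E \<subseteq> (\<Union>i\<in>C. cball i (5 * h i))"
  proof (rule Vitali_covering_lemma_cballs[where S=E and K=E and a="\<lambda>x. x" and r=h and B=1])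
    show "E \<subseteq> (\<Union>i\<in>E. cball i (h i))"
      using h centre_in_cball by (fastforce intro: less_imp_le)
    show "0 < h i \<and> h i \<le> 1" if "i \<in> E" for i
      using h[OF that] by auto
  qed auto
  have cball_eq: "cball x r = {x-r..x+r}" for x r :: real
    by (auto simp: dist_real_def)
  have fin: "(\<Sum>i\<in>D. \<eta> * h i) \<le> e" if D: "D \<subseteq> C" "finite D" for D
  proof -
    have inj: "inj_on (\<lambda>x. (x, cball x (h x))) D" by (auto simp: inj_on_def)
    have DE: "\<And>x. x \<in> D \<Longrightarrow> x \<in> E" using D C by blast
    let ?p = "(\<lambda>x. (x, cball x (h x))) ` D"
    have "?p tagged_partial_division_of (cbox a b)"
      unfolding tagged_partial_division_of_def
    proof (intro conjI allI impI)
      show "finite ?p" using D by simp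
      fix x k assume xk: "(x, k) \<in> ?p"
      then have x: "x \<in> D" "k = cball x (h x)" by auto
      then show "x \<in> k" using h[OF DE[of x]] by auto
      show "k \<subseteq> cbox a b" using h[OF DE[of x]] x by auto
      show "\<exists>a b. k = cbox a b" using x cball_eq by (metis cbox_interval)
    next
      fix x k x' k' assume "(x, k) \<in> ?p \<and> (x', k') \<in> ?p \<and> (x, k) \<noteq> (x', k')"
      then have x: "x \<in> D" "k = cball x (h x)"
        and x': "x' \<in> D" "k' = cball x' (h x')" "x \<noteq> x'" by auto
      then have "disjnt k k'" using C(3) D x unfolding pairwise_def by blast
      then show "interior k \<inter> interior k' = {}"
        using interior_subset unfolding disjnt_def by fastforce
    qed
    moreover have "\<gamma> fine ?p"
      using h DE unfolding fine_def by blast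
    ultimately have "sum (\<lambda>(x,k). norm(measure lborel k *\<^sub>R f x - integral k f)) ?p < e"
      by (rule fine)
    then have "(\<Sum>x\<in>D. norm(measure lborel (cball x (h x)) *\<^sub>R f x - integral (cball x (h x)) f)) < e"
      by (subst (asm) sum.reindex[OF inj]) (simp add: o_def)
    moreover have "(\<Sum>i\<in>D. \<eta> * h i) \<le> (\<Sum>x\<in>D. norm(measure lborel (cball x (h x)) *\<^sub>R f x - integral (cball x (h x)) f))"
    proof (rule sum_mono)
      fix x assume "x \<in> D"
      from h[OF DE[OF this]]
      show "\<eta> * h x \<le> norm(measure lborel (cball x (h x)) *\<^sub>R f x - integral (cball x (h x)) f)"
        unfolding cball_eq by (simp add: norm_minus_commute)
    qed
    ultimately show ?thesis by linarith
  qed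
  let ?T = "\<Union>i\<in>C. cball i (5 * h i)"
  have bound: "measure lebesgue (\<Union>i\<in>D. cball i (5 * h i)) \<le> \<epsilon>" if D: "D \<subseteq> C" "finite D" for D
  proof -
    have DE: "\<And>x. x \<in> D \<Longrightarrow> x \<in> E" using D C by blast
    have "measure lebesgue (\<Union>i\<in>D. cball i (5 * h i)) \<le> (\<Sum>i\<in>D. measure lebesgue (cball i (5 * h i)))"
      by (rule measure_UNION_le) (use D in auto)
    also have "\<dots> = (\<Sum>i\<in>D. 10 * h i)"
      using h[OF DE] by (intro sum.cong) (auto simp: cball_eq less_imp_le)
    also have "\<dots> = 10 / \<eta> * (\<Sum>i\<in>D. \<eta> * h i)"
      using \<open>\<eta> > 0\<close> by (simp add: sum_distrib_left)
    also have "\<dots> \<le> 10 / \<eta> * e"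
      using fin[OF D] \<open>\<eta> > 0\<close> by (intro mult_left_mono) auto
    also have "\<dots> = \<epsilon>" using \<open>\<eta> > 0\<close> by (simp add: e_def)
    finally show ?thesis .
  qed
  show "\<exists>T. E \<subseteq> T \<and> T \<in> lmeasurable \<and> measure lebesgue T \<le> \<epsilon>"
    unfolding E_def[symmetric]
    using C(4) fmeasurable_UN_bound[OF C(1) _ bound] measure_UN_bound[OF C(1) _ bound]
    by (intro exI[of _ ?T]) auto
qed

text \<open>Failure of the limit at x means that some threshold 1 / (k + 1) is exceeded for
  arbitrarily small h, so the bad points form a countable union of the preceding exceptional
  sets.\<close>

lemma symmetric_average_tendsto:
  fixes f :: "real \<Rightarrow> 'a::euclidean_space"
  assumes f: "f integrable_on cbox a b"
  shows "\<exists>N. negligible N \<and> (\<forall>x\<in>{a<..<b} - N.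
           ((\<lambda>h. (1 / h) *\<^sub>R (integral {x-h..x+h} f - (2 * h) *\<^sub>R f x)) \<longlongrightarrow> 0) (at_right 0))"
proof -
  define E where "E = (\<lambda>\<eta>. {x \<in> {a<..<b}. \<forall>\<delta>>0. \<exists>h. 0 < h \<and> h < \<delta> \<and>
           norm (integral {x-h..x+h} f - (2 * h) *\<^sub>R f x) > \<eta> * h})"
  define N where "N = (\<Union>k. E (1 / real (Suc k)))"
  have "negligible N"
    unfolding N_def
  proof (rule negligible_Union_nat)
    fix k show "negligible (E (1 / real (Suc k)))"
      unfolding E_def by (rule negligible_symmetric_average_defect[OF f]) simp
  qed
  moreover have "((\<lambda>h. (1 / h) *\<^sub>R (integral {x-h..x+h} f - (2 * h) *\<^sub>R f x)) \<longlongrightarrow> 0) (at_right 0)"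
    if x: "x \<in> {a<..<b} - N" for x
  proof (rule tendstoI)
    fix e :: real assume "e > 0"
    then obtain k where k: "1 / real (Suc k) < e" using nat_approx_posE by metis
    have "x \<notin> E (1 / real (Suc k))" using x by (auto simp: N_def)
    then obtain \<delta> where \<delta>: "\<delta> > 0" "\<And>h. 0 < h \<Longrightarrow> h < \<delta> \<Longrightarrow>
        norm (integral {x-h..x+h} f - (2 * h) *\<^sub>R f x) \<le> 1 / real (Suc k) * h"
      using x unfolding E_def by (force simp: not_less)
    have "dist ((1 / h) *\<^sub>R (integral {x-h..x+h} f - (2 * h) *\<^sub>R f x)) 0 < e" if "0 < h" "h < \<delta>" for h
    proof -
      have "norm ((1 / h) *\<^sub>R (integral {x-h..x+h} f - (2 * h) *\<^sub>R f x)) \<le> (1 / h) * (1 / real (Suc k) * h)"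
        unfolding norm_scaleR using \<delta>(2)[OF that] that by (intro mult_mono) auto
      also have "\<dots> < e" using k that by simp
      finally show ?thesis by simp
    qed
    then show "\<forall>\<^sub>F h in at_right 0. dist ((1 / h) *\<^sub>R (integral {x-h..x+h} f - (2 * h) *\<^sub>R f x)) 0 < e"
      using \<delta>(1) eventually_at_right_field by blast
  qed
  ultimately show ?thesis by blast
qed

text \<open>The measure before completion. Push-forward and change of variables are carried out
  here, where measurability is Borel measurability, and then transferred to
  \<open>circle\<close>.\<close>

abbreviation circle_borel :: "complex measure" where
  "circle_borel \<equiv> distr (restrict_space lborel {0..<1}) (restrict_space borel (sphere 0 1))
              (\<lambda>x::real. cis (2 * pi * x))"

section \<open>The circle measure\<close>

lemma cis_measurable_sphere:
  "(\<lambda>x::real. cis (2 * pi * x)) \<in> restrict_space lborel {0..<1} \<rightarrow>\<^sub>M restrict_space borel (sphere 0 1)"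
proof (rule measurable_restrict_space2)
  have "continuous_on UNIV (\<lambda>x::real. cis (2 * pi * x))"
    by (intro continuous_intros)
  then have "(\<lambda>x::real. cis (2 * pi * x)) \<in> borel_measurable borel"
    by (rule borel_measurable_continuous_onI)
  then show "(\<lambda>x::real. cis (2 * pi * x)) \<in> restrict_space lborel {0..<1} \<rightarrow>\<^sub>M borel"
    by (simp add: measurable_restrict_space1)
qed auto

lemma space_circle [simp]: "space circle = sphere 0 1"
  by (simp add: circle_def space_restrict_space)

lemma sets_circle_borel [simp]: "sets circle_borel = sets (restrict_space borel (sphere 0 1))"
  by simp

lemma emeasure_circle [simp]: "emeasure circle (sphere 0 1) = 1"
proof -
  have "(\<lambda>x::real. cis (2 * pi * x)) -` sphere 0 1 \<inter> {0..<1} = {0..<1}" by auto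
  moreover have "sphere (0::complex) 1 \<in> sets (restrict_space borel (sphere 0 1))"
    by (simp add: sets_restrict_space_iff)
  ultimately show ?thesis
    unfolding circle_def
    by (simp add: emeasure_distr[OF cis_measurable_sphere] emeasure_restrict_space space_restrict_space)
qed

lemma measure_circle [simp]: "measure circle (sphere 0 1) = 1"
  by (simp add: measure_def)

interpretation circle: finite_measure circle
  by (rule finite_measureI) simp

interpretation circle: complete_measure circle
  unfolding circle_def by (rule completion.complete_measure_axioms)

lemma borel_measurable_circleI:
  "f \<in> borel_measurable borel \<Longrightarrow> f \<in> borel_measurable circle"
  unfolding circle_def
  by (intro measurable_completion) (simp add: measurable_restrict_space1)

lemma borel_measurable_circle_ident [measurable]: "(\<lambda>t. t) \<in> borel_measurable circle"
  by (rule borel_measurable_circleI) simp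

text \<open>Computations in the angle need a Borel function on the circle, so they start from a
  Borel representative. Completion is handled on real and imaginary parts separately.\<close>

lemma circle_ex_borel:
  fixes f :: "complex \<Rightarrow> complex"
  assumes "f \<in> borel_measurable circle"
  shows "\<exists>g \<in> borel_measurable (restrict_space borel (sphere 0 1)). AE t in circle. f t = g t"
proof -
  have "(\<lambda>t. Re (f t)) \<in> borel_measurable circle" "(\<lambda>t. Im (f t)) \<in> borel_measurable circle"
    using assms by measurable
  then obtain u v where "u \<in> borel_measurable circle_borel" "AE t in circle_borel. Re (f t) = u t"
    "v \<in> borel_measurable circle_borel" "AE t in circle_borel. Im (f t) = v t"
    unfolding circle_def by (blast dest: completion_ex_borel_measurable_real)
  then have *: "(\<lambda>t. Complex (u t) (v t)) \<in> borel_measurable circle_borel"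
    "AE t in circle_borel. f t = Complex (u t) (v t)"
    by (auto simp: borel_measurable_complex_iff complex_eq_iff)
  then show ?thesis unfolding circle_def
    by (intro bexI[of _ "\<lambda>t. Complex (u t) (v t)"]) (auto intro: AE_completion)
qed

lemma
  fixes f :: "complex \<Rightarrow> 'a::{banach, second_countable_topology}"
  assumes f: "f \<in> borel_measurable (restrict_space borel (sphere 0 1))"
  shows integrable_circle_iff: "integrable circle f \<longleftrightarrow> set_integrable lborel {0..<1} (\<lambda>x. f (cis (2 * pi * x)))"
    and integral_circle_eq: "integral\<^sup>L circle f = (LINT x:{0..<1}|lborel. f (cis (2 * pi * x)))"
proof -
  have f': "f \<in> borel_measurable circle_borel" using f by simp
  show "integrable circle f \<longleftrightarrow> set_integrable lborel {0..<1} (\<lambda>x. f (cis (2 * pi * x)))"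
    unfolding circle_def integrable_completion[OF f']
    by (subst integrable_distr_eq[OF cis_measurable_sphere f])
      (simp add: integrable_restrict_space set_integrable_def)
  show "integral\<^sup>L circle f = (LINT x:{0..<1}|lborel. f (cis (2 * pi * x)))"
    unfolding circle_def integral_completion[OF f']
    by (subst integral_distr[OF cis_measurable_sphere f])
      (simp add: integral_restrict_space set_lebesgue_integral_def)
qed

lemma borel_measurable_Arg2pi: "Arg2pi \<in> borel_measurable borel"
proof (rule borel_measurableI_greater)
  fix t :: real
  show "{z \<in> space borel. t < Arg2pi z} \<in> sets borel"
    using open_Arg2pi2pi_gt by simp
qed

lemma Arg2pi_cis: "0 \<le> x \<Longrightarrow> x < 2 * pi \<Longrightarrow> Arg2pi (cis x) = x"
  by (rule Arg2pi_unique[of 1]) (auto simp: cis_conv_exp)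

text \<open>\<open>Arg2pi\<close> is a Borel inverse of the parametrization, so avoiding a Borel
  null set of parameters is a measurable predicate on the circle, and for such predicates
  almost-everywhere statements pass through the push-forward.\<close>

lemma AE_circleI_negligible:
  assumes "negligible N" and P: "\<And>x. 0 < x \<Longrightarrow> x < 1 \<Longrightarrow> x \<notin> N \<Longrightarrow> P (cis (2 * pi * x))"
  shows "AE t in circle. P t"
proof -
  \<comment> \<open>The parameter 0 is added to the null set because \<open>P\<close> is only
    required at interior points, around which symmetric intervals fit into the parameter
    interval.\<close>
  have "N \<union> {0} \<in> null_sets lebesgue"
    using assms by (simp add: negligible_iff_null_sets[symmetric])
  then obtain B where B: "B \<in> null_sets lborel" "N \<union> {0} \<subseteq> B"
    using null_sets_completion_iff2[of "N \<union> {0}" lborel] by auto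
  define Q where "Q t \<longleftrightarrow> Arg2pi t / (2 * pi) \<notin> B" for t
  have BM: "B \<in> sets borel" using B by auto
  have "(\<lambda>t. Arg2pi t / (2 * pi)) \<in> borel_measurable (restrict_space borel (sphere 0 1))"
    using borel_measurable_Arg2pi by (intro measurable_restrict_space1 borel_measurable_divide) auto
  then have "{t \<in> space (restrict_space borel (sphere 0 1)). Q t} \<in> sets (restrict_space borel (sphere 0 1))"
    unfolding Q_def using BM by measurable
  moreover have "AE x in restrict_space lborel {0..<1}. Q (cis (2 * pi * x))"
  proof -
    have "AE x in lborel. x \<notin> B" using B(1) by (rule AE_not_in)
    then show ?thesis
      unfolding Q_def by (subst AE_restrict_space_iff) (auto elim!: eventually_mono simp: Arg2pi_cis)
  qed
  ultimately have "AE t in circle_borel. Q t"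
    by (subst AE_distr_iff[OF cis_measurable_sphere]) auto
  then have "AE t in circle. Q t" unfolding circle_def by (rule AE_completion)
  moreover have "P t" if "t \<in> space circle" "Q t" for t
  proof -
    define x where "x = Arg2pi t / (2 * pi)"
    have x: "0 \<le> x" "x < 1" "cis (2 * pi * x) = t"
      using Arg2pi[of t] complex_norm_eq_1_exp[of t] that by (auto simp: x_def cis_conv_exp)
    have "x \<notin> B" using that by (simp add: Q_def x_def)
    then have "x \<noteq> 0" "x \<notin> N" using B(2) by auto
    then show "P t" using P[of x] x by auto
  qed
  ultimately show ?thesis using AE_space[of circle] by (elim AE_mp) (auto intro!: AE_I2)
qed

lemma AE_circle_norm: "AE t in circle. norm t = 1"
  by (rule AE_I2) auto

lemma circle_moment:
  "(\<integral>t. t powi j \<partial>circle) = (if j = 0 then 1 else 0)"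
proof -
  have "(\<lambda>t::complex. t powi j) \<in> borel_measurable (restrict_space borel (sphere 0 1))"
    by (intro borel_measurable_continuous_on_restrict continuous_intros) auto
  then have "(\<integral>t. t powi j \<partial>circle) = (LINT x:{0..<1}|lborel. cis (2 * pi * x) powi j)"
    by (rule integral_circle_eq)
  also have "\<dots> = (LINT x:{0..<1}|lborel. cis (of_int j * (2 * pi * x)))"
    by (simp add: Complex.cis_power_int)
  also have "\<dots> = (LINT x:{0..1}|lborel. cis (of_int j * (2 * pi * x)))"
    unfolding set_lebesgue_integral_def
  proof (rule integral_cong_AE)
    have "AE x in lborel. x \<noteq> (1::real)" using AE_lborel_singleton by blast
    then show "AE x in lborel. indicator {0..<1} x *\<^sub>R cis (of_int j * (2 * pi * x)) =
         indicator {0..1} x *\<^sub>R cis (of_int j * (2 * pi * x))"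
      by eventually_elim (auto simp: indicator_def)
  qed (intro borel_measurable_scaleR borel_measurable_indicator, simp, simp,
       intro borel_measurable_continuous_onI continuous_intros)+
  also have "\<dots> = integral {0..1} (\<lambda>x. cis (of_int j * (2 * pi * x)))"
    by (intro set_borel_integral_eq_integral borel_integrable_atLeastAtMost')
      (auto intro!: continuous_intros)
  also have "\<dots> = (if j = 0 then 1 else 0)"
  proof (cases "j = 0")
    case False
    define c where "c = of_int j * (2 * pi)"
    have "c \<noteq> 0" using False by (simp add: c_def)
    have ii: "- (\<i> * (w * \<i>)) = w" for w by (simp add: mult.commute[of w])
    have "((\<lambda>x. cis (c * x)) has_integral (cis (c * 1) / (\<i> * of_real c) - cis (c * 0) / (\<i> * of_real c))) {0..1}"
    proof (rule fundamental_theorem_of_calculus)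
      fix x :: real assume "x \<in> {0..1}"
      have "((\<lambda>x. exp (\<i> * of_real (c * x)) / (\<i> * of_real c)) has_vector_derivative exp (\<i> * of_real (c * x))) (at x within {0..1})"
        using \<open>c \<noteq> 0\<close>
        by (auto intro!: derivative_eq_intros has_vector_derivative_real_field simp: ii has_vector_derivative_def[symmetric])
      then show "((\<lambda>x. cis (c * x) / (\<i> * of_real c)) has_vector_derivative cis (c * x)) (at x within {0..1})"
        by (simp add: cis_conv_exp)
    qed auto
    moreover have "cis c = 1" unfolding c_def
      using cis_multiple_2pi[of "of_int j"] by (simp add: mult.commute)
    ultimately show ?thesis using False by (auto dest!: integral_unique simp: c_def mult.assoc)
  qed simp
  finally show ?thesis .
qed

section \<open>Cauchy and Poisson integrals\<close>

text \<open>Normalized Lebesgue measure is ds / (2 pi i s), so this is the Cauchy integral of f; the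
  factor s in the kernel cancels the one in the measure.\<close>

definition cauchy_int :: "(complex \<Rightarrow> complex) \<Rightarrow> complex \<Rightarrow> complex" where
  "cauchy_int f z = (\<integral>s. f s * (s / (s - z)) \<partial>circle)"

definition poisson_int :: "(complex \<Rightarrow> complex) \<Rightarrow> complex \<Rightarrow> complex" where
  "poisson_int f z = (\<integral>s. f s * of_real ((1 - (norm z)\<^sup>2) / (norm (s - z))\<^sup>2) \<partial>circle)"

lemma borel_measurable_cnj [measurable (raw)]:
  "f \<in> borel_measurable M \<Longrightarrow> (\<lambda>x. cnj (f x)) \<in> borel_measurable M"
  by (intro borel_measurable_continuous_on[of cnj] continuous_intros)

lemma integrable_circle_mult_bounded:
  fixes f :: "complex \<Rightarrow> complex"
  assumes f: "integrable circle f" and g: "g \<in> borel_measurable circle"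
    and B: "\<And>s. norm s = 1 \<Longrightarrow> norm (g s) \<le> B"
  shows "integrable circle (\<lambda>s. f s * g s)"
proof (rule Bochner_Integration.integrable_bound)
  show "integrable circle (\<lambda>s. B * norm (f s))" using f by auto
  show "(\<lambda>s. f s * g s) \<in> borel_measurable circle" using f g by auto
  show "AE s in circle. norm (f s * g s) \<le> norm (B * norm (f s))"
  proof (rule AE_I2)
    fix s assume "s \<in> space circle"
    then have "norm (g s) \<le> B" using B by auto
    then have "norm (f s) * norm (g s) \<le> norm (f s) * \<bar>B\<bar>" by (intro mult_left_mono) auto
    then show "norm (f s * g s) \<le> norm (B * norm (f s))"
      by (simp add: norm_mult abs_mult mult.commute)
  qed
qed

text \<open>On the circle the kernel is 1 / (1 - z cnj s). Its geometric series is dominated by |f|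
  |z|^j and may be integrated term by term, so the Taylor coefficients are the Fourier coefficients
  of index j >= 0.\<close>

lemma cauchy_sums:
  assumes f: "integrable circle f" and z: "norm z < 1"
  shows "(\<lambda>j. (\<integral>s. f s * cnj s ^ j \<partial>circle) * z ^ j) sums cauchy_int f z"
proof -
  define F where "F = (\<lambda>j s. f s * (z * cnj s) ^ j)"
  have int: "integrable circle (F j)" for j
    unfolding F_def by (rule integrable_circle_mult_bounded[OF f, where B=1])
      (use z in \<open>auto simp: norm_mult norm_power power_le_one\<close>)
  have nF: "norm (F j s) = norm (f s) * norm z ^ j" if "norm s = 1" for j s
    using that by (simp add: F_def norm_mult norm_power)
  have nI: "(\<integral>s. norm (F j s) \<partial>circle) = (\<integral>s. norm (f s) \<partial>circle) * norm z ^ j" for j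
  proof -
    have "(\<integral>s. norm (F j s) \<partial>circle) = (\<integral>s. norm (f s) * norm z ^ j \<partial>circle)"
      by (intro Bochner_Integration.integral_cong) (auto simp: nF)
    then show ?thesis by simp
  qed
  have s1: "AE s in circle. summable (\<lambda>j. norm (F j s))"
    using z by (intro AE_I2) (auto simp: nF intro!: summable_mult summable_geometric)
  have s2: "summable (\<lambda>j. \<integral>s. norm (F j s) \<partial>circle)"
    unfolding nI using z by (intro summable_mult summable_geometric) auto
  have "(\<lambda>j. integral\<^sup>L circle (F j)) sums (\<integral>s. (\<Sum>j. F j s) \<partial>circle)"
    using integral_suminf[OF int s1 s2] summable_integral[OF int s1 s2] by (simp add: sums_iff)
  also have "(\<integral>s. (\<Sum>j. F j s) \<partial>circle) = cauchy_int f z"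
    unfolding cauchy_int_def
  proof (rule Bochner_Integration.integral_cong[OF refl])
    fix s assume "s \<in> space circle"
    then have s: "norm s = 1" "s \<noteq> 0" "s * cnj s = 1" by (auto simp: complex_norm_square[symmetric])
    have sz: "s \<noteq> z" using s z by auto
    have "norm (z * cnj s) < 1" using s z by (simp add: norm_mult)
    then have "(\<lambda>j. f s * (z * cnj s) ^ j) sums (f s * (1 / (1 - z * cnj s)))"
      by (intro sums_mult geometric_sums)
    moreover have "1 / (1 - z * cnj s) = s / (s - z)"
    proof -
      have "s * (1 - z * cnj s) = s - z" using s by (simp add: algebra_simps)
      then show ?thesis using s sz by (metis mult_divide_mult_cancel_left mult.right_neutral)
    qed
    ultimately show "(\<Sum>j. F j s) = f s * (s / (s - z))"
      by (simp add: F_def sums_iff)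
  qed
  also have "(\<lambda>j. integral\<^sup>L circle (F j)) = (\<lambda>j. (\<integral>s. f s * cnj s ^ j \<partial>circle) * z ^ j)"
  proof
    fix j
    have "integral\<^sup>L circle (F j) = (\<integral>s. (f s * cnj s ^ j) * z ^ j \<partial>circle)"
      by (simp add: F_def power_mult_distrib mult_ac)
    then show "integral\<^sup>L circle (F j) = (\<integral>s. f s * cnj s ^ j \<partial>circle) * z ^ j" by simp
  qed
  finally show ?thesis .
qed

lemma cauchy_int_holomorphic:
  assumes "integrable circle f"
  shows "cauchy_int f holomorphic_on ball 0 1"
  by (rule power_series_holomorphic[where a="\<lambda>j. \<integral>s. f s * cnj s ^ j \<partial>circle"])
    (use cauchy_sums[OF assms] in auto)

lemma integrable_cauchy_kernel:
  fixes f :: "complex \<Rightarrow> complex"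
  assumes f: "integrable circle f" and z: "norm z < 1"
  shows "integrable circle (\<lambda>s. f s * (s / (s - z)))"
proof (rule integrable_circle_mult_bounded[OF f, where B="1 / (1 - norm z)"])
  fix s :: complex assume s: "norm s = 1"
  have "1 - norm z \<le> norm (s - z)" using norm_triangle_ineq2[of s z] s by simp
  then show "norm (s / (s - z)) \<le> 1 / (1 - norm z)"
    using s z by (simp add: norm_divide frac_le)
qed auto

lemma circle_moment_cnj: "(\<integral>s. cnj s ^ j \<partial>circle) = (if j = 0 then 1 else 0)"
proof -
  have "(\<integral>s. cnj s ^ j \<partial>circle) = (\<integral>s. s powi (- int j) \<partial>circle)"
  proof (rule Bochner_Integration.integral_cong[OF refl])
    fix s assume "s \<in> space circle"
    then have "cnj s = inverse s" using inverse_unique[of s "cnj s"]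
      by (auto simp: complex_norm_square[symmetric])
    then show "cnj s ^ j = s powi (- int j)" by (simp add: power_int_minus power_inverse)
  qed
  then show ?thesis by (simp add: circle_moment)
qed

lemma cauchy_int_const: "norm z < 1 \<Longrightarrow> cauchy_int (\<lambda>s. c) z = c"
proof -
  assume z: "norm z < 1"
  have "(\<lambda>j. (\<integral>s. c * cnj s ^ j \<partial>circle) * z ^ j) sums cauchy_int (\<lambda>s. c) z"
    by (rule cauchy_sums[OF _ z]) simp
  moreover have "(\<lambda>j. (\<integral>s. c * cnj s ^ j \<partial>circle) * z ^ j) = (\<lambda>j. if j = 0 then c else 0)"
    by (auto simp: circle_moment_cnj fun_eq_iff)
  ultimately show ?thesis using sums_single[of 0 "\<lambda>_. c"] sums_unique2 by metis
qed

text \<open>The Poisson kernel is twice the real part of the Cauchy kernel minus 1, by s cnj s = 1.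
  Through this identity the Poisson integral inherits integrability and its value on constants from
  Cauchy integrals.\<close>

lemma poisson_kernel_eq:
  assumes s: "norm s = 1" and z: "norm z < 1"
  shows "complex_of_real ((1 - (norm z)\<^sup>2) / (norm (s - z))\<^sup>2) = s / (s - z) + cnj (s / (s - z)) - 1"
proof -
  have nz: "s - z \<noteq> 0" "cnj (s - z) \<noteq> 0" using assms by auto
  have "s * cnj s = 1" using s by (simp add: complex_norm_square[symmetric])
  then have "s / (s - z) + cnj (s / (s - z)) - 1 = (1 - z * cnj z) / ((s - z) * cnj (s - z))"
    using nz by (simp add: divide_simps) (simp add: algebra_simps)
  then show ?thesis by (simp only: of_real_divide of_real_diff complex_norm_square of_real_1)
qed

lemma mult_poisson_kernel_eq:
  assumes s: "s \<in> space circle" and z: "norm z < 1"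
  shows "w * complex_of_real ((1 - (norm z)\<^sup>2) / (norm (s - z))\<^sup>2) =
    w * (s / (s - z)) + cnj (cnj w * (s / (s - z))) - w"
proof -
  have s1: "norm s = 1" using s by simp
  show ?thesis
    unfolding poisson_kernel_eq[OF s1 z] by (simp add: algebra_simps)
qed

lemma integrable_poisson_kernel:
  fixes f :: "complex \<Rightarrow> complex"
  assumes f: "integrable circle f" and z: "norm z < 1"
  shows "integrable circle (\<lambda>s. f s * of_real ((1 - (norm z)\<^sup>2) / (norm (s - z))\<^sup>2))"
proof -
  have "integrable circle (\<lambda>s. f s * (s / (s - z)) + cnj (cnj (f s) * (s / (s - z))) - f s)"
    using assms by (intro Bochner_Integration.integrable_add Bochner_Integration.integrable_diff
        integrable_cauchy_kernel integrable_cnj) auto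
  then show ?thesis
    by (rule Bochner_Integration.integrable_cong[THEN iffD1, rotated 2])
      (simp_all add: mult_poisson_kernel_eq[OF _ z] del: of_real_divide space_circle)
qed

lemma poisson_int_eq:
  assumes f: "integrable circle f" and z: "norm z < 1"
  shows "poisson_int f z = cauchy_int f z + cnj (cauchy_int (\<lambda>s. cnj (f s)) z) - (\<integral>s. f s \<partial>circle)"
proof -
  have "poisson_int f z = (\<integral>s. f s * (s / (s - z)) + cnj (cnj (f s) * (s / (s - z))) - f s \<partial>circle)"
    unfolding poisson_int_def
    by (intro Bochner_Integration.integral_cong mult_poisson_kernel_eq z refl)
  also have "\<dots> = cauchy_int f z + cnj (cauchy_int (\<lambda>s. cnj (f s)) z) - (\<integral>s. f s \<partial>circle)"
    unfolding cauchy_int_def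
    using assms integrable_cauchy_kernel[OF f z] integrable_cauchy_kernel[of "\<lambda>s. cnj (f s)" z]
    by (simp add: Bochner_Integration.integral_diff Bochner_Integration.integral_add integrable_cnj
        del: complex_cnj_mult complex_cnj_divide complex_cnj_cnj)
  finally show ?thesis .
qed

lemma poisson_int_const: "norm z < 1 \<Longrightarrow> poisson_int (\<lambda>s. c) z = c"
  by (simp add: poisson_int_eq cauchy_int_const)

text \<open>The hypothesis kills all Fourier coefficients of negative index. The Cauchy integral of
  the conjugate is then constant, and its conjugate cancels the mean in
  \<open>poisson_int_eq\<close>.\<close>

lemma poisson_int_eq_cauchy_int:
  assumes f: "integrable circle f" and z: "norm z < 1"
    and m: "\<And>j. j \<ge> 1 \<Longrightarrow> (\<integral>s. f s * s ^ j \<partial>circle) = 0"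
  shows "poisson_int f z = cauchy_int f z"
proof -
  have "(\<integral>s. cnj (f s) * cnj s ^ j \<partial>circle) = cnj (\<integral>s. f s * s ^ j \<partial>circle)" for j
    using Bochner_Integration.integral_cnj[of circle "\<lambda>s. f s * s ^ j"] by simp
  then have "(\<lambda>j. (\<integral>s. cnj (f s) * cnj s ^ j \<partial>circle) * z ^ j) = (\<lambda>j. if j = 0 then cnj (\<integral>s. f s \<partial>circle) else 0)"
    using m by (auto simp: fun_eq_iff)
  moreover have "(\<lambda>j. (\<integral>s. cnj (f s) * cnj s ^ j \<partial>circle) * z ^ j) sums cauchy_int (\<lambda>s. cnj (f s)) z"
    by (rule cauchy_sums[OF _ z]) (use f in simp)
  ultimately have "cauchy_int (\<lambda>s. cnj (f s)) z = cnj (\<integral>s. f s \<partial>circle)"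
    using sums_single[of 0 "\<lambda>_. cnj (\<integral>s. f s \<partial>circle)"] sums_unique2 by metis
  then show ?thesis using poisson_int_eq[OF f z] by simp
qed

section \<open>Fatou's theorem\<close>

lemma dist_cis: "dist (cis a) (cis b) = 2 * \<bar>sin ((a - b) / 2)\<bar>"
proof -
  have "(dist (cis a) (cis b))\<^sup>2 = (cos a - cos b)\<^sup>2 + (sin a - sin b)\<^sup>2"
    by (simp add: dist_norm cmod_power2)
  also have "\<dots> = 2 - 2 * cos (a - b)"
    using sin_cos_squared_add[of a] sin_cos_squared_add[of b]
    by (simp add: cos_diff power2_eq_square algebra_simps)
  also have "\<dots> = (2 * \<bar>sin ((a - b) / 2)\<bar>)\<^sup>2"
  proof -
    define w where "w = (a - b) / 2"
    have "a - b = 2 * w" by (simp add: w_def)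
    then show ?thesis
      using cos_double_sin[of w] by (simp add: power_mult_distrib)
  qed
  finally show ?thesis by (rule power2_eq_imp_eq) auto
qed

text \<open>The chord between the parameters x and y has length 2 |sin (pi (x - y))|. The bounds on
  h keep the arc from crossing the point 1, where the parametrization jumps.\<close>

lemma arc_iff:
  assumes x: "0 < x" "x < 1" and h: "0 < h" "h < x" "h < 1 - x" and y: "0 \<le> y" "y < 1"
  shows "dist (cis (2 * pi * y)) (cis (2 * pi * x)) \<le> 2 * sin (pi * h) \<longleftrightarrow> y \<in> {x-h..x+h}"
proof -
  define w where "w = \<bar>y - x\<bar>"
  have w: "0 \<le> w" "w < 1 - h" using assms by (auto simp: w_def abs_if)
  have h2: "h < 1/2" using assms by linarith
  have "\<bar>sin (pi * (y - x))\<bar> = sin (pi * w)"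
  proof -
    have "0 \<le> sin (pi * w)" using w h by (intro sin_ge_zero) auto
    then show ?thesis by (auto simp: w_def abs_if algebra_simps) (smt (verit) sin_minus)+
  qed
  then have "dist (cis (2 * pi * y)) (cis (2 * pi * x)) \<le> 2 * sin (pi * h) \<longleftrightarrow> sin (pi * w) \<le> sin (pi * h)"
    unfolding dist_cis by (simp add: right_diff_distrib[symmetric])
  also have "\<dots> \<longleftrightarrow> w \<le> h"
  \<comment> \<open>The sine increases only up to pi / 2; a larger w is reflected to 1 - w, which
    still exceeds h because w < 1 - h.\<close>
  proof (cases "w \<le> 1/2")
    case True
    have "sin (pi * w) \<le> sin (pi * h) \<longleftrightarrow> pi * w \<le> pi * h"
    proof (rule sin_mono_le_eq)
      have "0 \<le> pi * w" "0 \<le> pi * h" using w h by auto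
      then show "- (pi / 2) \<le> pi * w" "- (pi / 2) \<le> pi * h"
        using pi_gt_zero by linarith+
      show "pi * w \<le> pi / 2" "pi * h \<le> pi / 2" using True h2
        by (simp_all add: field_simps)
    qed
    then show ?thesis by simp
  next
    case False
    have "sin (pi * h) < sin (pi * (1 - w))"
    proof (rule sin_monotone_2pi)
      have "0 \<le> pi * h" using h by auto
      then show "- (pi / 2) \<le> pi * h" using pi_gt_zero by linarith
      show "pi * h < pi * (1 - w)" using w by (simp only: mult_less_cancel_left_pos[OF pi_gt_zero])
      show "pi * (1 - w) \<le> pi / 2" using False by (simp add: field_simps)
    qed
    also have "sin (pi * (1 - w)) = sin (pi * w)" by (simp add: algebra_simps)
    finally show ?thesis using False h2 by simp
  qed
  also have "\<dots> \<longleftrightarrow> y \<in> {x-h..x+h}" by (auto simp: w_def)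
  finally show ?thesis .
qed

lemma circle_arc_integral:
  fixes g :: "complex \<Rightarrow> 'a::euclidean_space"
  assumes g: "g \<in> borel_measurable (restrict_space borel (sphere 0 1))"
    and x: "0 < x" "x < 1" and h: "0 < h" "h < x" "h < 1 - x"
    and int: "set_integrable lborel {0..<1} (\<lambda>x. g (cis (2 * pi * x)))"
  shows "(\<integral>s. indicator (cball (cis (2 * pi * x)) (2 * sin (pi * h))) s *\<^sub>R g s \<partial>circle) =
    integral {x-h..x+h} (\<lambda>x. g (cis (2 * pi * x)))"
proof -
  have "(\<integral>s. indicator (cball (cis (2 * pi * x)) (2 * sin (pi * h))) s *\<^sub>R g s \<partial>circle) =
    (LINT y:{0..<1}|lborel. indicator (cball (cis (2 * pi * x)) (2 * sin (pi * h))) (cis (2 * pi * y)) *\<^sub>R g (cis (2 * pi * y)))"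
    by (rule integral_circle_eq)
      (intro borel_measurable_scaleR g measurable_restrict_space1 borel_measurable_indicator, simp)
  also have "\<dots> = (LINT y:{x-h..x+h}|lborel. g (cis (2 * pi * y)))"
    unfolding set_lebesgue_integral_def
  proof (intro Bochner_Integration.integral_cong refl)
    fix y
    show "indicator {0..<1} y *\<^sub>R indicator (cball (cis (2 * pi * x)) (2 * sin (pi * h))) (cis (2 * pi * y)) *\<^sub>R g (cis (2 * pi * y))
      = indicator {x-h..x+h} y *\<^sub>R g (cis (2 * pi * y))"
    proof (cases "0 \<le> y \<and> y < 1")
      case True
      then have "cis (2 * pi * y) \<in> cball (cis (2 * pi * x)) (2 * sin (pi * h)) \<longleftrightarrow> y \<in> {x-h..x+h}"
        using arc_iff[OF x h, of y] by (simp only: mem_cball dist_commute)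
      then show ?thesis using True unfolding indicator_def by auto
    next
      case False
      then have "y \<notin> {x-h..x+h}" using h by auto
      then show ?thesis using False by (auto simp: indicator_def)
    qed
  qed
  also have "\<dots> = integral {x-h..x+h} (\<lambda>x. g (cis (2 * pi * x)))"
    by (rule set_borel_integral_eq_integral(2)[OF set_integrable_subset[OF int]]) (use h in auto)
  finally show ?thesis .
qed

lemma integrable_indicator_cball:
  fixes f :: "complex \<Rightarrow> 'a::{banach, second_countable_topology}"
  assumes f: "integrable circle f"
  shows "integrable circle (\<lambda>s. indicator (cball t v) s *\<^sub>R f s)"
  by (rule Bochner_Integration.integrable_bound[OF f])
    (use f in \<open>auto simp: indicator_def intro!: borel_measurable_scaleR borel_measurable_circleI\<close>)

text \<open>Discs of the plane are used instead of arcs because the Poisson kernel at r t depends on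
  s only through |s - t|. In the parameter such a disc is a symmetric interval, and the result on
  the line applies.\<close>

lemma circle_lebesgue_point:
  fixes f :: "complex \<Rightarrow> complex"
  assumes f: "integrable circle f"
  shows "AE t in circle. \<forall>\<epsilon>>0. \<exists>\<delta>>0. \<forall>v. 0 < v \<and> v < \<delta> \<longrightarrow>
    norm (\<integral>s. indicator (cball t v) s *\<^sub>R (f s - f t) \<partial>circle) \<le> \<epsilon> * (\<integral>s. indicator (cball t v) s \<partial>circle)"
proof -
  obtain g where g: "g \<in> borel_measurable (restrict_space borel (sphere 0 1))" and fg: "AE t in circle. f t = g t"
    using circle_ex_borel[of f] borel_measurable_integrable[OF f] by blast
  have gm: "g \<in> borel_measurable circle"
    unfolding circle_def by (rule measurable_completion) (use g in simp)
  have gi: "integrable circle g"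
    using integrable_cong_AE[of f circle g] f gm fg by auto
  define u where "u = (\<lambda>x. g (cis (2 * pi * x)))"
  have u: "set_integrable lborel {0..<1} u"
    using gi integrable_circle_iff[OF g] by (simp add: u_def)
  have "u integrable_on {0..<1}"
    using set_borel_integral_eq_integral(1)[OF u] .
  then have "u integrable_on cbox 0 1"
  proof (rule integrable_spike_set)
    have "{x \<in> cbox 0 1 - {0..<1}. u x \<noteq> 0} \<subseteq> {1}" by auto
    then show "negligible {x \<in> cbox 0 1 - {0..<1}. u x \<noteq> 0}"
      by (rule negligible_subset[OF negligible_sing])
    have "{x \<in> {0..<1} - cbox 0 1. u x \<noteq> 0} = {}" by auto
    then show "negligible {x \<in> {0..<1} - cbox 0 1. u x \<noteq> 0}" by (simp only: negligible_empty)
  qed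
  from symmetric_average_tendsto[OF this] obtain N where N: "negligible N"
    "\<And>x. x \<in> {0<..<1} - N \<Longrightarrow> ((\<lambda>h. (1 / h) *\<^sub>R (integral {x-h..x+h} u - (2 * h) *\<^sub>R u x)) \<longlongrightarrow> 0) (at_right 0)"
    by auto
  have "AE t in circle. \<forall>\<epsilon>>0. \<exists>\<delta>>0. \<forall>v. 0 < v \<and> v < \<delta> \<longrightarrow>
    norm (\<integral>s. indicator (cball t v) s *\<^sub>R (g s - g t) \<partial>circle) \<le> \<epsilon> * (\<integral>s. indicator (cball t v) s \<partial>circle)"
  proof (rule AE_circleI_negligible[OF N(1)], intro allI impI)
    fix x \<epsilon> :: real assume x: "0 < x" "x < 1" "x \<notin> N" and "\<epsilon> > 0"
    define t where "t = cis (2 * pi * x)"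
    have "\<forall>\<^sub>F h in at_right 0. dist ((1 / h) *\<^sub>R (integral {x-h..x+h} u - (2 * h) *\<^sub>R u x)) 0 < \<epsilon>"
      using N(2)[of x] x \<open>\<epsilon> > 0\<close> by (intro tendstoD) auto
    then obtain d where d: "d > 0" "\<And>h. 0 < h \<Longrightarrow> h < d \<Longrightarrow>
       norm ((1 / h) *\<^sub>R (integral {x-h..x+h} u - (2 * h) *\<^sub>R u x)) < \<epsilon>"
      unfolding eventually_at_right_field by auto
    \<comment> \<open>The bounds x and 1 - x keep the arcs away from the cut, and together they
      force d' <= 1/2, so that pi d' lies where \<open>arcsin\<close> inverts the sine.\<close>
    define d' where "d' = min d (min x (1 - x))"
    have d': "0 < d'" "d' \<le> 1/2" "d' \<le> d" "d' \<le> x" "d' \<le> 1 - x"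
      using d x by (auto simp: d'_def min_def)
    define \<delta> where "\<delta> = 2 * sin (pi * d')"
    have "pi * d' < pi" using d' by simp
    then have "\<delta> > 0" unfolding \<delta>_def using d' by (auto intro!: sin_gt_zero)
    moreover have "norm (\<integral>s. indicator (cball t v) s *\<^sub>R (g s - g t) \<partial>circle) \<le> \<epsilon> * (\<integral>s. indicator (cball t v) s \<partial>circle)"
      if v: "0 < v" "v < \<delta>" for v
    proof -
      \<comment> \<open>The half-width of the arc cut out by a disc of radius v, solved from v = 2
        sin (pi h).\<close>
      define h where "h = arcsin (v / 2) / pi"
      have v2: "0 < v / 2" "v / 2 < sin (pi * d')" "v / 2 < 1"
        using v sin_le_one[of "pi * d'"] unfolding \<delta>_def by linarith+
      have "arcsin 0 < arcsin (v / 2)" using v2 by (intro arcsin_less_arcsin) auto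
      then have h0: "0 < h" by (simp add: h_def)
      have "arcsin (v / 2) < arcsin (sin (pi * d'))" using v2 by (intro arcsin_less_arcsin) auto
      also have "arcsin (sin (pi * d')) = pi * d'"
      proof (rule arcsin_sin)
        have "0 \<le> pi * d'" using d' by auto
        then show "- (pi / 2) \<le> pi * d'" using pi_gt_zero by linarith
        show "pi * d' \<le> pi / 2" using d' by (simp add: field_simps)
      qed
      finally have h1: "h < d'" by (simp add: h_def field_simps)
      have vh: "v = 2 * sin (pi * h)" using v2 by (simp add: h_def)
      have hx: "h < x" "h < 1 - x" "h < d" using h1 d' by auto
      have A1: "(\<integral>s. indicator (cball t v) s *\<^sub>R g s \<partial>circle) = integral {x-h..x+h} u"
        unfolding vh t_def u_def
        by (rule circle_arc_integral) (use g x h0 hx u in \<open>auto simp: u_def\<close>)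
      have "(\<integral>s. indicator (cball t v) s *\<^sub>R (1::real) \<partial>circle) = integral {x-h..x+h} (\<lambda>_. 1)"
        unfolding vh t_def
        by (rule circle_arc_integral) (use x h0 hx in \<open>auto simp: set_integrable_def\<close>)
      then have A2: "(\<integral>s. indicator (cball t v) s \<partial>circle) = 2 * h"
        using h0 by simp
      have gt: "g t = u x" by (simp add: u_def t_def)
      have "(\<integral>s. indicator (cball t v) s *\<^sub>R (g s - g t) \<partial>circle) =
          (\<integral>s. indicator (cball t v) s *\<^sub>R g s \<partial>circle) - (\<integral>s. indicator (cball t v) s \<partial>circle) *\<^sub>R g t"
        using integrable_indicator_cball[OF gi, of t v] integrable_indicator_cball[of "\<lambda>_. 1::real" t v]
        by (simp add: scaleR_diff_right)
      also have "\<dots> = integral {x-h..x+h} u - (2 * h) *\<^sub>R u x"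
        unfolding A1 A2 gt ..
      finally have "norm (\<integral>s. indicator (cball t v) s *\<^sub>R (g s - g t) \<partial>circle) =
           norm (integral {x-h..x+h} u - (2 * h) *\<^sub>R u x)" by (rule arg_cong)
      also have "\<dots> = h * norm ((1 / h) *\<^sub>R (integral {x-h..x+h} u - (2 * h) *\<^sub>R u x))"
        unfolding norm_scaleR using h0 by simp
      also have "\<dots> \<le> h * \<epsilon>" using d(2)[OF h0 hx(3)] h0 by (intro mult_left_mono) auto
      also have "\<dots> \<le> \<epsilon> * (2 * h)" using h0 \<open>\<epsilon> > 0\<close> by simp
      finally show ?thesis unfolding A2 .
    qed
    ultimately show "\<exists>\<delta>>0. \<forall>v. 0 < v \<and> v < \<delta> \<longrightarrow>
       norm (\<integral>s. indicator (cball (cis (2 * pi * x)) v) s *\<^sub>R (g s - g (cis (2 * pi * x))) \<partial>circle)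
         \<le> \<epsilon> * (\<integral>s. indicator (cball (cis (2 * pi * x)) v) s \<partial>circle)"
      unfolding t_def[symmetric] by blast
  qed
  then show ?thesis
    using fg
  proof eventually_elim
    case (elim t)
    have "(\<integral>s. indicator (cball t v) s *\<^sub>R (f s - f t) \<partial>circle) =
        (\<integral>s. indicator (cball t v) s *\<^sub>R (g s - g t) \<partial>circle)" for v
    proof (rule integral_cong_AE)
      show "AE s in circle. indicator (cball t v) s *\<^sub>R (f s - f t) = indicator (cball t v) s *\<^sub>R (g s - g t)"
        using fg elim(2) by auto
    qed (use f gi in \<open>auto intro!: borel_measurable_integrable integrable_indicator_cball\<close>)
    then show ?case using elim(1) by simp
  qed
qed

text \<open>
  With \<open>d = |s - t|\<close> the Poisson kernel at \<open>r t\<close> is \<open>(1 - r\<^sup>2) / ((1 - r)\<^sup>2 + r d\<^sup>2)\<close>, a decreasing function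
  of \<open>d\<close>; integrating its derivative exhibits it as a mixture of normalized indicators of discs.
\<close>

definition poisson_profile :: "real \<Rightarrow> real \<Rightarrow> real" where
  "poisson_profile r d = (1 - r\<^sup>2) / ((1 - r)\<^sup>2 + r * d\<^sup>2)"

definition poisson_slope :: "real \<Rightarrow> real \<Rightarrow> real" where
  "poisson_slope r v = (1 - r\<^sup>2) * (2 * r * v) / ((1 - r)\<^sup>2 + r * v\<^sup>2)\<^sup>2"

lemma poisson_kernel_profile:
  fixes s t :: complex
  assumes t: "norm t = 1" and s: "norm s = 1" and r: "0 < r" "r < 1"
  shows "(1 - (norm (of_real r * t))\<^sup>2) / (norm (s - of_real r * t))\<^sup>2 = poisson_profile r (dist s t)"
proof -
  have "(norm (s - of_real r * t))\<^sup>2 = (1 - r)\<^sup>2 + r * (dist s t)\<^sup>2"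
  proof -
    have "(Re s)\<^sup>2 + (Im s)\<^sup>2 = 1" "(Re t)\<^sup>2 + (Im t)\<^sup>2 = 1"
      using s t by (metis cmod_power2 one_power2)+
    then show ?thesis unfolding dist_norm cmod_power2 by simp algebra
  qed
  then show ?thesis using t by (simp add: poisson_profile_def norm_mult)
qed

lemma poisson_profile_deriv:
  assumes r: "0 < r" "r < 1"
  shows "((\<lambda>v. - poisson_profile r v) has_real_derivative poisson_slope r v) (at v within S)"
proof -
  have "(1 - r)\<^sup>2 + r * v\<^sup>2 > 0" using r by (intro add_pos_nonneg) auto
  then show ?thesis
    unfolding poisson_profile_def poisson_slope_def
    by (auto intro!: derivative_eq_intros simp: divide_simps power2_eq_square)
qed

lemma continuous_poisson_slope:
  assumes r: "0 < r" "r < 1"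
  shows "continuous_on S (poisson_slope r)"
proof -
  have "(1 - r)\<^sup>2 + r * v\<^sup>2 > 0" for v using r by (intro add_pos_nonneg) auto
  then show ?thesis unfolding poisson_slope_def
    by (intro continuous_intros) (auto simp: less_imp_neq[THEN not_sym])
qed

lemma poisson_slope_nonneg: "0 < r \<Longrightarrow> r < 1 \<Longrightarrow> 0 \<le> v \<Longrightarrow> 0 \<le> poisson_slope r v"
  by (auto simp: poisson_slope_def power_le_one intro!: divide_nonneg_nonneg mult_nonneg_nonneg)

lemma poisson_profile_nonneg: "0 < r \<Longrightarrow> r < 1 \<Longrightarrow> 0 \<le> poisson_profile r v"
  by (auto simp: poisson_profile_def power_le_one intro!: divide_nonneg_nonneg mult_nonneg_nonneg add_nonneg_nonneg)

lemma poisson_slope_integral: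
  assumes r: "0 < r" "r < 1" and d: "0 \<le> d" "d \<le> 2"
  shows "set_integrable lborel {d..2} (poisson_slope r)"
    and "(LINT v:{d..2}|lborel. poisson_slope r v) = poisson_profile r d - poisson_profile r 2"
proof -
  show "set_integrable lborel {d..2} (poisson_slope r)"
    by (rule borel_integrable_atLeastAtMost') (rule continuous_poisson_slope[OF r])
  then have "(LINT v:{d..2}|lborel. poisson_slope r v) = integral {d..2} (poisson_slope r)"
    by (rule set_borel_integral_eq_integral(2))
  also have "\<dots> = - poisson_profile r 2 - - poisson_profile r d"
    by (rule integral_unique, rule fundamental_theorem_of_calculus)
      (use d poisson_profile_deriv[OF r] in \<open>auto simp: has_real_derivative_iff_has_vector_derivative[symmetric]\<close>)
  finally show "(LINT v:{d..2}|lborel. poisson_slope r v) = poisson_profile r d - poisson_profile r 2" by simp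
qed

interpretation circle_lborel: pair_sigma_finite circle "lborel :: real measure"
  by standard

text \<open>The kernel at s is its value at distance 2, the diameter, plus the integral of the slope
  over v from |s - t| to 2. Exchanging the integrals leaves a weighted integral of the masses of f
  on discs.\<close>

lemma poisson_int_layer_cake:
  assumes f: "integrable circle f" and t: "norm t = 1" and r: "0 < r" "r < 1"
  defines "D \<equiv> \<lambda>v. (\<integral>s. indicator (cball t v) s *\<^sub>R f s \<partial>circle)"
  shows "poisson_int f (of_real r * t) = of_real (poisson_profile r 2) * (\<integral>s. f s \<partial>circle) +
           (LINT v:{0..2}|lborel. poisson_slope r v *\<^sub>R D v)"
    and "set_integrable lborel {0..2} (\<lambda>v. poisson_slope r v *\<^sub>R D v)"
proof -
  define F where "F = (\<lambda>s v. (indicator {dist s t..2} v * poisson_slope r v) *\<^sub>R f s)"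
  have qm [measurable]: "poisson_slope r \<in> borel_measurable borel"
    by (rule borel_measurable_continuous_onI) (rule continuous_poisson_slope[OF r])
  have fm [measurable]: "f \<in> borel_measurable circle" using f by auto
  have dist2: "dist s t \<le> 2" if "s \<in> space circle" for s
    using norm_triangle_ineq4[of s t] that t by (simp add: dist_norm)
  have inner: "(\<integral>v. indicator {dist s t..2} v * poisson_slope r v \<partial>lborel) =
      poisson_profile r (dist s t) - poisson_profile r 2"
    and innerI: "integrable lborel (\<lambda>v. indicator {dist s t..2} v * poisson_slope r v)"
    if "s \<in> space circle" for s
    using poisson_slope_integral[OF r, of "dist s t"] dist2[OF that]
    by (auto simp: set_lebesgue_integral_def set_integrable_def)
  have Feq: "F = (\<lambda>s v. (if dist s t \<le> v \<and> v \<le> 2 then poisson_slope r v else 0) *\<^sub>R f s)"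
    by (auto simp: F_def fun_eq_iff)
  have pi: "integrable circle (\<lambda>s. f s * of_real ((1 - (norm (of_real r * t))\<^sup>2) / (norm (s - of_real r * t))\<^sup>2))"
    by (rule integrable_poisson_kernel[OF f]) (use t r in \<open>simp add: norm_mult\<close>)
  have pk: "f s * of_real ((1 - (norm (of_real r * t))\<^sup>2) / (norm (s - of_real r * t))\<^sup>2)
      - of_real (poisson_profile r 2) * f s = (poisson_profile r (dist s t) - poisson_profile r 2) *\<^sub>R f s"
    if "s \<in> space circle" for s
  proof -
    have s1: "norm s = 1" using that by simp
    show ?thesis
      unfolding poisson_kernel_profile[OF t s1 r] by (simp add: scaleR_conv_of_real algebra_simps)
  qed
  have pi': "integrable circle (\<lambda>s. (poisson_profile r (dist s t) - poisson_profile r 2) *\<^sub>R f s)"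
    by (rule Bochner_Integration.integrable_cong[THEN iffD1, OF refl pk
          Bochner_Integration.integrable_diff[OF pi integrable_mult_right[OF f]]])
  \<comment> \<open>Since the slope is nonnegative, integrating |F| over v gives back a difference
    of kernel values times |f|, so Fubini rests on the integrability of the Poisson
    integrand.\<close>
  have FI: "integrable (circle \<Otimes>\<^sub>M lborel) (case_prod F)"
  proof (rule circle_lborel.Fubini_integrable)
    show "case_prod F \<in> borel_measurable (circle \<Otimes>\<^sub>M lborel)"
      unfolding Feq by measurable
    show "integrable circle (\<lambda>s. \<integral>v. norm (case_prod F (s, v)) \<partial>lborel)"
    proof (rule Bochner_Integration.integrable_cong[THEN iffD1, OF refl _ integrable_norm[OF pi']])
      fix s assume s: "s \<in> space circle"
      have "(\<integral>v. norm (case_prod F (s, v)) \<partial>lborel) =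
          (\<integral>v. (indicator {dist s t..2} v * poisson_slope r v) * norm (f s) \<partial>lborel)"
      proof (rule Bochner_Integration.integral_cong[OF refl])
        fix v :: real
        have "0 \<le> indicator {dist s t..2} v * poisson_slope r v"
          using poisson_slope_nonneg[OF r, of v] order_trans[OF zero_le_dist, of s t v] by (auto simp: indicator_def)
        then show "norm (case_prod F (s, v)) = (indicator {dist s t..2} v * poisson_slope r v) * norm (f s)"
          unfolding F_def by (simp add: abs_of_nonneg del: abs_mult)
      qed
      also have "\<dots> = (poisson_profile r (dist s t) - poisson_profile r 2) * norm (f s)"
        using inner[OF s] by simp
      also have "\<dots> = norm ((poisson_profile r (dist s t) - poisson_profile r 2) *\<^sub>R f s)"
      proof -
        have "0 \<le> poisson_profile r (dist s t) - poisson_profile r 2"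
          unfolding inner[OF s, symmetric]
          using poisson_slope_nonneg[OF r] order_trans[OF zero_le_dist, of s t]
          by (intro Bochner_Integration.integral_nonneg) (auto simp: indicator_def)
        then show ?thesis by simp
      qed
      finally show "norm ((poisson_profile r (dist s t) - poisson_profile r 2) *\<^sub>R f s) =
          (\<integral>v. norm (case_prod F (s, v)) \<partial>lborel)" by simp
    qed
    show "AE s in circle. integrable lborel (\<lambda>v. case_prod F (s, v))"
    proof (rule AE_I2)
      fix s assume s: "s \<in> space circle"
      show "integrable lborel (\<lambda>v. case_prod F (s, v))"
        unfolding F_def using integrable_scaleR_left[of "f s" lborel, OF innerI[OF s]] by simp
    qed
  qed
  have Fv: "(\<integral>s. F s v \<partial>circle) = indicator {0..2} v *\<^sub>R (poisson_slope r v *\<^sub>R D v)" for v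
  proof -
    have "F s v = (indicator {0..2} v * poisson_slope r v) *\<^sub>R (indicator (cball t v) s *\<^sub>R f s)" for s
      using order_trans[OF zero_le_dist, of s t v]
      by (auto simp: F_def indicator_def dist_commute)
    then have "(\<integral>s. F s v \<partial>circle) = (indicator {0..2} v * poisson_slope r v) *\<^sub>R D v"
      by (simp only: D_def integral_scaleR_right)
    then show ?thesis by simp
  qed
  have "poisson_int f (of_real r * t) - of_real (poisson_profile r 2) * (\<integral>s. f s \<partial>circle)
      = (\<integral>s. f s * of_real ((1 - (norm (of_real r * t))\<^sup>2) / (norm (s - of_real r * t))\<^sup>2)
           - of_real (poisson_profile r 2) * f s \<partial>circle)"
    unfolding poisson_int_def
    using Bochner_Integration.integral_diff[OF pi integrable_mult_right[OF f, of "of_real (poisson_profile r 2)"]]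
    by (simp only: integral_mult_right_zero)
  also have "\<dots> = (\<integral>s. (poisson_profile r (dist s t) - poisson_profile r 2) *\<^sub>R f s \<partial>circle)"
    by (intro Bochner_Integration.integral_cong refl pk)
  also have "\<dots> = (\<integral>s. \<integral>v. F s v \<partial>lborel \<partial>circle)"
  proof (intro Bochner_Integration.integral_cong refl)
    fix s assume s: "s \<in> space circle"
    show "(poisson_profile r (dist s t) - poisson_profile r 2) *\<^sub>R f s = (\<integral>v. F s v \<partial>lborel)"
      unfolding F_def using integral_scaleR_left[OF innerI[OF s], of "f s"] inner[OF s] by simp
  qed
  also have "\<dots> = (\<integral>v. \<integral>s. F s v \<partial>circle \<partial>lborel)"
    by (rule circle_lborel.Fubini_integral[OF FI, symmetric])
  also have "\<dots> = (LINT v:{0..2}|lborel. poisson_slope r v *\<^sub>R D v)"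
    unfolding Fv set_lebesgue_integral_def ..
  finally show "poisson_int f (of_real r * t) = of_real (poisson_profile r 2) * (\<integral>s. f s \<partial>circle) +
           (LINT v:{0..2}|lborel. poisson_slope r v *\<^sub>R D v)" by (simp only: diff_eq_eq add.commute)
  show "set_integrable lborel {0..2} (\<lambda>v. poisson_slope r v *\<^sub>R D v)"
    using circle_lborel.integrable_snd[OF FI] unfolding Fv set_integrable_def .
qed

text \<open>At a Lebesgue point t the constant f t is subtracted. Discs of radius below \<delta> are
  controlled by a small multiple of their mass, larger discs by the L^1 norm B; the radii above
  \<delta> carry slope weight at most \<open>poisson_profile r \<delta>\<close>, which vanishes as r
  tends to 1.\<close>

theorem poisson_int_tendsto:
  assumes f: "integrable circle f"
  shows "AE t in circle. ((\<lambda>r. poisson_int f (of_real r * t)) \<longlongrightarrow> f t) (at_left 1)"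
  using circle_lebesgue_point[OF f] AE_circle_norm
proof eventually_elim
  case (elim t)
  define c where "c = f t"
  have fi: "integrable circle (\<lambda>s. f s - c)" using f by simp
  define D where "D = (\<lambda>v. \<integral>s. indicator (cball t v) s *\<^sub>R (f s - c) \<partial>circle)"
  define m where "m = (\<lambda>v. (\<integral>s. indicator (cball t v) s \<partial>circle) :: real)"
  define B where "B = (\<integral>s. norm (f s - c) \<partial>circle)"
  have B0: "0 \<le> B" unfolding B_def by simp
  have DB: "norm (D v) \<le> B" for v
  proof -
    have "norm (D v) \<le> (\<integral>s. norm (indicator (cball t v) s *\<^sub>R (f s - c)) \<partial>circle)"
      unfolding D_def by (rule integral_norm_bound)
    also have "\<dots> \<le> B" unfolding B_def
      by (intro integral_mono integrable_norm integrable_indicator_cball fi) (auto simp: indicator_def)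
    finally show ?thesis .
  qed
  have m0: "0 \<le> m v" for v unfolding m_def by simp
  show ?case
  proof (rule tendstoI)
    fix e :: real assume "e > 0"
    then have e3: "e / 3 > 0" by simp
    obtain \<delta>' where "\<delta>' > 0" "\<forall>v. 0 < v \<and> v < \<delta>' \<longrightarrow> norm (D v) \<le> e / 3 * m v"
      using elim(1)[rule_format, OF e3] unfolding D_def m_def c_def by meson
    then have \<delta>': "\<delta>' > 0" "\<And>v. 0 < v \<Longrightarrow> v < \<delta>' \<Longrightarrow> norm (D v) \<le> e / 3 * m v"
      by blast+
    define \<delta> where "\<delta> = min \<delta>' 2"
    have \<delta>: "0 < \<delta>" "\<delta> \<le> 2" "\<And>v. 0 < v \<Longrightarrow> v < \<delta> \<Longrightarrow> norm (D v) \<le> e / 3 * m v"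
      using \<delta>' by (auto simp: \<delta>_def)
    have bound: "norm (poisson_int f (of_real r * t) - c) \<le> e / 3 + 2 * (B * poisson_profile r \<delta>)"
      if r: "0 < r" "r < 1" for r
    proof -
      have rt: "norm (of_real r * t) < 1" using r elim(2) by (simp add: norm_mult)
      have Dv: "(\<integral>s. indicator (cball t v) s *\<^sub>R (f s - c) \<partial>circle) = D v" for v
        by (simp add: D_def)
      note P = poisson_int_layer_cake[OF fi elim(2) r, unfolded Dv]
      \<comment> \<open>The same decomposition for the constant 1, whose Poisson integral is 1,
        bounds the slope-weighted mass of the discs by 1.\<close>
      have one: "poisson_int (\<lambda>_. 1) (of_real r * t) = of_real (poisson_profile r 2) +
           (LINT v:{0..2}|lborel. poisson_slope r v *\<^sub>R complex_of_real (m v))"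
        and oneI: "set_integrable lborel {0..2} (\<lambda>v. poisson_slope r v *\<^sub>R complex_of_real (m v))"
      proof -
        have "(\<integral>s. indicator (cball t v) s *\<^sub>R 1 \<partial>circle) = complex_of_real (m v)" for v
          by (simp only: m_def scaleR_conv_of_real mult_1_right integral_complex_of_real)
        then show "poisson_int (\<lambda>_. 1) (of_real r * t) = of_real (poisson_profile r 2) +
           (LINT v:{0..2}|lborel. poisson_slope r v *\<^sub>R complex_of_real (m v))"
          "set_integrable lborel {0..2} (\<lambda>v. poisson_slope r v *\<^sub>R complex_of_real (m v))"
          using poisson_int_layer_cake[of "\<lambda>_. 1", OF _ elim(2) r] by auto
      qed
      have mI: "set_integrable lborel {0..2} (\<lambda>v. poisson_slope r v * m v)"
      proof -
        have "integrable lborel (\<lambda>v. complex_of_real (indicator {0..2} v *\<^sub>R (poisson_slope r v * m v)))"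
          using oneI by (simp add: set_integrable_def scaleR_conv_of_real mult_ac)
        then show ?thesis unfolding set_integrable_def complex_of_real_integrable_eq .
      qed
      have "(LINT v:{0..2}|lborel. poisson_slope r v *\<^sub>R complex_of_real (m v)) =
          complex_of_real (LINT v:{0..2}|lborel. poisson_slope r v * m v)"
        unfolding set_lebesgue_integral_def integral_complex_of_real[symmetric]
        by (simp add: scaleR_conv_of_real mult_ac)
      with one rt have "complex_of_real 1 = complex_of_real (poisson_profile r 2 + (LINT v:{0..2}|lborel. poisson_slope r v * m v))"
        by (simp add: poisson_int_const)
      then have "1 = poisson_profile r 2 + (LINT v:{0..2}|lborel. poisson_slope r v * m v)"
        by (simp only: of_real_eq_iff)
      then have mle: "(LINT v:{0..2}|lborel. poisson_slope r v * m v) \<le> 1"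
        using poisson_profile_nonneg[OF r, of 2] by linarith
      have qI: "integrable lborel (\<lambda>v. indicator {\<delta>..2} v * poisson_slope r v)"
        using poisson_slope_integral(1)[OF r, of \<delta>] \<delta> by (simp add: set_integrable_def)
      have "norm (LINT v:{0..2}|lborel. poisson_slope r v *\<^sub>R D v) \<le>
          (\<integral>v. e / 3 * (indicator {0..2} v * (poisson_slope r v * m v)) + B * (indicator {\<delta>..2} v * poisson_slope r v) \<partial>lborel)"
        unfolding set_lebesgue_integral_def
      proof (rule Bochner_Integration.integral_norm_bound_integral)
        show "integrable lborel (\<lambda>v. indicator {0..2} v *\<^sub>R poisson_slope r v *\<^sub>R D v)"
          using P(2) unfolding set_integrable_def .
        show "integrable lborel (\<lambda>v. e / 3 * (indicator {0..2} v * (poisson_slope r v * m v)) + B * (indicator {\<delta>..2} v * poisson_slope r v))"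
          using mI qI by (intro Bochner_Integration.integrable_add integrable_mult_right) (simp_all add: set_integrable_def)
        fix v :: real
        show "norm (indicator {0..2} v *\<^sub>R poisson_slope r v *\<^sub>R D v) \<le>
            e / 3 * (indicator {0..2} v * (poisson_slope r v * m v)) + B * (indicator {\<delta>..2} v * poisson_slope r v)"
        proof (cases "v \<in> {0..2}")
          case True
          note q0 = poisson_slope_nonneg[OF r, of v]
          consider "v = 0" | "0 < v" "v < \<delta>" | "\<delta> \<le> v" using True by fastforce
          then show ?thesis
          proof cases
            case 1
            then show ?thesis using \<delta>(1) by (simp add: poisson_slope_def)
          next
            case 2
            have "poisson_slope r v * norm (D v) \<le> poisson_slope r v * (e / 3 * m v)"
              using \<delta>(3)[OF 2] q0 True by (intro mult_left_mono) auto
            then show ?thesis using 2 q0 True by (simp add: indicator_def mult_ac)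
          next
            case 3
            have "poisson_slope r v * norm (D v) \<le> poisson_slope r v * B"
              using DB q0 True by (intro mult_left_mono) auto
            moreover have "0 \<le> e / 3 * (poisson_slope r v * m v)"
              using q0 True m0 \<open>e > 0\<close> by auto
            ultimately show ?thesis using 3 q0 True by (simp add: indicator_def mult_ac)
          qed
        next
          case False
          then have "v \<notin> {\<delta>..2}" using \<delta> by auto
          with False show ?thesis by simp
        qed
      qed
      also have "\<dots> = e / 3 * (LINT v:{0..2}|lborel. poisson_slope r v * m v) + B * (LINT v:{\<delta>..2}|lborel. poisson_slope r v)"
        using mI qI by (subst Bochner_Integration.integral_add) (auto simp: set_lebesgue_integral_def set_integrable_def)
      also have "\<dots> \<le> e / 3 * 1 + B * poisson_profile r \<delta>"
      proof (intro add_mono mult_left_mono mle B0)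
        show "(LINT v:{\<delta>..2}|lborel. poisson_slope r v) \<le> poisson_profile r \<delta>"
          using poisson_slope_integral(2)[OF r, of \<delta>] \<delta> poisson_profile_nonneg[OF r, of 2] by simp
      qed (use \<open>e > 0\<close> in auto)
      finally have part: "norm (LINT v:{0..2}|lborel. poisson_slope r v *\<^sub>R D v) \<le> e / 3 + B * poisson_profile r \<delta>" by simp
      have "poisson_int f (of_real r * t) - c = poisson_int (\<lambda>s. f s - c) (of_real r * t)"
      proof -
        have "integrable circle (\<lambda>_. c)" by simp
        from Bochner_Integration.integral_diff[OF integrable_poisson_kernel[OF f rt] integrable_poisson_kernel[OF this rt]]
        have "poisson_int (\<lambda>s. f s - c) (of_real r * t) = poisson_int f (of_real r * t) - poisson_int (\<lambda>_. c) (of_real r * t)"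
          unfolding poisson_int_def by (simp only: left_diff_distrib)
        then show ?thesis by (simp only: poisson_int_const[OF rt])
      qed
      also have "norm \<dots> \<le> norm (of_real (poisson_profile r 2) * (\<integral>s. f s - c \<partial>circle)) +
          norm (LINT v:{0..2}|lborel. poisson_slope r v *\<^sub>R D v)"
        unfolding P(1) by (rule norm_triangle_ineq)
      also have "norm (of_real (poisson_profile r 2) * (\<integral>s. f s - c \<partial>circle)) \<le> poisson_profile r \<delta> * B"
        unfolding norm_mult
      proof (rule mult_mono)
        have "0 \<le> (LINT v:{\<delta>..2}|lborel. poisson_slope r v)"
          unfolding set_lebesgue_integral_def using poisson_slope_nonneg[OF r] \<delta>
          by (intro Bochner_Integration.integral_nonneg) (auto simp: indicator_def)
        then show "norm (complex_of_real (poisson_profile r 2)) \<le> poisson_profile r \<delta>"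
          using poisson_slope_integral(2)[OF r, of \<delta>] \<delta> poisson_profile_nonneg[OF r, of 2] by simp
        show "norm (\<integral>s. f s - c \<partial>circle) \<le> B" unfolding B_def by (rule integral_norm_bound)
      qed (use poisson_profile_nonneg[OF r] in auto)
      finally show ?thesis using part by (simp add: mult_ac)
    qed
    have "((\<lambda>r. (1 - r\<^sup>2) / ((1 - r)\<^sup>2 + r * \<delta>\<^sup>2)) \<longlongrightarrow> (1 - 1\<^sup>2) / ((1 - 1)\<^sup>2 + 1 * \<delta>\<^sup>2)) (at_left 1)"
      using \<delta>(1) by (intro tendsto_intros) auto
    then have "((\<lambda>r. e / 3 + 2 * (B * poisson_profile r \<delta>)) \<longlongrightarrow> e / 3 + 2 * (B * 0)) (at_left 1)"
      unfolding poisson_profile_def by (intro tendsto_intros) simp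
    moreover have "e / 3 + 2 * (B * 0) < e" using \<open>e > 0\<close> by simp
    ultimately have "\<forall>\<^sub>F r in at_left 1. e / 3 + 2 * (B * poisson_profile r \<delta>) < e"
      by (rule order_tendstoD)
    moreover have "\<forall>\<^sub>F r in at_left (1::real). 0 < r \<and> r < 1"
      using eventually_at_left_real[of 0 1] by simp
    ultimately show "\<forall>\<^sub>F r in at_left 1. dist (poisson_int f (of_real r * t)) (f t) < e"
    proof eventually_elim
      case (elim r)
      then show ?case using bound[of r] by (simp add: dist_norm c_def)
    qed
  qed
qed

section \<open>Complex semi-Hilbert spaces\<close>

text \<open>Null vectors are allowed, since vectors are functions and almost-everywhere equal ones
  are not identified. Scalar multiplication is a parameter because it has to be complex both on
  scalar functions and on functions into \<open>complex^2\<close>.\<close>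

locale semi_inner_space =
  fixes V :: "'a::ab_group_add set" and sc :: "complex \<Rightarrow> 'a \<Rightarrow> 'a" and ip :: "'a \<Rightarrow> 'a \<Rightarrow> complex"
  assumes zero_in [simp]: "0 \<in> V"
    and add_in [simp]: "x \<in> V \<Longrightarrow> y \<in> V \<Longrightarrow> x + y \<in> V"
    and sc_in [simp]: "x \<in> V \<Longrightarrow> sc c x \<in> V"
    and sc_minus_one: "sc (-1) x = - x"
    and sc_diff: "sc c (x - y) = sc c x - sc c y"
    and ip_add_left: "x \<in> V \<Longrightarrow> y \<in> V \<Longrightarrow> z \<in> V \<Longrightarrow> ip (x + y) z = ip x z + ip y z"
    and ip_sc_left: "x \<in> V \<Longrightarrow> z \<in> V \<Longrightarrow> ip (sc c x) z = c * ip x z"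
    and ip_cnj: "x \<in> V \<Longrightarrow> y \<in> V \<Longrightarrow> ip y x = cnj (ip x y)"
    and ip_nonneg: "x \<in> V \<Longrightarrow> 0 \<le> Re (ip x x)"
begin

definition nrm :: "'a \<Rightarrow> real" where
  "nrm x = sqrt (Re (ip x x))"

lemma minus_in [simp]: "x \<in> V \<Longrightarrow> - x \<in> V"
  using sc_in[of x "-1"] by (simp add: sc_minus_one)

lemma diff_in [simp]: "x \<in> V \<Longrightarrow> y \<in> V \<Longrightarrow> x - y \<in> V"
  using add_in[of x "- y"] by simp

lemma ip_minus_left: "x \<in> V \<Longrightarrow> z \<in> V \<Longrightarrow> ip (- x) z = - ip x z"
  using ip_sc_left[of x z "-1"] by (simp add: sc_minus_one)

lemma ip_diff_left: "x \<in> V \<Longrightarrow> y \<in> V \<Longrightarrow> z \<in> V \<Longrightarrow> ip (x - y) z = ip x z - ip y z"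
  using ip_add_left[of x "- y" z] by (simp add: ip_minus_left)

lemma ip_add_right: "x \<in> V \<Longrightarrow> y \<in> V \<Longrightarrow> z \<in> V \<Longrightarrow> ip z (x + y) = ip z x + ip z y"
  by (simp add: ip_cnj[of _ z] ip_add_left)

lemma ip_sc_right: "x \<in> V \<Longrightarrow> z \<in> V \<Longrightarrow> ip z (sc c x) = cnj c * ip z x"
  by (simp add: ip_cnj[of _ z] ip_sc_left)

lemma ip_minus_right: "x \<in> V \<Longrightarrow> z \<in> V \<Longrightarrow> ip z (- x) = - ip z x"
  by (simp add: ip_cnj[of _ z] ip_minus_left)

lemma ip_diff_right: "x \<in> V \<Longrightarrow> y \<in> V \<Longrightarrow> z \<in> V \<Longrightarrow> ip z (x - y) = ip z x - ip z y"
  by (simp add: ip_cnj[of _ z] ip_diff_left)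

lemma ip_zero_left [simp]: "z \<in> V \<Longrightarrow> ip 0 z = 0"
  using ip_diff_left[of 0 0 z] by simp

lemma ip_zero_right [simp]: "z \<in> V \<Longrightarrow> ip z 0 = 0"
  using ip_diff_right[of 0 0 z] by simp

lemmas ip_simps = ip_add_left ip_add_right ip_diff_left ip_diff_right ip_sc_left ip_sc_right
  ip_minus_left ip_minus_right

lemma ip_self: "x \<in> V \<Longrightarrow> ip x x = of_real ((nrm x)\<^sup>2)"
  using ip_cnj[of x x] ip_nonneg[of x] by (simp add: nrm_def complex_eq_iff)

lemma nrm_nonneg [simp]: "x \<in> V \<Longrightarrow> 0 \<le> nrm x"
  by (simp add: nrm_def ip_nonneg)

lemma nrm_sq: "x \<in> V \<Longrightarrow> (nrm x)\<^sup>2 = Re (ip x x)"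
  by (simp add: nrm_def ip_nonneg)

lemma nrm_sc: "x \<in> V \<Longrightarrow> nrm (sc c x) = cmod c * nrm x"
proof -
  assume x: "x \<in> V"
  have "complex_of_real ((nrm (sc c x))\<^sup>2) = c * (cnj c * of_real ((nrm x)\<^sup>2))"
    using x by (simp only: ip_self[symmetric] sc_in ip_sc_left ip_sc_right mult.left_commute)
  also have "\<dots> = of_real ((cmod c * nrm x)\<^sup>2)"
    by (simp add: power_mult_distrib mult.assoc[symmetric] complex_norm_square[symmetric])
  finally have "(nrm (sc c x))\<^sup>2 = (cmod c * nrm x)\<^sup>2" by (simp only: of_real_eq_iff)
  then show ?thesis using x by (simp add: power2_eq_imp_eq)
qed

lemma nrm_minus [simp]: "x \<in> V \<Longrightarrow> nrm (- x) = nrm x"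
  by (simp add: nrm_def ip_simps)

lemma nrm_minus_commute: "x \<in> V \<Longrightarrow> y \<in> V \<Longrightarrow> nrm (x - y) = nrm (y - x)"
  using nrm_minus[of "x - y"] by simp

lemma nrm_zero [simp]: "nrm 0 = 0"
  by (simp add: nrm_def)

lemma nrm_sq_add: "x \<in> V \<Longrightarrow> y \<in> V \<Longrightarrow> (nrm (x + y))\<^sup>2 = (nrm x)\<^sup>2 + (nrm y)\<^sup>2 + 2 * Re (ip x y)"
  by (simp add: nrm_sq ip_simps ip_cnj[of x y])

lemma nrm_sq_diff: "x \<in> V \<Longrightarrow> y \<in> V \<Longrightarrow> (nrm (x - y))\<^sup>2 = (nrm x)\<^sup>2 + (nrm y)\<^sup>2 - 2 * Re (ip x y)"
  by (simp add: nrm_sq ip_simps ip_cnj[of x y])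

text \<open>Nonnegativity of the squared norm of x - s <x, y> y for all real s. For a null vector y
  there is no optimal s, and <x, y> = 0 is extracted by a large s.\<close>

lemma Cauchy_Schwarz: "x \<in> V \<Longrightarrow> y \<in> V \<Longrightarrow> cmod (ip x y) \<le> nrm x * nrm y"
proof -
  assume x: "x \<in> V" and y: "y \<in> V"
  have *: "0 \<le> (nrm x)\<^sup>2 + (s * cmod (ip x y))\<^sup>2 * (nrm y)\<^sup>2 - 2 * s * (cmod (ip x y))\<^sup>2" for s :: real
  proof -
    have "0 \<le> (nrm (x - sc (of_real s * ip x y) y))\<^sup>2" by simp
    also have "\<dots> = (nrm x)\<^sup>2 + (s * cmod (ip x y))\<^sup>2 * (nrm y)\<^sup>2 - 2 * s * (cmod (ip x y))\<^sup>2"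
      using x y
      by (simp add: nrm_sq_diff nrm_sc norm_mult ip_simps power_mult_distrib cmod_power2 algebra_simps)
        (simp add: power2_eq_square algebra_simps)
    finally show ?thesis .
  qed
  show ?thesis
  proof (cases "nrm y = 0")
    case True
    show ?thesis
    proof (cases "ip x y = 0")
      case False
      then have p: "(cmod (ip x y))\<^sup>2 > 0" by simp
      \<comment> \<open>This s makes the linear term 2 (nrm x)^2 + 2, which cannot be at most (nrm
        x)^2.\<close>
      have "2 * (((nrm x)\<^sup>2 + 1) / (cmod (ip x y))\<^sup>2) * (cmod (ip x y))\<^sup>2 \<le> (nrm x)\<^sup>2"
        using *[of "((nrm x)\<^sup>2 + 1) / (cmod (ip x y))\<^sup>2"] True by simp
      then have "(nrm x)\<^sup>2 + 2 \<le> 0" using p by simp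
      then show ?thesis using zero_le_power2[of "nrm x"] by linarith
    qed (use True in simp)
  next
    case False
    then have p: "(nrm y)\<^sup>2 > 0" by simp
    define Y where "Y = (nrm y)\<^sup>2"
    have Y: "Y \<noteq> 0" using p by (simp add: Y_def)
    have "(1 / Y * c)\<^sup>2 * Y - 2 * (1 / Y) * c\<^sup>2 = - (c\<^sup>2 / Y)" for c :: real
      using Y by (simp add: power2_eq_square divide_simps)
    from this[of "cmod (ip x y)"] have "0 \<le> (nrm x)\<^sup>2 - (cmod (ip x y))\<^sup>2 / (nrm y)\<^sup>2"
      using *[of "1 / Y"] unfolding Y_def[symmetric] by linarith
    then have "(cmod (ip x y))\<^sup>2 \<le> (nrm x * nrm y)\<^sup>2"
      by (simp only: le_diff_eq add_0 pos_divide_le_eq[OF p] power_mult_distrib)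
    then show ?thesis by (rule power2_le_imp_le) (use x y in simp)
  qed
qed

lemma nrm_triangle: "x \<in> V \<Longrightarrow> y \<in> V \<Longrightarrow> nrm (x + y) \<le> nrm x + nrm y"
proof (rule power2_le_imp_le)
  assume x: "x \<in> V" and y: "y \<in> V"
  have "Re (ip x y) \<le> nrm x * nrm y"
    using Cauchy_Schwarz[OF x y] complex_Re_le_cmod order_trans by blast
  then show "(nrm (x + y))\<^sup>2 \<le> (nrm x + nrm y)\<^sup>2"
    using x y by (simp add: nrm_sq_add power2_sum)
qed simp

lemma nrm_triangle_diff: "x \<in> V \<Longrightarrow> y \<in> V \<Longrightarrow> z \<in> V \<Longrightarrow> nrm (x - z) \<le> nrm (x - y) + nrm (y - z)"
  using nrm_triangle[of "x - y" "y - z"] by simp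

lemma ip_eq_0_null: "x \<in> V \<Longrightarrow> y \<in> V \<Longrightarrow> nrm x = 0 \<Longrightarrow> ip x y = 0"
  using Cauchy_Schwarz[of x y] by simp

lemma ip_eq_0_null_right: "x \<in> V \<Longrightarrow> y \<in> V \<Longrightarrow> nrm y = 0 \<Longrightarrow> ip x y = 0"
  using Cauchy_Schwarz[of x y] by simp

lemma ip_cong_left: "x \<in> V \<Longrightarrow> y \<in> V \<Longrightarrow> z \<in> V \<Longrightarrow> nrm (x - y) = 0 \<Longrightarrow> ip x z = ip y z"
  using ip_eq_0_null[of "x - y" z] by (simp add: ip_diff_left)

lemma ip_cong_right: "x \<in> V \<Longrightarrow> y \<in> V \<Longrightarrow> z \<in> V \<Longrightarrow> nrm (x - y) = 0 \<Longrightarrow> ip z x = ip z y"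
  using ip_eq_0_null_right[of z "x - y"] by (simp add: ip_diff_right)

lemma nrm_cong: "x \<in> V \<Longrightarrow> y \<in> V \<Longrightarrow> nrm (x - y) = 0 \<Longrightarrow> nrm x = nrm y"
  using nrm_triangle[of "x - y" y] nrm_triangle[of "y - x" x] nrm_minus_commute[of x y] by simp

lemma ip_tendsto_left:
  assumes "\<And>n. X n \<in> V" "x \<in> V" "y \<in> V" "(\<lambda>n. nrm (X n - x)) \<longlonglongrightarrow> 0"
  shows "(\<lambda>n. ip (X n) y) \<longlonglongrightarrow> ip x y"
proof -
  have "(\<lambda>n. ip (X n - x) y) \<longlonglongrightarrow> 0"
  proof (rule Lim_null_comparison)
    show "\<forall>\<^sub>F n in sequentially. norm (ip (X n - x) y) \<le> nrm (X n - x) * nrm y"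
      using assms by (auto intro!: always_eventually Cauchy_Schwarz)
    show "(\<lambda>n. nrm (X n - x) * nrm y) \<longlonglongrightarrow> 0"
      using tendsto_mult_right[OF assms(4), of "nrm y"] by simp
  qed
  then show ?thesis using assms by (simp add: ip_diff_left LIM_zero_iff)
qed

lemma sum_in: "(\<And>i. i \<in> I \<Longrightarrow> f i \<in> V) \<Longrightarrow> sum f I \<in> V"
  by (induction I rule: infinite_finite_induct) auto

lemma ip_sum_left: "(\<And>i. i \<in> I \<Longrightarrow> f i \<in> V) \<Longrightarrow> x \<in> V \<Longrightarrow> ip (sum f I) x = (\<Sum>i\<in>I. ip (f i) x)"
  by (induction I rule: infinite_finite_induct) (auto simp: ip_add_left sum_in)

lemma nrm_sq_orthonormal_sum:
  assumes e: "\<And>i. e i \<in> V" "\<And>i j. ip (e i) (e j) = (if i = j then 1 else 0)" and I: "finite I"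
  shows "(nrm (\<Sum>i\<in>I. sc (b i) (e i)))\<^sup>2 = (\<Sum>i\<in>I. (cmod (b i))\<^sup>2)"
  using I
proof induction
  case (insert k I)
  have "ip (sc (b k) (e k)) (\<Sum>i\<in>I. sc (b i) (e i)) = cnj (ip (\<Sum>i\<in>I. sc (b i) (e i)) (sc (b k) (e k)))"
    by (intro ip_cnj sum_in sc_in e)
  also have "ip (\<Sum>i\<in>I. sc (b i) (e i)) (sc (b k) (e k)) = (\<Sum>i\<in>I. 0)"
    unfolding ip_sum_left[OF sc_in[OF e(1)] sc_in[OF e(1)]]
    by (rule sum.cong) (use insert e in \<open>auto simp: ip_simps\<close>)
  finally have "ip (sc (b k) (e k)) (\<Sum>i\<in>I. sc (b i) (e i)) = 0" by simp
  moreover have "(nrm (e k))\<^sup>2 = 1" using e by (simp add: nrm_sq)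
  ultimately show ?case using insert e
    by (simp add: nrm_sq_add sum_in nrm_sc power_mult_distrib)
qed simp

lemma Bessel:
  assumes e: "\<And>i. e i \<in> V" "\<And>i j. ip (e i) (e j) = (if i = j then 1 else 0)" and I: "finite I" and x: "x \<in> V"
  shows "(\<Sum>i\<in>I. (cmod (ip x (e i)))\<^sup>2) \<le> (nrm x)\<^sup>2"
proof -
  define S where "S = (\<Sum>i\<in>I. sc (ip x (e i)) (e i))"
  have S: "S \<in> V" unfolding S_def by (intro sum_in sc_in e)
  have "ip S x = (\<Sum>i\<in>I. of_real ((cmod (ip x (e i)))\<^sup>2))"
    unfolding S_def ip_sum_left[OF sc_in[OF e(1)] x]
    by (rule sum.cong) (use e x in \<open>auto simp: ip_simps ip_cnj[of x] complex_norm_square simp del: of_real_power\<close>)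
  then have "Re (ip S x) = (\<Sum>i\<in>I. (cmod (ip x (e i)))\<^sup>2)"
    by (simp only: of_real_sum[symmetric] Re_complex_of_real)
  moreover have "(nrm S)\<^sup>2 = (\<Sum>i\<in>I. (cmod (ip x (e i)))\<^sup>2)"
    unfolding S_def by (rule nrm_sq_orthonormal_sum[OF e I])
  ultimately show ?thesis
    using nrm_sq_diff[OF S x] zero_le_power2[of "nrm (S - x)"] by linarith
qed

text \<open>Closedness refers to the seminorm, so with a vector such a set contains every vector of
  \<open>V\<close> at distance zero from it: these are the subspaces saturated under null
  differences.\<close>

definition closed_subspace :: "'a set \<Rightarrow> bool" where
  "closed_subspace S \<longleftrightarrow> S \<subseteq> V \<and> 0 \<in> S \<and> (\<forall>x\<in>S. \<forall>y\<in>S. x + y \<in> S) \<and> (\<forall>c. \<forall>x\<in>S. sc c x \<in> S) \<and>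
     (\<forall>x\<in>V. (\<forall>e>0. \<exists>g\<in>S. nrm (x - g) < e) \<longrightarrow> x \<in> S)"

lemma
  assumes "closed_subspace S"
  shows csub_V: "x \<in> S \<Longrightarrow> x \<in> V"
    and csub_zero: "0 \<in> S"
    and csub_add: "x \<in> S \<Longrightarrow> y \<in> S \<Longrightarrow> x + y \<in> S"
    and csub_sc: "x \<in> S \<Longrightarrow> sc c x \<in> S"
    and csub_minus: "x \<in> S \<Longrightarrow> - x \<in> S"
    and csub_diff: "x \<in> S \<Longrightarrow> y \<in> S \<Longrightarrow> x - y \<in> S"
    and csub_closed: "x \<in> V \<Longrightarrow> (\<And>e. e > 0 \<Longrightarrow> \<exists>g\<in>S. nrm (x - g) < e) \<Longrightarrow> x \<in> S"
proof -
  show m: "- x \<in> S" if "x \<in> S" for x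
    using that assms unfolding closed_subspace_def by (metis sc_minus_one)
  then show "x - y \<in> S" if "x \<in> S" "y \<in> S" for x y
    using that assms unfolding closed_subspace_def by (metis add_uminus_conv_diff)
qed (use assms in \<open>auto simp: closed_subspace_def\<close>)

lemma csub_null:
  assumes S: "closed_subspace S" and x: "x \<in> S" and y: "y \<in> V" "nrm (y - x) = 0"
  shows "y \<in> S"
proof (rule csub_closed[OF S y(1)])
  fix e :: real assume "e > 0"
  then show "\<exists>g\<in>S. nrm (y - g) < e" using x y by (intro bexI[of _ x]) auto
qed

lemma csub_lim:
  assumes S: "closed_subspace S" and X: "\<And>n. X n \<in> S" and x: "x \<in> V" and lim: "(\<lambda>n. nrm (X n - x)) \<longlonglongrightarrow> 0"
  shows "x \<in> S"
proof (rule csub_closed[OF S x])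
  fix e :: real assume "e > 0"
  then have "\<forall>\<^sub>F n in sequentially. nrm (X n - x) < e"
    by (rule order_tendstoD(2)[OF lim])
  then obtain n where "nrm (X n - x) < e" by (auto simp: eventually_sequentially)
  then show "\<exists>g\<in>S. nrm (x - g) < e"
    using X[of n] nrm_minus_commute[OF csub_V[OF S X[of n]] x] by auto
qed

end

locale semi_hilbert = semi_inner_space +
  assumes complete: "(\<And>n::nat. X n \<in> V) \<Longrightarrow>
      (\<And>e. e > 0 \<Longrightarrow> \<exists>N. \<forall>m\<ge>N. \<forall>n\<ge>N. nrm (X m - X n) < e) \<Longrightarrow> \<exists>x\<in>V. (\<lambda>n. nrm (X n - x)) \<longlonglongrightarrow> 0"
begin

text \<open>By the parallelogram law a minimizing sequence is Cauchy; its limit attains the distance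
  d, and minimality under variation by multiples of g forces orthogonality.\<close>

lemma projection_exists:
  assumes S: "closed_subspace S" and x: "x \<in> V"
  shows "\<exists>p\<in>S. \<forall>g\<in>S. ip (x - p) g = 0"
proof -
  note SV = csub_V[OF S]
  define d where "d = (INF g\<in>S. nrm (x - g))"
  have bdd: "bdd_below ((\<lambda>g. nrm (x - g)) ` S)"
    using x SV by (intro bdd_belowI[of _ 0]) auto
  have ne: "S \<noteq> {}" using csub_zero[OF S] by auto
  have dle: "d \<le> nrm (x - g)" if "g \<in> S" for g
    unfolding d_def by (rule cINF_lower[OF bdd that])
  have d0: "0 \<le> d" unfolding d_def using x SV ne by (intro cINF_greatest) auto
  have "\<exists>g\<in>S. nrm (x - g) < d + 1 / Suc n" for n
    using cINF_less_iff[OF ne bdd, of "d + 1 / Suc n"] by (simp add: d_def)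
  then obtain X where X: "\<And>n. X n \<in> S" "\<And>n. nrm (x - X n) < d + 1 / Suc n" by metis
  have XV: "X n \<in> V" for n using X SV by auto
  have lim: "(\<lambda>n. nrm (x - X n)) \<longlonglongrightarrow> d"
  proof (rule tendsto_sandwich[where f="\<lambda>_. d" and h="\<lambda>n. d + 1 / Suc n"])
    show "(\<lambda>n. d + 1 / Suc n) \<longlonglongrightarrow> d"
      using tendsto_add[OF tendsto_const[of d] LIMSEQ_inverse_real_of_nat] by (simp add: inverse_eq_divide)
  qed (use X dle in \<open>auto intro!: always_eventually less_imp_le\<close>)
  have par: "(nrm (X m - X n))\<^sup>2 \<le> 2 * ((nrm (x - X m))\<^sup>2 - d\<^sup>2) + 2 * ((nrm (x - X n))\<^sup>2 - d\<^sup>2)" for m n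
  proof -
    define a b where "a = x - X m" and "b = x - X n"
    have ab: "a \<in> V" "b \<in> V" using x XV by (auto simp: a_def b_def)
    have "sc (1/2) (X m + X n) \<in> S" using X by (intro csub_sc[OF S] csub_add[OF S])
    then have "d\<^sup>2 \<le> (nrm (x - sc (1/2) (X m + X n)))\<^sup>2"
      using dle d0 by (intro power_mono) auto
    also have "\<dots> = (nrm x)\<^sup>2 + (nrm (X m + X n))\<^sup>2 / 4 - Re (ip x (X m) + ip x (X n))"
      using x XV by (simp add: nrm_sq_diff nrm_sc ip_simps power_divide add_divide_distrib)
    finally have "4 * d\<^sup>2 \<le> 4 * (nrm x)\<^sup>2 + (nrm (X m + X n))\<^sup>2 - 4 * Re (ip x (X m) + ip x (X n))"
      by simp
    then show ?thesis using x XV by (simp add: nrm_sq_diff nrm_sq_add)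
  qed
  obtain p where p: "p \<in> V" "(\<lambda>n. nrm (X n - p)) \<longlonglongrightarrow> 0"
  proof (rule bexE[OF complete[of X]])
    fix e :: real assume "e > 0"
    have "(\<lambda>n. 2 * ((nrm (x - X n))\<^sup>2 - d\<^sup>2)) \<longlonglongrightarrow> 2 * (d\<^sup>2 - d\<^sup>2)"
      by (intro tendsto_intros lim)
    then have "\<forall>\<^sub>F n in sequentially. 2 * ((nrm (x - X n))\<^sup>2 - d\<^sup>2) < e\<^sup>2 / 2"
      by (rule order_tendstoD) (use \<open>e > 0\<close> in auto)
    then obtain N where N: "\<And>n. n \<ge> N \<Longrightarrow> 2 * ((nrm (x - X n))\<^sup>2 - d\<^sup>2) < e\<^sup>2 / 2"
      by (auto simp: eventually_sequentially)
    have "nrm (X m - X n) < e" if "m \<ge> N" "n \<ge> N" for m n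
    proof (rule power2_less_imp_less)
      show "(nrm (X m - X n))\<^sup>2 < e\<^sup>2" using par[of m n] N[OF that(1)] N[OF that(2)] by linarith
    qed (use \<open>e > 0\<close> in simp)
    then show "\<exists>N. \<forall>m\<ge>N. \<forall>n\<ge>N. nrm (X m - X n) < e" by blast
  qed (use XV in auto)
  have pS: "p \<in> S" by (rule csub_lim[OF S X(1) p])
  have "nrm (x - p) \<le> d"
  proof (rule LIMSEQ_le_const)
    show "(\<lambda>n. nrm (x - X n) + nrm (X n - p)) \<longlonglongrightarrow> d"
      using tendsto_add[OF lim p(2)] by simp
    show "\<exists>N. \<forall>n\<ge>N. nrm (x - p) \<le> nrm (x - X n) + nrm (X n - p)"
      using x XV p by (auto intro!: nrm_triangle_diff)
  qed
  then have npd: "nrm (x - p) = d" using dle[OF pS] by simp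
  have "ip (x - p) g = 0" if g: "g \<in> S" for g
  proof -
    define y where "y = x - p"
    have y: "y \<in> V" "nrm y = d" and gV: "g \<in> V" using x p npd g SV by (auto simp: y_def)
    have *: "2 * s * (cmod (ip y g))\<^sup>2 \<le> (s * cmod (ip y g))\<^sup>2 * (nrm g)\<^sup>2" for s :: real
    proof -
      have "p + sc (of_real s * ip y g) g \<in> S" using pS g by (intro csub_add[OF S] csub_sc[OF S])
      then have "d \<le> nrm (y - sc (of_real s * ip y g) g)" using dle unfolding y_def by (simp add: diff_diff_add)
      then have "d\<^sup>2 \<le> (nrm (y - sc (of_real s * ip y g) g))\<^sup>2" using d0 by (intro power_mono) auto
      also have "\<dots> = d\<^sup>2 + (s * cmod (ip y g))\<^sup>2 * (nrm g)\<^sup>2 - 2 * s * (cmod (ip y g))\<^sup>2"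
        using y gV
        by (simp add: nrm_sq_diff nrm_sc norm_mult ip_simps power_mult_distrib cmod_power2 algebra_simps)
          (simp add: power2_eq_square algebra_simps)
      finally show ?thesis by simp
    qed
    \<comment> \<open>The parameter 1 / ((nrm g)^2 + 1) makes sense also for a null vector g, and it
      is small enough for the linear term to dominate the quadratic one.\<close>
    have "2 * (1 / ((nrm g)\<^sup>2 + 1)) \<le> (1 / ((nrm g)\<^sup>2 + 1))\<^sup>2 * (nrm g)\<^sup>2" if "cmod (ip y g) \<noteq> 0"
    proof -
      have "0 < (cmod (ip y g))\<^sup>2" using that by simp
      moreover have "(2 * (1 / ((nrm g)\<^sup>2 + 1))) * (cmod (ip y g))\<^sup>2 \<le> ((1 / ((nrm g)\<^sup>2 + 1))\<^sup>2 * (nrm g)\<^sup>2) * (cmod (ip y g))\<^sup>2"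
        using *[of "1 / ((nrm g)\<^sup>2 + 1)"] by (simp add: power_mult_distrib power_divide mult_ac)
      ultimately show ?thesis by (simp only: mult_le_cancel_right_pos)
    qed
    moreover have "(1 / ((nrm g)\<^sup>2 + 1))\<^sup>2 * (nrm g)\<^sup>2 < 2 * (1 / ((nrm g)\<^sup>2 + 1))"
    proof -
      have "0 < (nrm g)\<^sup>2 + 1" using zero_le_power2[of "nrm g"] by linarith
      then show ?thesis by (simp add: power_divide divide_simps power2_eq_square[of "_ + 1"])
    qed
    ultimately show ?thesis unfolding y_def by fastforce
  qed
  then show ?thesis using pS by blast
qed

text \<open>Fixed point iteration for x = v + \<zeta> A x, a contraction with factor |\<zeta>|. A
  Lipschitz bound stands in for linearity of A, since operators built from \<open>SOME\<close> are
  linear only up to null vectors; accordingly the equation is solved up to a null vector.\<close>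

lemma resolvent_exists:
  assumes S: "closed_subspace S" and A: "\<And>x. x \<in> S \<Longrightarrow> A x \<in> S"
    and lip: "\<And>x y. x \<in> S \<Longrightarrow> y \<in> S \<Longrightarrow> nrm (A x - A y) \<le> nrm (x - y)"
    and z: "cmod \<zeta> < 1" and v: "v \<in> S"
  shows "\<exists>x\<in>S. nrm (x - sc \<zeta> (A x) - v) = 0"
proof -
  note SV = csub_V[OF S]
  define T where "T = (\<lambda>x. v + sc \<zeta> (A x))"
  define X where "X = rec_nat 0 (\<lambda>_. T)"
  have X0: "X 0 = 0" and XS: "X (Suc n) = T (X n)" for n by (auto simp: X_def)
  have TS: "T x \<in> S" if "x \<in> S" for x unfolding T_def using that v A by (intro csub_add[OF S] csub_sc[OF S])
  have XinS: "X n \<in> S" for n by (induction n) (auto simp: X0 XS TS csub_zero[OF S])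
  have XV: "X n \<in> V" for n using XinS SV by blast
  have Tlip: "nrm (T x - T y) \<le> cmod \<zeta> * nrm (x - y)" if "x \<in> S" "y \<in> S" for x y
  proof -
    have "T x - T y = sc \<zeta> (A x - A y)" using that A by (simp add: T_def sc_diff)
    then show ?thesis using that A SV lip[OF that] by (simp add: nrm_sc mult_left_mono)
  qed
  have step: "nrm (X (Suc n) - X n) \<le> cmod \<zeta> ^ n * nrm (X 1)" for n
  proof (induction n)
    case (Suc n)
    have "nrm (X (Suc (Suc n)) - X (Suc n)) \<le> cmod \<zeta> * nrm (X (Suc n) - X n)"
      unfolding XS[of "Suc n"] XS[of n] by (rule order_trans[OF Tlip]) (auto simp: XS TS XinS)
    also have "\<dots> \<le> cmod \<zeta> * (cmod \<zeta> ^ n * nrm (X 1))" by (intro mult_left_mono Suc) auto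
    finally show ?case by (simp add: mult_ac)
  qed (simp add: X0)
  have tail: "nrm (X (n + k) - X n) \<le> cmod \<zeta> ^ n * nrm (X 1) / (1 - cmod \<zeta>)" for n k
  proof -
    have "nrm (X (n + k) - X n) \<le> cmod \<zeta> ^ n * nrm (X 1) * (\<Sum>i<k. cmod \<zeta> ^ i)"
    proof (induction k)
      case (Suc k)
      have "nrm (X (n + Suc k) - X n) \<le> nrm (X (Suc (n + k)) - X (n + k)) + nrm (X (n + k) - X n)"
        using nrm_triangle_diff[OF XV XV XV, of "Suc (n + k)" n "n + k"] by simp
      also have "\<dots> \<le> cmod \<zeta> ^ (n + k) * nrm (X 1) + cmod \<zeta> ^ n * nrm (X 1) * (\<Sum>i<k. cmod \<zeta> ^ i)"
        by (intro add_mono step Suc)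
      finally show ?case by (simp add: algebra_simps power_add)
    qed simp
    also have "\<dots> \<le> cmod \<zeta> ^ n * nrm (X 1) * (1 / (1 - cmod \<zeta>))"
    proof (rule mult_left_mono)
      have "(\<Sum>i<k. cmod \<zeta> ^ i) \<le> (\<Sum>i. cmod \<zeta> ^ i)"
        using z by (intro sum_le_suminf summable_geometric) auto
      then show "(\<Sum>i<k. cmod \<zeta> ^ i) \<le> 1 / (1 - cmod \<zeta>)" using z by (simp add: suminf_geometric)
    qed (use XV in auto)
    finally show ?thesis by simp
  qed
  have zn: "(\<lambda>n. cmod \<zeta> ^ n * nrm (X 1) / (1 - cmod \<zeta>)) \<longlonglongrightarrow> 0 * nrm (X 1) / (1 - cmod \<zeta>)"
    using z by (intro tendsto_intros LIMSEQ_power_zero) auto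
  obtain x where x: "x \<in> V" "(\<lambda>n. nrm (X n - x)) \<longlonglongrightarrow> 0"
  proof (rule bexE[OF complete[of X]])
    fix e :: real assume "e > 0"
    then have "\<forall>\<^sub>F n in sequentially. cmod \<zeta> ^ n * nrm (X 1) / (1 - cmod \<zeta>) < e / 2"
      using order_tendstoD(2)[OF zn, of "e / 2"] by simp
    then obtain N where N: "cmod \<zeta> ^ N * nrm (X 1) / (1 - cmod \<zeta>) < e / 2"
      by (auto simp: eventually_sequentially)
    have *: "nrm (X m - X N) < e / 2" if "m \<ge> N" for m
    proof -
      have "nrm (X (N + (m - N)) - X N) < e / 2" using tail[of N "m - N"] N by linarith
      then show ?thesis using that by simp
    qed
    have "nrm (X m - X n) < e" if "m \<ge> N" "n \<ge> N" for m n
      using nrm_triangle_diff[OF XV XV XV, of m n N] *[OF that(1)] *[OF that(2)] nrm_minus_commute[OF XV XV, of n N]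
      by linarith
    then show "\<exists>N. \<forall>m\<ge>N. \<forall>n\<ge>N. nrm (X m - X n) < e" by blast
  qed (use XV in auto)
  have xS: "x \<in> S" by (rule csub_lim[OF S XinS x])
  have "nrm (x - T x) \<le> 0"
  proof (rule LIMSEQ_le_const)
    show "(\<lambda>n. nrm (X (Suc n) - x) + cmod \<zeta> * nrm (X n - x)) \<longlonglongrightarrow> 0"
      using tendsto_add[OF LIMSEQ_Suc[OF x(2)] tendsto_mult_left[OF x(2), of "cmod \<zeta>"]] by simp
    have "nrm (x - T x) \<le> nrm (X (Suc n) - x) + cmod \<zeta> * nrm (X n - x)" for n
      using nrm_triangle_diff[OF x(1) XV csub_V[OF S TS[OF xS]], of "Suc n"]
        nrm_minus_commute[OF x(1) XV, of "Suc n"] Tlip[OF XinS xS, of n] by (simp add: XS)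
    then show "\<exists>N. \<forall>n\<ge>N. nrm (x - T x) \<le> nrm (X (Suc n) - x) + cmod \<zeta> * nrm (X n - x)" by blast
  qed
  moreover have "x - T x = x - sc \<zeta> (A x) - v" by (simp add: T_def)
  moreover have "0 \<le> nrm (x - T x)" using csub_V[OF S TS[OF xS]] x(1) by simp
  ultimately have "nrm (x - sc \<zeta> (A x) - v) = 0" by (metis order_antisym)
  then show ?thesis using xS by blast
qed

end

section \<open>Square-integrable functions and Hardy spaces\<close>

lemma L2_measurable: "f \<in> L2 \<Longrightarrow> f \<in> borel_measurable circle"
  and L2_integrable_sq: "f \<in> L2 \<Longrightarrow> integrable circle (\<lambda>t. (cmod (f t))\<^sup>2)"
  by (auto simp: L2_def)

lemma L2_mult_integrable:
  assumes f: "f \<in> L2" and g: "g \<in> L2"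
  shows "integrable circle (\<lambda>t. f t * g t)"
proof (rule Bochner_Integration.integrable_bound)
  show "integrable circle (\<lambda>t. (cmod (f t))\<^sup>2 + (cmod (g t))\<^sup>2)"
    using f g by (intro Bochner_Integration.integrable_add L2_integrable_sq)
  show "(\<lambda>t. f t * g t) \<in> borel_measurable circle" using f g by (intro borel_measurable_times L2_measurable)
  have "norm (f t * g t) \<le> norm ((cmod (f t))\<^sup>2 + (cmod (g t))\<^sup>2)" for t
  proof -
    have "2 * (cmod (f t) * cmod (g t)) \<le> (cmod (f t))\<^sup>2 + (cmod (g t))\<^sup>2"
      using zero_le_power2[of "cmod (f t) - cmod (g t)"] by (simp add: power2_diff)
    moreover have "0 \<le> cmod (f t) * cmod (g t)" by simp
    ultimately show ?thesis unfolding norm_mult real_norm_def by linarith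
  qed
  then show "AE t in circle. norm (f t * g t) \<le> norm ((cmod (f t))\<^sup>2 + (cmod (g t))\<^sup>2)" by simp
qed

lemma L2_add:
  assumes f: "f \<in> L2" and g: "g \<in> L2"
  shows "(\<lambda>t. f t + g t) \<in> L2"
  unfolding L2_def
proof (intro CollectI conjI)
  show m: "(\<lambda>t. f t + g t) \<in> borel_measurable circle" using f g by (intro borel_measurable_add L2_measurable)
  show "integrable circle (\<lambda>t. (cmod (f t + g t))\<^sup>2)"
  proof (rule Bochner_Integration.integrable_bound)
    show "integrable circle (\<lambda>t. 2 * (cmod (f t))\<^sup>2 + 2 * (cmod (g t))\<^sup>2)"
      using f g by (intro Bochner_Integration.integrable_add integrable_mult_right L2_integrable_sq)
    show "(\<lambda>t. (cmod (f t + g t))\<^sup>2) \<in> borel_measurable circle" using m by measurable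
    have "norm ((cmod (f t + g t))\<^sup>2) \<le> norm (2 * (cmod (f t))\<^sup>2 + 2 * (cmod (g t))\<^sup>2)" for t
    proof -
      have "(cmod (f t + g t))\<^sup>2 \<le> (cmod (f t) + cmod (g t))\<^sup>2"
        by (intro power_mono norm_triangle_ineq) auto
      also have "\<dots> \<le> 2 * (cmod (f t))\<^sup>2 + 2 * (cmod (g t))\<^sup>2"
        using zero_le_power2[of "cmod (f t) - cmod (g t)"] by (simp add: power2_diff power2_sum)
      finally show ?thesis by simp
    qed
    then show "AE t in circle. norm ((cmod (f t + g t))\<^sup>2) \<le> norm (2 * (cmod (f t))\<^sup>2 + 2 * (cmod (g t))\<^sup>2)" by simp
  qed
qed

lemma L2_mult_bounded:
  assumes f: "f \<in> L2" and g: "g \<in> borel_measurable circle" and B: "AE t in circle. cmod (g t) \<le> B"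
  shows "(\<lambda>t. g t * f t) \<in> L2"
  unfolding L2_def
proof (intro CollectI conjI)
  show m: "(\<lambda>t. g t * f t) \<in> borel_measurable circle" by (intro borel_measurable_times L2_measurable[OF f] g)
  show "integrable circle (\<lambda>t. (cmod (g t * f t))\<^sup>2)"
  proof (rule Bochner_Integration.integrable_bound)
    show "integrable circle (\<lambda>t. B\<^sup>2 * (cmod (f t))\<^sup>2)"
      using f by (intro integrable_mult_right L2_integrable_sq)
    show "(\<lambda>t. (cmod (g t * f t))\<^sup>2) \<in> borel_measurable circle" using m by measurable
    show "AE t in circle. norm ((cmod (g t * f t))\<^sup>2) \<le> norm (B\<^sup>2 * (cmod (f t))\<^sup>2)"
      using B by eventually_elim (auto simp: norm_mult power_mult_distrib intro!: mult_right_mono power_mono)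
  qed
qed

lemma L2_const [simp]: "(\<lambda>t. c) \<in> L2"
  by (simp add: L2_def)

lemma L2_scale: "f \<in> L2 \<Longrightarrow> (\<lambda>t. c * f t) \<in> L2"
  by (rule L2_mult_bounded[where B="cmod c"]) auto

lemma L2_integrable: "f \<in> L2 \<Longrightarrow> integrable circle f"
  using L2_mult_integrable[of f "\<lambda>_. 1"] by simp

lemma L2_cnj: "f \<in> L2 \<Longrightarrow> (\<lambda>t. cnj (f t)) \<in> L2"
  by (auto simp: L2_def)

lemma L2_power: "f \<in> L2 \<Longrightarrow> (\<lambda>t. t ^ j * f t) \<in> L2"
  by (rule L2_mult_bounded[where B=1]) (auto intro!: AE_I2 simp: norm_power)

lemma L2_cong_AE:
  assumes f: "f \<in> L2" and g: "AE t in circle. f t = g t" "g \<in> borel_measurable circle"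
  shows "g \<in> L2"
proof -
  have "integrable circle (\<lambda>t. (cmod (g t))\<^sup>2)"
  proof (rule integrable_cong_AE_imp[OF L2_integrable_sq[OF f]])
    show "(\<lambda>t. (cmod (g t))\<^sup>2) \<in> borel_measurable circle" using g(2) by measurable
    show "AE t in circle. (cmod (f t))\<^sup>2 = (cmod (g t))\<^sup>2" using g(1) by eventually_elim simp
  qed
  then show ?thesis using g by (simp add: L2_def)
qed

interpretation L2: semi_inner_space L2 "\<lambda>c f t. c * f t" L2_inner
proof
  show "(0 :: complex \<Rightarrow> complex) \<in> L2" by (simp add: zero_fun_def)
  fix f g h :: "complex \<Rightarrow> complex" and c
  show "(\<lambda>t. (-1) * f t) = - f" "(\<lambda>t. c * (f - g) t) = (\<lambda>t. c * f t) - (\<lambda>t. c * g t)"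
    by (simp_all add: fun_eq_iff algebra_simps)
  assume f: "f \<in> L2"
  show "(\<lambda>t. c * f t) \<in> L2" by (rule L2_scale[OF f])
  have "L2_inner f f = (\<integral>t. complex_of_real ((cmod (f t))\<^sup>2) \<partial>circle)"
    unfolding L2_inner_def complex_norm_square by (simp add: mult.commute)
  then show "0 \<le> Re (L2_inner f f)" by (simp del: of_real_power)
  assume g: "g \<in> L2"
  show "f + g \<in> L2" using L2_add[OF f g] by (simp add: plus_fun_def)
  show "L2_inner (\<lambda>t. c * f t) g = c * L2_inner f g"
    by (simp add: L2_inner_def mult.left_commute)
  show "L2_inner g f = cnj (L2_inner f g)"
    unfolding L2_inner_def by (simp add: mult.commute flip: Bochner_Integration.integral_cnj)
  assume h: "h \<in> L2"
  show "L2_inner (f + g) h = L2_inner f h + L2_inner g h"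
    using L2_mult_integrable[OF L2_cnj[OF h] f] L2_mult_integrable[OF L2_cnj[OF h] g]
    by (simp add: L2_inner_def distrib_left)
qed

lemma L2_nrm_sq: "f \<in> L2 \<Longrightarrow> (L2.nrm f)\<^sup>2 = (\<integral>t. (cmod (f t))\<^sup>2 \<partial>circle)"
proof -
  assume f: "f \<in> L2"
  have "L2_inner f f = (\<integral>t. complex_of_real ((cmod (f t))\<^sup>2) \<partial>circle)"
    unfolding L2_inner_def complex_norm_square by (simp add: mult.commute)
  then show ?thesis by (simp add: L2.nrm_sq[OF f] del: of_real_power)
qed

section \<open>Fatou's lemma and completeness of the square-integrable functions\<close>

lemma L2_fatou:
  assumes Y: "\<And>k::nat. Y k \<in> L2" "\<And>k. (\<integral>t. (cmod (Y k t))\<^sup>2 \<partial>circle) \<le> B" and h: "h \<in> borel_measurable circle"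
    and lim: "AE t in circle. (\<lambda>k. Y k t) \<longlonglongrightarrow> h t"
  shows "h \<in> L2" "(\<integral>t. (cmod (h t))\<^sup>2 \<partial>circle) \<le> B"
proof -
  note [measurable] = L2_measurable[OF Y(1)] h
  have B0: "0 \<le> B" using order_trans[OF _ Y(2)[of 0]] by simp
  have "(\<integral>\<^sup>+t. ennreal ((cmod (h t))\<^sup>2) \<partial>circle) = (\<integral>\<^sup>+t. liminf (\<lambda>k. ennreal ((cmod (Y k t))\<^sup>2)) \<partial>circle)"
  proof (rule nn_integral_cong_AE)
    show "AE t in circle. ennreal ((cmod (h t))\<^sup>2) = liminf (\<lambda>k. ennreal ((cmod (Y k t))\<^sup>2))"
      using lim
    proof eventually_elim
      case (elim t)
      have "(\<lambda>k. ennreal ((cmod (Y k t))\<^sup>2)) \<longlonglongrightarrow> ennreal ((cmod (h t))\<^sup>2)"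
        using elim by (intro tendsto_intros)
      then show ?case using lim_imp_Liminf[OF sequentially_bot] by metis
    qed
  qed
  also have "\<dots> \<le> liminf (\<lambda>k. \<integral>\<^sup>+t. ennreal ((cmod (Y k t))\<^sup>2) \<partial>circle)"
    by (rule nn_integral_liminf) measurable
  also have "\<dots> \<le> ennreal B"
  proof (rule Liminf_le)
    show "\<forall>\<^sub>F k in sequentially. (\<integral>\<^sup>+t. ennreal ((cmod (Y k t))\<^sup>2) \<partial>circle) \<le> ennreal B"
      using Y B0 by (subst nn_integral_eq_integral) (auto intro: L2_integrable_sq ennreal_leI)
  qed simp
  finally have le: "(\<integral>\<^sup>+t. ennreal ((cmod (h t))\<^sup>2) \<partial>circle) \<le> ennreal B" .
  then have i: "integrable circle (\<lambda>t. (cmod (h t))\<^sup>2)"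
    by (intro integrableI_bounded) (auto simp: less_top[symmetric] top_unique intro: le_less_trans)
  then show "h \<in> L2" by (simp add: L2_def h)
  show "(\<integral>t. (cmod (h t))\<^sup>2 \<partial>circle) \<le> B"
    using le B0 by (simp add: nn_integral_eq_integral[OF i])
qed

lemma L2_norm1_le: "f \<in> L2 \<Longrightarrow> (\<integral>t. cmod (f t) \<partial>circle) \<le> L2.nrm f"
proof -
  assume f: "f \<in> L2"
  define g where "g = (\<lambda>t. complex_of_real (cmod (f t)))"
  have g: "g \<in> L2" using f by (auto simp: L2_def g_def)
  have "(L2.nrm g)\<^sup>2 = (L2.nrm f)\<^sup>2" using f g by (simp add: L2_nrm_sq g_def)
  then have "L2.nrm g = L2.nrm f" using f g by (simp add: power2_eq_imp_eq)
  moreover have "L2_inner g (\<lambda>_. 1) = of_real (\<integral>t. cmod (f t) \<partial>circle)"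
    by (simp add: L2_inner_def g_def)
  moreover have "(L2.nrm (\<lambda>_. 1))\<^sup>2 = 1" by (simp add: L2_nrm_sq)
  then have "L2.nrm (\<lambda>_. 1) = 1" using L2.nrm_nonneg[OF L2_const[of 1]] by (auto simp: power2_eq_1_iff)
  ultimately show ?thesis using L2.Cauchy_Schwarz[OF g L2_const[of 1]] by simp
qed

lemma AE_summable_of_integrals:
  fixes g :: "nat \<Rightarrow> complex \<Rightarrow> complex"
  assumes g: "\<And>k. integrable circle (g k)" and le: "\<And>k. (\<integral>t. cmod (g k t) \<partial>circle) \<le> B k" and s: "summable B"
  shows "AE t in circle. summable (\<lambda>k. cmod (g k t))"
proof -
  have [measurable]: "g k \<in> borel_measurable circle" for k using g by auto
  have sI: "summable (\<lambda>k. \<integral>t. cmod (g k t) \<partial>circle)"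
    by (rule summable_comparison_test'[OF s, of 0]) (use le in auto)
  have "(\<integral>\<^sup>+t. (\<Sum>k. ennreal (cmod (g k t))) \<partial>circle) = (\<Sum>k. \<integral>\<^sup>+t. ennreal (cmod (g k t)) \<partial>circle)"
    by (rule nn_integral_suminf) measurable
  also have "\<dots> = (\<Sum>k. ennreal (\<integral>t. cmod (g k t) \<partial>circle))"
    using g by (simp add: nn_integral_eq_integral)
  also have "\<dots> = ennreal (\<Sum>k. \<integral>t. cmod (g k t) \<partial>circle)"
    using sI by (intro suminf_ennreal2) auto
  finally have "(\<integral>\<^sup>+t. (\<Sum>k. ennreal (cmod (g k t))) \<partial>circle) \<noteq> \<infinity>" by simp
  then have "AE t in circle. (\<Sum>k. ennreal (cmod (g k t))) \<noteq> \<infinity>"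
    by (intro nn_integral_PInf_AE) auto
  then show ?thesis
    by eventually_elim (auto intro: summable_suminf_not_top)
qed

text \<open>Riesz-Fischer: a subsequence with increments below 2^-k converges almost everywhere,
  since the L^1 norms of the increments are summable; Fatou's lemma turns the Cauchy property into
  norm convergence of the whole sequence.\<close>

interpretation L2: semi_hilbert L2 "\<lambda>c f t. c * f t" L2_inner
proof
  fix X :: "nat \<Rightarrow> complex \<Rightarrow> complex"
  assume X: "\<And>n. X n \<in> L2" and cau: "\<And>e. e > 0 \<Longrightarrow> \<exists>N. \<forall>m\<ge>N. \<forall>n\<ge>N. L2.nrm (X m - X n) < e"
  have "\<exists>N. \<forall>m\<ge>N. \<forall>n\<ge>N. L2.nrm (X m - X n) < (1/2)^k" for k by (rule cau) simp
  then obtain N where N: "\<And>k m n. m \<ge> N k \<Longrightarrow> n \<ge> N k \<Longrightarrow> L2.nrm (X m - X n) < (1/2)^k" by metis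
  \<comment> \<open>The cumulative sum makes the index increase with k while it stays above both N k
    and k.\<close>
  define \<phi> where "\<phi> k = k + (\<Sum>i\<le>k. N i)" for k
  have \<phi>: "N k \<le> \<phi> k" "\<phi> k \<le> \<phi> (Suc k)" "k \<le> \<phi> k" for k
    by (auto simp: \<phi>_def intro!: trans_le_add2 member_le_sum)
  define g where "g k = X (\<phi> (Suc k)) - X (\<phi> k)" for k
  have gL: "g k \<in> L2" for k using X by (simp add: g_def)
  define f where "f t = lim (\<lambda>k. X (\<phi> k) t)" for t
  have "AE t in circle. summable (\<lambda>k. cmod (g k t))"
  proof (rule AE_summable_of_integrals)
    show "(\<integral>t. cmod (g k t) \<partial>circle) \<le> (1/2)^k" for k
    proof -
      have "L2.nrm (g k) < (1/2)^k"
        unfolding g_def using \<phi>[of k] by (intro N) auto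
      then show ?thesis using L2_norm1_le[OF gL[of k]] by linarith
    qed
  qed (auto intro!: L2_integrable gL summable_geometric)
  then have lim: "AE t in circle. (\<lambda>k. X (\<phi> k) t) \<longlonglongrightarrow> f t"
  proof eventually_elim
    case (elim t)
    then have "summable (\<lambda>k. g k t)" by (rule summable_norm_cancel)
    then have "(\<lambda>n. X (\<phi> 0) t + (\<Sum>k<n. g k t)) \<longlonglongrightarrow> X (\<phi> 0) t + (\<Sum>k. g k t)"
      by (intro tendsto_intros summable_LIMSEQ)
    moreover have "X (\<phi> 0) t + (\<Sum>k<n. g k t) = X (\<phi> n) t" for n
      using sum_lessThan_telescope[of "\<lambda>k. X (\<phi> k) t" n] by (simp add: g_def)
    ultimately have "convergent (\<lambda>n. X (\<phi> n) t)" by (auto simp: convergent_def)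
    then show ?case unfolding f_def by (simp add: convergent_LIMSEQ_iff)
  qed
  have fm: "f \<in> borel_measurable circle"
    unfolding f_def by (rule borel_measurable_lim_metric) (rule L2_measurable[OF X])
  have est: "X n - f \<in> L2 \<and> (L2.nrm (X n - f))\<^sup>2 \<le> e\<^sup>2"
    if "e > 0" "\<And>m. m \<ge> M \<Longrightarrow> L2.nrm (X n - X m) < e" for e M n
  proof -
    have lim': "AE t in circle. (\<lambda>k. (X n - X (\<phi> (k + M))) t) \<longlonglongrightarrow> (X n - f) t"
      using lim by eventually_elim (auto intro!: tendsto_intros LIMSEQ_ignore_initial_segment)
    have M: "\<phi> (k + M) \<ge> M" for k using \<phi>(3)[of "k + M"] by linarith
    have le: "(\<integral>t. (cmod ((X n - X (\<phi> (k + M))) t))\<^sup>2 \<partial>circle) \<le> e\<^sup>2" for k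
      unfolding L2_nrm_sq[OF L2.diff_in[OF X X], symmetric]
      using less_imp_le[OF that(2)[OF M[of k]]] X by (intro power_mono) auto
    have m: "X n - f \<in> borel_measurable circle"
      using fm L2_measurable[OF X[of n]] unfolding fun_diff_def by measurable
    have "X n - f \<in> L2" by (rule L2_fatou(1)[OF L2.diff_in[OF X X] le m lim'])
    moreover have "(\<integral>t. (cmod ((X n - f) t))\<^sup>2 \<partial>circle) \<le> e\<^sup>2"
      by (rule L2_fatou(2)[OF L2.diff_in[OF X X] le m lim'])
    ultimately show ?thesis by (simp add: L2_nrm_sq)
  qed
  obtain M where "\<And>m n. m \<ge> M \<Longrightarrow> n \<ge> M \<Longrightarrow> L2.nrm (X m - X n) < 1" using cau[of 1] by auto
  then have "X M - f \<in> L2" using est[of 1 M M] by simp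
  then have "X M - (X M - f) \<in> L2" using X by (rule_tac L2.diff_in)
  then have fL: "f \<in> L2" by simp
  have "(\<lambda>n. L2.nrm (X n - f)) \<longlonglongrightarrow> 0"
  proof (rule LIMSEQ_I)
    fix e :: real assume "e > 0"
    then obtain N' where N': "\<And>m n. m \<ge> N' \<Longrightarrow> n \<ge> N' \<Longrightarrow> L2.nrm (X m - X n) < e / 2"
      using cau[of "e / 2"] by auto
    have "norm (L2.nrm (X n - f) - 0) < e" if "n \<ge> N'" for n
    proof -
      have "(L2.nrm (X n - f))\<^sup>2 \<le> (e / 2)\<^sup>2" using est[of "e / 2" N' n] N'[OF that] \<open>e > 0\<close> by simp
      then have "L2.nrm (X n - f) \<le> e / 2" by (rule power2_le_imp_le) (use \<open>e > 0\<close> in simp)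
      then show ?thesis using \<open>e > 0\<close> X fL by simp
    qed
    then show "\<exists>no. \<forall>n\<ge>no. norm (L2.nrm (X n - f) - 0) < e" by blast
  qed
  then show "\<exists>x\<in>L2. (\<lambda>n. L2.nrm (X n - x)) \<longlonglongrightarrow> 0" using fL by blast
qed

section \<open>Dilates of holomorphic functions and their pairings on the circle\<close>

lemma borel_measurable_circle_sphere:
  "continuous_on (sphere 0 1) g \<Longrightarrow> g \<in> borel_measurable circle"
  unfolding circle_def
  by (rule measurable_completion) (simp add: borel_measurable_continuous_on_restrict)

lemma L2_sphere:
  assumes "continuous_on (sphere 0 1) g"
  shows "g \<in> L2"
proof -
  have "bounded (g ` sphere 0 1)"
    using assms by (intro compact_imp_bounded compact_continuous_image) auto
  then obtain B where "\<forall>t\<in>sphere 0 1. norm (g t) \<le> B" by (auto simp: bounded_iff)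
  then have "(\<lambda>t. g t * 1) \<in> L2"
    using borel_measurable_circle_sphere[OF assms] by (intro L2_mult_bounded[where B=B] L2_const AE_I2) auto
  then show ?thesis by simp
qed

lemma disk_circle_continuous:
  fixes r :: real
  assumes "F holomorphic_on ball 0 1" "0 \<le> r" "r < 1"
  shows "continuous_on (sphere 0 1) (\<lambda>t. F (of_real r * t))"
  by (rule continuous_on_compose2[OF holomorphic_on_imp_continuous_on[OF assms(1)]])
    (use assms in \<open>auto intro!: continuous_intros simp: norm_mult\<close>)

lemma taylor_summable_norm:
  fixes F :: "complex \<Rightarrow> complex" and r :: real
  assumes a: "\<And>z. norm z < 1 \<Longrightarrow> (\<lambda>i. a i * z ^ i) sums F z" and r: "0 \<le> r" "r < 1"
  shows "summable (\<lambda>i. cmod (a i) * r ^ i)"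
proof -
  \<comment> \<open>Convergence at the radius halfway between r and 1 gives absolute convergence at
    r.\<close>
  have "norm (of_real ((1 + r) / 2) :: complex) < 1"
    unfolding norm_of_real using r by simp
  from sums_summable[OF a[OF this]] have "summable (\<lambda>i. a i * of_real ((1 + r) / 2) ^ i)" .
  then have "summable (\<lambda>i. norm (a i * of_real r ^ i))"
    by (rule powser_insidea) (use r in \<open>simp only: norm_of_real, simp\<close>)
  then show ?thesis using r by (simp add: norm_mult norm_power)
qed

text \<open>Termwise integration of the Taylor series, which converges absolutely and uniformly at
  radius r. With G = 1 it gives the mean value property, with G = cnj t^i the Taylor
  coefficients.\<close>

lemma circle_pairing_sums:
  fixes F :: "complex \<Rightarrow> complex" and r :: real
  assumes a: "\<And>z. norm z < 1 \<Longrightarrow> (\<lambda>i. a i * z ^ i) sums F z" and r: "0 \<le> r" "r < 1"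
    and G: "integrable circle G"
  shows "(\<lambda>i. a i * of_real r ^ i * (\<integral>t. t ^ i * G t \<partial>circle)) sums (\<integral>t. F (of_real r * t) * G t \<partial>circle)"
proof -
  define f where "f = (\<lambda>i t. a i * of_real r ^ i * (t ^ i * G t))"
  have int: "integrable circle (f i)" for i
    unfolding f_def
    using integrable_circle_mult_bounded[OF G, of "\<lambda>t. t ^ i" 1]
    by (intro integrable_mult_right) (simp add: norm_power mult.commute)
  have nf: "norm (f i t) = cmod (a i) * r ^ i * norm (G t)" if "norm t = 1" for i t
    using that r by (simp add: f_def norm_mult norm_power)
  note sa = taylor_summable_norm[OF a r]
  have nI: "(\<integral>t. norm (f i t) \<partial>circle) = cmod (a i) * r ^ i * (\<integral>t. norm (G t) \<partial>circle)" for i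
  proof -
    have "(\<integral>t. norm (f i t) \<partial>circle) = (\<integral>t. cmod (a i) * r ^ i * norm (G t) \<partial>circle)"
      by (intro Bochner_Integration.integral_cong) (auto simp: nf)
    then show ?thesis by simp
  qed
  have s1: "AE t in circle. summable (\<lambda>i. norm (f i t))"
    using sa by (intro AE_I2) (auto simp: nf intro!: summable_mult2)
  have s2: "summable (\<lambda>i. \<integral>t. norm (f i t) \<partial>circle)"
    unfolding nI by (intro summable_mult2 sa)
  have "(\<lambda>i. integral\<^sup>L circle (f i)) sums (\<integral>t. (\<Sum>i. f i t) \<partial>circle)"
    using integral_suminf[OF int s1 s2] summable_integral[OF int s1 s2] by (simp add: sums_iff)
  also have "(\<integral>t. (\<Sum>i. f i t) \<partial>circle) = (\<integral>t. F (of_real r * t) * G t \<partial>circle)"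
  proof (rule Bochner_Integration.integral_cong[OF refl])
    fix t assume "t \<in> space circle"
    then have "(\<lambda>i. a i * (of_real r * t) ^ i) sums F (of_real r * t)"
      using r by (intro a) (auto simp: norm_mult)
    then have "(\<lambda>i. a i * (of_real r * t) ^ i * G t) sums (F (of_real r * t) * G t)"
      by (rule sums_mult2)
    then show "(\<Sum>i. f i t) = F (of_real r * t) * G t"
      by (simp add: f_def sums_iff power_mult_distrib mult_ac)
  qed
  also have "(\<lambda>i. integral\<^sup>L circle (f i)) = (\<lambda>i. a i * of_real r ^ i * (\<integral>t. t ^ i * G t \<partial>circle))"
    by (simp add: f_def)
  finally show ?thesis .
qed

lemma disk_taylor:
  assumes "F holomorphic_on ball 0 1"
  obtains a where "\<And>z. norm z < 1 \<Longrightarrow> (\<lambda>i. a i * z ^ i) sums F z"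
proof
  fix z :: complex assume "norm z < 1"
  then show "(\<lambda>i. ((deriv ^^ i) F 0 / fact i) * z ^ i) sums F z"
    using holomorphic_power_series[OF assms, of z] by simp
qed

lemma circle_moment_power: "(\<integral>t. t ^ i \<partial>circle) = (if i = 0 then 1 else 0)"
  using circle_moment[of "int i"] by simp

lemma circle_mean_value:
  fixes r :: real
  assumes F: "F holomorphic_on ball 0 1" and r: "0 \<le> r" "r < 1"
  shows "(\<integral>t. F (of_real r * t) \<partial>circle) = F 0"
proof -
  obtain a where a: "\<And>z. norm z < 1 \<Longrightarrow> (\<lambda>i. a i * z ^ i) sums F z" using disk_taylor[OF F] by blast
  have "(\<lambda>i. a i * of_real r ^ i * (\<integral>t. t ^ i * 1 \<partial>circle)) sums (\<integral>t. F (of_real r * t) * 1 \<partial>circle)"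
    by (rule circle_pairing_sums[OF a r]) auto
  moreover have "(\<lambda>i. a i * of_real r ^ i * (\<integral>t. t ^ i * 1 \<partial>circle)) = (\<lambda>i. if i = 0 then a 0 else 0)"
    by (auto simp: circle_moment_power fun_eq_iff)
  ultimately have "(\<integral>t. F (of_real r * t) \<partial>circle) = a 0"
    using sums_single[of 0 "\<lambda>_. a 0"] sums_unique2 by fastforce
  moreover have "F 0 = a 0" using a[of 0] powser_sums_zero[of a] sums_unique2 by fastforce
  ultimately show ?thesis by simp
qed

lemma cnj_power_mult_power: "norm t = 1 \<Longrightarrow> cnj t ^ i * t ^ j = t powi (int j - int i)"
proof -
  assume t: "norm t = 1"
  then have "cnj t = inverse t" using inverse_unique[of t "cnj t"]
    by (auto simp: complex_norm_square[symmetric])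
  moreover have "t \<noteq> 0" using t by auto
  ultimately show ?thesis by (simp add: power_int_diff power_inverse divide_inverse mult.commute)
qed

lemma circle_orthonormal: "L2_inner (\<lambda>t. t ^ i) (\<lambda>t. t ^ j) = (if i = j then 1 else 0)"
proof -
  have "L2_inner (\<lambda>t. t ^ i) (\<lambda>t. t ^ j) = (\<integral>t. t powi (int i - int j) \<partial>circle)"
    unfolding L2_inner_def
    by (intro Bochner_Integration.integral_cong refl) (auto simp: cnj_power_mult_power[symmetric])
  then show ?thesis by (simp add: circle_moment)
qed

lemma circle_moment_mixed: "(\<integral>t. cnj t ^ i * t ^ j \<partial>circle) = (if i = j then 1 else 0)"
  using circle_orthonormal[of j i] by (simp add: L2_inner_def eq_commute)

lemma L2_power_fun [simp]: "(\<lambda>t. t ^ j) \<in> L2" "(\<lambda>t. cnj t ^ j) \<in> L2"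
  by (intro L2_sphere continuous_intros)+

text \<open>A pointwise limit and a norm bound do not give strong convergence, but the pairings
  converge: where \<epsilon> |d| <= |u| the product is dominated by |u|^2 / \<epsilon>, and
  elsewhere it is at most \<epsilon> |d|^2, with integral at most \<epsilon> C.\<close>

lemma L2_weak_null:
  assumes u: "u \<in> L2" and d: "\<And>k::nat. d k \<in> L2" "\<And>k. (\<integral>t. (cmod (d k t))\<^sup>2 \<partial>circle) \<le> C"
    and lim: "AE t in circle. (\<lambda>k. d k t) \<longlonglongrightarrow> 0"
  shows "(\<lambda>k. \<integral>t. cmod (u t) * cmod (d k t) \<partial>circle) \<longlonglongrightarrow> 0"
proof (rule LIMSEQ_I)
  fix e :: real assume "e > 0"
  note [measurable] = L2_measurable[OF u] L2_measurable[OF d(1)]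
  have C0: "0 \<le> C" using order_trans[OF _ d(2)[of 0]] by simp
  \<comment> \<open>C + 1 instead of C, since the bound C may vanish.\<close>
  define \<epsilon> where "\<epsilon> = e / (2 * (C + 1))"
  have \<epsilon>: "\<epsilon> > 0" "\<epsilon> * C \<le> e / 2" using \<open>e > 0\<close> C0 by (simp_all add: \<epsilon>_def field_simps)
  define m where "m k t = min (cmod (u t) * cmod (d k t)) ((cmod (u t))\<^sup>2 / \<epsilon>)" for k t
  have [measurable]: "m k \<in> borel_measurable circle" for k unfolding m_def by measurable
  have uI: "integrable circle (\<lambda>t. (cmod (u t))\<^sup>2 / \<epsilon>)" using L2_integrable_sq[OF u] by simp
  have mb: "norm (m k t) \<le> (cmod (u t))\<^sup>2 / \<epsilon>" for k t
  proof -
    have "0 \<le> m k t" "m k t \<le> (cmod (u t))\<^sup>2 / \<epsilon>" using \<epsilon> by (simp_all add: m_def)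
    then show ?thesis by simp
  qed
  have mI: "integrable circle (m k)" for k
    by (rule Bochner_Integration.integrable_bound[OF uI]) (use mb order_trans[OF mb abs_ge_self] in auto)
  have "(\<lambda>k. integral\<^sup>L circle (m k)) \<longlonglongrightarrow> integral\<^sup>L circle (\<lambda>_. 0)"
  proof (rule integral_dominated_convergence[OF _ _ uI])
    show "AE t in circle. (\<lambda>k. m k t) \<longlonglongrightarrow> 0"
      using lim
    proof eventually_elim
      case (elim t)
      have "(\<lambda>k. cmod (u t) * cmod (d k t)) \<longlonglongrightarrow> cmod (u t) * 0"
        using tendsto_norm[OF elim] by (intro tendsto_mult tendsto_const) simp
      then have "(\<lambda>k. min (cmod (u t) * cmod (d k t)) ((cmod (u t))\<^sup>2 / \<epsilon>)) \<longlonglongrightarrow> min (cmod (u t) * 0) ((cmod (u t))\<^sup>2 / \<epsilon>)"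
        by (intro tendsto_min tendsto_const)
      then show ?case using \<epsilon> by (simp add: m_def)
    qed
  qed (use mb in auto)
  then have "(\<lambda>k. integral\<^sup>L circle (m k)) \<longlonglongrightarrow> 0" by simp
  then have "\<forall>\<^sub>F k in sequentially. integral\<^sup>L circle (m k) < e / 2"
    by (rule order_tendstoD(2)) (use \<open>e > 0\<close> in simp)
  then obtain N where N: "\<And>k. k \<ge> N \<Longrightarrow> integral\<^sup>L circle (m k) < e / 2" by (auto simp: eventually_sequentially)
  have udI: "integrable circle (\<lambda>t. cmod (u t) * cmod (d k t))" for k
    using integrable_norm[OF L2_mult_integrable[OF u d(1)[of k]]] by (simp add: norm_mult)
  have "norm ((\<integral>t. cmod (u t) * cmod (d k t) \<partial>circle) - 0) < e" if "k \<ge> N" for k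
  proof -
    have "(\<integral>t. cmod (u t) * cmod (d k t) \<partial>circle) \<le> (\<integral>t. m k t + \<epsilon> * (cmod (d k t))\<^sup>2 \<partial>circle)"
    proof (rule integral_mono[OF udI])
      show "integrable circle (\<lambda>t. m k t + \<epsilon> * (cmod (d k t))\<^sup>2)"
        using mI L2_integrable_sq[OF d(1)] by auto
      fix t
      show "cmod (u t) * cmod (d k t) \<le> m k t + \<epsilon> * (cmod (d k t))\<^sup>2"
      proof (cases "\<epsilon> * cmod (d k t) \<le> cmod (u t)")
        case True
        have "cmod (u t) * (\<epsilon> * cmod (d k t)) \<le> cmod (u t) * cmod (u t)" by (intro mult_left_mono True) simp
        then have "cmod (u t) * cmod (d k t) \<le> (cmod (u t))\<^sup>2 / \<epsilon>"
          using \<epsilon> by (simp add: pos_le_divide_eq power2_eq_square mult_ac)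
        moreover have "0 \<le> \<epsilon> * (cmod (d k t))\<^sup>2" using \<epsilon> by simp
        ultimately show ?thesis unfolding m_def by linarith
      next
        case False
        then have "cmod (u t) * cmod (d k t) \<le> (\<epsilon> * cmod (d k t)) * cmod (d k t)" by (intro mult_right_mono) auto
        moreover have "0 \<le> m k t" using \<epsilon> by (simp add: m_def)
        ultimately show ?thesis by (simp add: power2_eq_square)
      qed
    qed
    also have "\<dots> = integral\<^sup>L circle (m k) + \<epsilon> * (\<integral>t. (cmod (d k t))\<^sup>2 \<partial>circle)"
      using mI L2_integrable_sq[OF d(1)] by simp
    also have "\<dots> \<le> integral\<^sup>L circle (m k) + \<epsilon> * C"
      using d(2)[of k] \<epsilon> by simp
    also have "\<dots> < e" using N[OF that] \<epsilon> by linarith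
    finally show ?thesis by simp
  qed
  then show "\<exists>no. \<forall>k\<ge>no. norm ((\<integral>t. cmod (u t) * cmod (d k t) \<partial>circle) - 0) < e" by blast
qed

text \<open>The convergence theorems for integrals are sequential, while radial limits use
  \<open>at_left 1\<close>; this sequence connects the two. The 2 in the denominator keeps every
  radius positive.\<close>

definition radius :: "nat \<Rightarrow> real" where
  "radius k = 1 - 1 / (real k + 2)"

lemma radius: "0 \<le> radius k" "0 < radius k" "radius k < 1"
  by (auto simp: radius_def field_simps)

lemma radius_at_left: "filterlim radius (at_left 1) sequentially"
  unfolding filterlim_at
proof (intro conjI always_eventually allI)
  show "radius \<longlonglongrightarrow> 1" unfolding radius_def by real_asymp
qed (use radius in \<open>auto simp: less_imp_neq\<close>)

section \<open>Boundary values of Hardy space functions and the moment criterion\<close>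

lemma H2_disk_L2:
  assumes F: "F \<in> H2_disk"
  obtains C where "\<And>r::real. 0 \<le> r \<Longrightarrow> r < 1 \<Longrightarrow> (\<lambda>t. F (of_real r * t)) \<in> L2"
    "\<And>r::real. 0 \<le> r \<Longrightarrow> r < 1 \<Longrightarrow> (\<integral>t. (cmod (F (of_real r * t)))\<^sup>2 \<partial>circle) \<le> C"
  using F by (auto simp: H2_disk_def intro: L2_sphere disk_circle_continuous)

text \<open>Radial limits and bounded means are what \<open>L2_weak_null\<close> asks for. The
  absolute values inside the integral allow the remainder to be multiplied by bounded factors
  later.\<close>

lemma H2_disk_tendsto:
  assumes f: "f \<in> L2" and F: "F \<in> H2_disk"
    and lim: "AE t in circle. ((\<lambda>r::real. F (of_real r * t)) \<longlongrightarrow> f t) (at_left 1)" and u: "u \<in> L2"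
  shows "(\<lambda>k. \<integral>t. cmod (u t) * cmod (F (of_real (radius k) * t) - f t) \<partial>circle) \<longlonglongrightarrow> 0"
proof -
  obtain C where C: "\<And>r::real. 0 \<le> r \<Longrightarrow> r < 1 \<Longrightarrow> (\<lambda>t. F (of_real r * t)) \<in> L2"
    "\<And>r::real. 0 \<le> r \<Longrightarrow> r < 1 \<Longrightarrow> (\<integral>t. (cmod (F (of_real r * t)))\<^sup>2 \<partial>circle) \<le> C"
    using H2_disk_L2[OF F] by blast
  define d where "d k t = F (of_real (radius k) * t) - f t" for k t
  have d_eq: "d k = (\<lambda>t. F (of_real (radius k) * t)) - f" for k by (auto simp: d_def)
  have dL: "d k \<in> L2" for k unfolding d_eq using C(1) f radius by (intro L2.diff_in) auto
  have "(\<integral>t. (cmod (d k t))\<^sup>2 \<partial>circle) \<le> (sqrt C + L2.nrm f)\<^sup>2" for k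
  proof -
    let ?Fk = "\<lambda>t. F (of_real (radius k) * t)"
    have FL: "?Fk \<in> L2" using C(1) radius by auto
    have "(L2.nrm ?Fk)\<^sup>2 \<le> C" using C(2) radius by (simp add: L2_nrm_sq[OF FL])
    then have "L2.nrm ?Fk \<le> sqrt C" by (simp add: real_le_rsqrt)
    then have "L2.nrm (d k) \<le> sqrt C + L2.nrm f"
      using L2.nrm_triangle[OF FL L2.minus_in[OF f]] f by (simp add: d_eq)
    then show ?thesis unfolding L2_nrm_sq[OF dL, symmetric] by (intro power_mono) (simp_all add: dL)
  qed
  moreover have "AE t in circle. (\<lambda>k. d k t) \<longlonglongrightarrow> 0"
    using lim
  proof eventually_elim
    case (elim t)
    then have "(\<lambda>k. F (of_real (radius k) * t)) \<longlonglongrightarrow> f t"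
      by (rule filterlim_compose[OF _ radius_at_left])
    then show ?case by (simp add: d_def LIM_zero_iff)
  qed
  ultimately have "(\<lambda>k. \<integral>t. cmod (u t) * cmod (d k t) \<partial>circle) \<longlonglongrightarrow> 0"
    using dL by (intro L2_weak_null[OF u])
  then show ?thesis by (simp add: d_def)
qed

text \<open>The moments annihilate every term of the Taylor series of a dilate, hence every dilate,
  and the pairing passes to the boundary.\<close>

lemma H2_disk_pairing_zero:
  assumes f: "f \<in> H2_plus" and u: "u \<in> L2" and m: "\<And>i. (\<integral>t. t ^ i * u t \<partial>circle) = 0"
  shows "(\<integral>t. f t * u t \<partial>circle) = 0"
proof -
  obtain F where fL: "f \<in> L2" and F: "F \<in> H2_disk"
    and lim: "AE t in circle. ((\<lambda>r::real. F (of_real r * t)) \<longlongrightarrow> f t) (at_left 1)"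
    using f by (auto simp: H2_plus_def)
  obtain C where C: "\<And>r::real. 0 \<le> r \<Longrightarrow> r < 1 \<Longrightarrow> (\<lambda>t. F (of_real r * t)) \<in> L2"
    using H2_disk_L2[OF F] by metis
  obtain a where a: "\<And>z. norm z < 1 \<Longrightarrow> (\<lambda>i. a i * z ^ i) sums F z"
    using disk_taylor[of F] F by (auto simp: H2_disk_def)
  have z: "(\<integral>t. F (of_real (radius k) * t) * u t \<partial>circle) = 0" for k
  proof -
    have "(\<lambda>i. a i * of_real (radius k) ^ i * (\<integral>t. t ^ i * u t \<partial>circle)) sums
        (\<integral>t. F (of_real (radius k) * t) * u t \<partial>circle)"
      by (rule circle_pairing_sums[OF a]) (use radius L2_integrable[OF u] in auto)
    then show ?thesis using sums_unique2[OF _ sums_zero] by (simp add: m)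
  qed
  have "norm (\<integral>t. f t * u t \<partial>circle) \<le> (\<integral>t. cmod (u t) * cmod (F (of_real (radius k) * t) - f t) \<partial>circle)" for k
  proof -
    have i: "integrable circle (\<lambda>t. F (of_real (radius k) * t) * u t)" "integrable circle (\<lambda>t. f t * u t)"
      using C radius fL u by (auto intro!: L2_mult_integrable)
    have "- (\<integral>t. f t * u t \<partial>circle) = (\<integral>t. F (of_real (radius k) * t) * u t - f t * u t \<partial>circle)"
      using z i by simp
    then have "norm (\<integral>t. f t * u t \<partial>circle) = norm (\<integral>t. F (of_real (radius k) * t) * u t - f t * u t \<partial>circle)"
      by (metis norm_minus_cancel)
    also have "\<dots> \<le> (\<integral>t. norm (F (of_real (radius k) * t) * u t - f t * u t) \<partial>circle)"
      by (rule integral_norm_bound)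
    also have "\<dots> = (\<integral>t. cmod (u t) * cmod (F (of_real (radius k) * t) - f t) \<partial>circle)"
      by (intro Bochner_Integration.integral_cong refl) (simp add: norm_mult[symmetric] algebra_simps)
    finally show ?thesis .
  qed
  then have "norm (\<integral>t. f t * u t \<partial>circle) \<le> 0"
    by (intro LIMSEQ_le_const[OF H2_disk_tendsto[OF fL F lim u]]) auto
  then show ?thesis by simp
qed

lemma sum_fun_apply: "(\<Sum>i\<in>I. f i) t = (\<Sum>i\<in>I. f i t)"
  for f :: "'i \<Rightarrow> 'a \<Rightarrow> 'b::comm_monoid_add"
  by (induction I rule: infinite_finite_induct) auto

text \<open>Parseval bounds the partial sums on the circle of radius r by C, and Fatou's lemma
  carries the bound to their limit.\<close>

lemma power_series_H2_disk:
  assumes a: "\<And>z. norm z < 1 \<Longrightarrow> (\<lambda>i. a i * z ^ i) sums F z" and C: "\<And>N. (\<Sum>i<N. (cmod (a i))\<^sup>2) \<le> C"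
  shows "F \<in> H2_disk"
  unfolding H2_disk_def
proof (intro CollectI conjI exI allI impI)
  show hol: "F holomorphic_on ball 0 1"
    by (rule power_series_holomorphic[where a=a]) (use a in auto)
  fix r :: real assume r: "0 \<le> r \<and> r < 1"
  define S where "S = (\<lambda>N. \<Sum>i<N. (\<lambda>t. (a i * of_real r ^ i) * t ^ i))"
  have SL: "S N \<in> L2" for N unfolding S_def by (intro L2.sum_in L2_scale L2_power_fun)
  show "(\<integral>t. (cmod (F (of_real r * t)))\<^sup>2 \<partial>circle) \<le> C"
  proof (rule L2_fatou(2)[OF SL])
    show "(\<integral>t. (cmod (S N t))\<^sup>2 \<partial>circle) \<le> C" for N
    proof -
      have "(\<integral>t. (cmod (S N t))\<^sup>2 \<partial>circle) = (L2.nrm (S N))\<^sup>2"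
        by (simp only: L2_nrm_sq[OF SL])
      also have "\<dots> = (\<Sum>i<N. (cmod (a i * of_real r ^ i))\<^sup>2)"
        unfolding S_def
        by (rule L2.nrm_sq_orthonormal_sum) (auto simp: circle_orthonormal)
      also have "\<dots> \<le> (\<Sum>i<N. (cmod (a i))\<^sup>2)"
        using r by (intro sum_mono power_mono) (auto simp: norm_mult norm_power mult_left_le power_le_one)
      finally show ?thesis using C[of N] by linarith
    qed
    show "(\<lambda>t. F (of_real r * t)) \<in> borel_measurable circle"
      using r by (intro borel_measurable_circle_sphere disk_circle_continuous[OF hol]) auto
    show "AE t in circle. (\<lambda>N. S N t) \<longlonglongrightarrow> F (of_real r * t)"
    proof (rule AE_I2)
      fix t assume "t \<in> space circle"
      then have "(\<lambda>i. a i * (of_real r * t) ^ i) sums F (of_real r * t)"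
        using r by (intro a) (auto simp: norm_mult)
      then show "(\<lambda>N. S N t) \<longlonglongrightarrow> F (of_real r * t)"
        by (simp add: S_def sums_def sum_fun_apply power_mult_distrib mult_ac)
    qed
  qed
qed

lemma cauchy_int_H2_disk:
  assumes h: "h \<in> L2"
  shows "cauchy_int h \<in> H2_disk"
proof (rule power_series_H2_disk)
  show "(\<lambda>i. (\<integral>s. h s * cnj s ^ i \<partial>circle) * z ^ i) sums cauchy_int h z" if "norm z < 1" for z
    by (rule cauchy_sums[OF L2_integrable[OF h] that])
  show "(\<Sum>i<N. (cmod (\<integral>s. h s * cnj s ^ i \<partial>circle))\<^sup>2) \<le> (L2.nrm h)\<^sup>2" for N
    using L2.Bessel[of "\<lambda>i t. t ^ i" "{..<N}" h] h
    by (simp add: circle_orthonormal) (simp add: L2_inner_def mult.commute)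
qed

lemma cauchy_int_tendsto:
  assumes h: "integrable circle h" and m: "\<And>j. j \<ge> 1 \<Longrightarrow> (\<integral>t. h t * t ^ j \<partial>circle) = 0"
  shows "AE t in circle. ((\<lambda>r::real. cauchy_int h (of_real r * t)) \<longlongrightarrow> h t) (at_left 1)"
  using poisson_int_tendsto[OF h] AE_circle_norm
proof eventually_elim
  case (elim t)
  have "\<forall>\<^sub>F r in at_left (1::real). poisson_int h (of_real r * t) = cauchy_int h (of_real r * t)"
    using eventually_at_left_real[of 0 1]
  proof (rule eventually_mono)
    fix r :: real assume "r \<in> {0<..<1}"
    then show "poisson_int h (of_real r * t) = cauchy_int h (of_real r * t)"
      using elim(2) by (intro poisson_int_eq_cauchy_int h m) (auto simp: norm_mult)
  qed simp
  then show ?case using elim(1) by (rule Lim_transform_eventually[rotated])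
qed

text \<open>Forward, the dilates are paired with t^j. Backward, the Cauchy integral is the witness:
  it coincides with the Poisson integral, so Fatou's theorem supplies its boundary values.
  Membership is thereby reduced to Fourier coefficients of negative index.\<close>

theorem H2_plus_iff:
  "h \<in> H2_plus \<longleftrightarrow> h \<in> L2 \<and> (\<forall>j\<ge>1. (\<integral>t. h t * t ^ j \<partial>circle) = 0)"
proof (intro iffI conjI allI impI)
  assume h: "h \<in> H2_plus"
  then show "h \<in> L2" by (simp add: H2_plus_def)
  fix j :: nat assume "1 \<le> j"
  then show "(\<integral>t. h t * t ^ j \<partial>circle) = 0"
    using H2_disk_pairing_zero[OF h L2_power_fun(1)[of j]] circle_moment_power
    by (simp only: power_add[symmetric]) simp
next
  assume h: "h \<in> L2 \<and> (\<forall>j\<ge>1. (\<integral>t. h t * t ^ j \<partial>circle) = 0)"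
  then show "h \<in> H2_plus"
    unfolding H2_plus_def
    by (intro CollectI conjI bexI[of _ "cauchy_int h"] cauchy_int_tendsto cauchy_int_H2_disk L2_integrable) auto
qed

lemma H2_plus_L2: "h \<in> H2_plus \<Longrightarrow> h \<in> L2"
  by (simp add: H2_plus_iff)

lemma H2_minus_L2: "h \<in> H2_minus \<Longrightarrow> h \<in> L2"
  by (simp add: H2_minus_def)

lemma H2_plus_moment: "h \<in> H2_plus \<Longrightarrow> j \<ge> 1 \<Longrightarrow> (\<integral>t. h t * t ^ j \<partial>circle) = 0"
  by (simp add: H2_plus_iff)

lemma L2_moment_integrable: "h \<in> L2 \<Longrightarrow> integrable circle (\<lambda>t. h t * t ^ j)"
  by (intro L2_mult_integrable L2_power_fun)

lemma H2_plus_add: "f \<in> H2_plus \<Longrightarrow> g \<in> H2_plus \<Longrightarrow> (\<lambda>t. f t + g t) \<in> H2_plus"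
  by (simp add: H2_plus_iff L2_add distrib_right L2_moment_integrable)

lemma H2_plus_scale: "f \<in> H2_plus \<Longrightarrow> (\<lambda>t. c * f t) \<in> H2_plus"
  by (simp add: H2_plus_iff L2_scale mult.assoc)

lemma H2_plus_const [simp]: "(\<lambda>t. c) \<in> H2_plus"
  by (simp add: H2_plus_iff circle_moment_power)

lemma H2_plus_mult_t: "f \<in> H2_plus \<Longrightarrow> (\<lambda>t. t * f t) \<in> H2_plus"
proof -
  assume f: "f \<in> H2_plus"
  have "(\<integral>t. t * f t * t ^ j \<partial>circle) = 0" for j
    using H2_plus_moment[OF f, of "Suc j"] by (simp add: mult_ac)
  then show ?thesis using L2_power[of f 1] f by (simp add: H2_plus_iff)
qed

lemma H2_minus_add: "f \<in> H2_minus \<Longrightarrow> g \<in> H2_minus \<Longrightarrow> (\<lambda>t. f t + g t) \<in> H2_minus"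
  using L2.ip_add_left[of f g] by (auto simp: H2_minus_def L2_add plus_fun_def H2_plus_L2)

lemma H2_minus_scale: "f \<in> H2_minus \<Longrightarrow> (\<lambda>t. c * f t) \<in> H2_minus"
  using L2.ip_sc_left[of f] by (auto simp: H2_minus_def L2_scale H2_plus_L2)

lemma H2_minus_zero [simp]: "(\<lambda>t. 0) \<in> H2_minus"
  by (simp add: H2_minus_def L2_inner_def)

text \<open>With its converse below, this identifies \<open>H2_minus\<close> with the conjugates of
  t times \<open>H2_plus\<close>; the extra t removes the constant term, which belongs to
  \<open>H2_plus\<close>.\<close>

lemma cnj_mult_t_H2_minus: "f \<in> H2_plus \<Longrightarrow> (\<lambda>t. cnj (t * f t)) \<in> H2_minus"
proof -
  assume f: "f \<in> H2_plus"
  have tf: "(\<lambda>t. t * f t) \<in> L2" using L2_power[of f 1] f by (simp add: H2_plus_iff)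
  have "L2_inner (\<lambda>t. cnj (t * f t)) g = 0" if g: "g \<in> H2_plus" for g
  proof -
    have "(\<integral>t. g t * (t * f t) \<partial>circle) = 0"
    proof (rule H2_disk_pairing_zero[OF g tf])
      show "(\<integral>t. t ^ i * (t * f t) \<partial>circle) = 0" for i
        using H2_plus_moment[OF f, of "Suc i"] by (simp add: mult_ac)
    qed
    then show ?thesis
      unfolding L2_inner_def by (simp flip: complex_cnj_mult)
  qed
  then show ?thesis using L2_cnj[OF tf] by (simp add: H2_minus_def)
qed

lemma cnj_mult_t_H2_plus: "f \<in> H2_minus \<Longrightarrow> (\<lambda>t. cnj (t * f t)) \<in> H2_plus"
proof -
  assume f: "f \<in> H2_minus"
  have tf: "(\<lambda>t. t * f t) \<in> L2" using L2_power[of f 1] f by (simp add: H2_minus_def)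
  have "(\<integral>t. cnj (t * f t) * t ^ j \<partial>circle) = 0" if j: "j \<ge> 1" for j
  proof -
    have "L2_inner f (\<lambda>t. t ^ (j - 1)) = 0"
      using f j by (auto simp: H2_minus_def H2_plus_iff power_add[symmetric] circle_moment_power)
    moreover have "(\<integral>t. cnj (t * f t) * t ^ j \<partial>circle) = cnj (L2_inner f (\<lambda>t. t ^ (j - 1)))"
      unfolding L2_inner_def Bochner_Integration.integral_cnj[symmetric]
    proof (intro Bochner_Integration.integral_cong refl)
      fix t assume "t \<in> space circle"
      then have "cnj t * t = 1" by (auto simp: complex_norm_square[symmetric] mult.commute)
      moreover have "t ^ j = t * t ^ (j - 1)" using j by (cases j) auto
      ultimately show "cnj (t * f t) * t ^ j = cnj (cnj (t ^ (j - 1)) * f t)"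
        by (simp add: mult_ac)
    qed
    ultimately show ?thesis by simp
  qed
  then show ?thesis using L2_cnj[OF tf] by (simp add: H2_plus_iff)
qed

lemma H2_plus_cong_AE:
  assumes h: "h \<in> H2_plus" and g: "AE t in circle. h t = g t" "g \<in> borel_measurable circle"
  shows "g \<in> H2_plus"
proof -
  have gL: "g \<in> L2" using L2_cong_AE[OF H2_plus_L2[OF h] g] .
  have "(\<integral>t. g t * t ^ j \<partial>circle) = (\<integral>t. h t * t ^ j \<partial>circle)" for j
  proof (rule integral_cong_AE)
    show "AE t in circle. g t * t ^ j = h t * t ^ j" using g(1) by eventually_elim simp
  qed (use L2_moment_integrable[OF gL] L2_moment_integrable[OF H2_plus_L2[OF h]] in auto)
  then show ?thesis using h gL by (simp add: H2_plus_iff)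
qed

lemma H2_minus_cong_AE:
  assumes h: "h \<in> H2_minus" and g: "AE t in circle. h t = g t" "g \<in> borel_measurable circle"
  shows "g \<in> H2_minus"
proof -
  have gL: "g \<in> L2" using L2_cong_AE[OF H2_minus_L2[OF h] g] .
  have "L2_inner g f = L2_inner h f" if "f \<in> L2" for f
    unfolding L2_inner_def
  proof (rule integral_cong_AE)
    show "AE t in circle. cnj (f t) * g t = cnj (f t) * h t" using g(1) by eventually_elim simp
  qed (use L2_mult_integrable[OF L2_cnj[OF that] gL] L2_mult_integrable[OF L2_cnj[OF that] H2_minus_L2[OF h]] in auto)
  then show ?thesis using h gL H2_plus_L2 by (simp add: H2_minus_def)
qed

text \<open>The Taylor coefficients are square summable, by Bessel's inequality on each dilate and
  letting the radius tend to 1. Their Riesz-Fischer sum has these as its only nonzero Fourier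
  coefficients, so its Cauchy integral is F.\<close>

theorem H2_disk_boundary:
  assumes F: "F \<in> H2_disk"
  shows "\<exists>h\<in>H2_plus. \<forall>z. cmod z < 1 \<longrightarrow> cauchy_int h z = F z"
proof -
  obtain C where C: "\<And>r::real. 0 \<le> r \<Longrightarrow> r < 1 \<Longrightarrow> (\<lambda>t. F (of_real r * t)) \<in> L2"
    "\<And>r::real. 0 \<le> r \<Longrightarrow> r < 1 \<Longrightarrow> (\<integral>t. (cmod (F (of_real r * t)))\<^sup>2 \<partial>circle) \<le> C"
    using H2_disk_L2[OF F] by blast
  obtain a where a: "\<And>z. norm z < 1 \<Longrightarrow> (\<lambda>i. a i * z ^ i) sums F z"
    using disk_taylor[of F] F by (auto simp: H2_disk_def)
  have bound: "(\<Sum>i<N. (cmod (a i))\<^sup>2) \<le> C" for N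
  proof -
    have le: "(\<Sum>i<N. (cmod (a i * of_real (radius k) ^ i))\<^sup>2) \<le> C" for k
    proof -
      let ?Fk = "\<lambda>t. F (of_real (radius k) * t)"
      have FL: "?Fk \<in> L2" using C(1) radius by auto
      have "L2_inner ?Fk (\<lambda>t. t ^ i) = a i * of_real (radius k) ^ i" for i
      proof -
        have "(\<lambda>j. a j * of_real (radius k) ^ j * (\<integral>t. t ^ j * cnj t ^ i \<partial>circle)) sums
           (\<integral>t. ?Fk t * cnj t ^ i \<partial>circle)"
          by (rule circle_pairing_sums[OF a]) (use radius L2_integrable[OF L2_power_fun(2)] in auto)
        moreover have "(\<lambda>j. a j * of_real (radius k) ^ j * (\<integral>t. t ^ j * cnj t ^ i \<partial>circle)) =
            (\<lambda>j. if j = i then a i * of_real (radius k) ^ i else 0)"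
          using circle_moment_mixed[of i] by (auto simp: mult.commute fun_eq_iff)
        ultimately have "(\<integral>t. ?Fk t * cnj t ^ i \<partial>circle) = a i * of_real (radius k) ^ i"
          using sums_single[of i "\<lambda>_. a i * of_real (radius k) ^ i"] sums_unique2 by fastforce
        then show ?thesis by (simp add: L2_inner_def mult.commute)
      qed
      then have "(\<Sum>i<N. (cmod (a i * of_real (radius k) ^ i))\<^sup>2) \<le> (L2.nrm ?Fk)\<^sup>2"
        using L2.Bessel[of "\<lambda>i t. t ^ i" "{..<N}" ?Fk] FL by (simp add: circle_orthonormal)
      then show ?thesis using C(2)[of "radius k"] radius[of k] by (simp add: L2_nrm_sq[OF FL])
    qed
    have "radius \<longlonglongrightarrow> 1" using radius_at_left by (simp add: filterlim_at)
    then have "(\<lambda>k. \<Sum>i<N. (cmod (a i * of_real (radius k) ^ i))\<^sup>2) \<longlonglongrightarrow> (\<Sum>i<N. (cmod (a i * of_real 1 ^ i))\<^sup>2)"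
      by (intro tendsto_intros)
    then show ?thesis using LIMSEQ_le_const2[OF _ exI[of _ 0]] le by fastforce
  qed
  then have sumA: "summable (\<lambda>i. (cmod (a i))\<^sup>2)"
    by (intro summableI_nonneg_bounded[where x=C]) (auto simp: lessThan_def)
  define S where "S = (\<lambda>N. \<Sum>i<N. (\<lambda>t. a i * t ^ i))"
  have SL: "S N \<in> L2" for N unfolding S_def by (intro L2.sum_in L2_scale L2_power_fun)
  have S_diff: "(L2.nrm (S m - S n))\<^sup>2 = (\<Sum>i\<in>{n..<m}. (cmod (a i))\<^sup>2)" if "n \<le> m" for m n
  proof -
    have "S m - S n = (\<Sum>i\<in>{n..<m}. (\<lambda>t. a i * t ^ i))"
      using sum_diff_nat_ivl[of 0 n m "\<lambda>i t. a i * t ^ i"] that by (simp add: S_def lessThan_atLeast0)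
    then show ?thesis using L2.nrm_sq_orthonormal_sum[of "\<lambda>i t. t ^ i" "{n..<m}" a] by (simp add: circle_orthonormal)
  qed
  obtain h where h: "h \<in> L2" "(\<lambda>N. L2.nrm (S N - h)) \<longlonglongrightarrow> 0"
  proof (rule bexE[OF L2.complete[of S]])
    fix e :: real assume "e > 0"
    then obtain N where N: "\<And>m n. m \<ge> N \<Longrightarrow> norm (\<Sum>i\<in>{m..<n}. (cmod (a i))\<^sup>2) < e\<^sup>2"
      using sumA unfolding summable_Cauchy by (meson zero_less_power)
    have *: "L2.nrm (S m - S n) < e" if "n \<ge> N" "m \<ge> n" for m n
    proof (rule power2_less_imp_less)
      show "(L2.nrm (S m - S n))\<^sup>2 < e\<^sup>2" using N[of n m] that by (simp add: S_diff)
    qed (use \<open>e > 0\<close> in simp)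
    have "L2.nrm (S m - S n) < e" if "m \<ge> N" "n \<ge> N" for m n
      using *[of n m] *[of m n] that L2.nrm_minus_commute[OF SL SL, of m n] by (cases "m \<ge> n") auto
    then show "\<exists>N. \<forall>m\<ge>N. \<forall>n\<ge>N. L2.nrm (S m - S n) < e" by blast
  qed (use SL in auto)
  have coef: "(\<integral>t. h t * cnj t ^ j \<partial>circle) = a j" for j
  proof -
    have "L2_inner (S N) (\<lambda>t. t ^ j) = a j" if "N > j" for N
    proof -
      have "L2_inner (S N) (\<lambda>t. t ^ j) = (\<Sum>i<N. L2_inner (\<lambda>t. a i * t ^ i) (\<lambda>t. t ^ j))"
        unfolding S_def by (rule L2.ip_sum_left) (auto intro: L2_scale)
      also have "\<dots> = (\<Sum>i<N. if i = j then a i else 0)"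
        by (intro sum.cong refl) (simp add: L2.ip_sc_left circle_orthonormal)
      finally show ?thesis using that by simp
    qed
    then have "\<forall>\<^sub>F N in sequentially. L2_inner (S N) (\<lambda>t. t ^ j) = a j"
      by (rule eventually_mono[OF eventually_gt_at_top[of j]])
    moreover have "(\<lambda>N. L2_inner (S N) (\<lambda>t. t ^ j)) \<longlonglongrightarrow> L2_inner h (\<lambda>t. t ^ j)"
      by (rule L2.ip_tendsto_left[OF SL h(1) L2_power_fun(1) h(2)])
    ultimately have "L2_inner h (\<lambda>t. t ^ j) = a j"
      by (metis LIMSEQ_unique tendsto_eventually)
    then show ?thesis by (simp add: L2_inner_def mult.commute)
  qed
  have mom: "(\<integral>t. h t * t ^ j \<partial>circle) = 0" if "j \<ge> 1" for j
  proof -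
    have "L2_inner (S N) (\<lambda>t. cnj t ^ j) = 0" for N
    proof -
      have "L2_inner (S N) (\<lambda>t. cnj t ^ j) = (\<Sum>i<N. L2_inner (\<lambda>t. a i * t ^ i) (\<lambda>t. cnj t ^ j))"
        unfolding S_def by (rule L2.ip_sum_left) (auto intro: L2_scale)
      also have "\<dots> = (\<Sum>i<N. 0)"
      proof (intro sum.cong refl)
        fix i
        have "L2_inner (\<lambda>t. t ^ i) (\<lambda>t. cnj t ^ j) = (\<integral>t. t ^ (i + j) \<partial>circle)"
          by (simp add: L2_inner_def power_add mult.commute)
        then show "L2_inner (\<lambda>t. a i * t ^ i) (\<lambda>t. cnj t ^ j) = 0"
          using that by (simp add: L2.ip_sc_left circle_moment_power)
      qed
      finally show ?thesis by simp
    qed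
    then have "L2_inner h (\<lambda>t. cnj t ^ j) = 0"
      using L2.ip_tendsto_left[OF SL h(1) L2_power_fun(2)[of j] h(2)] by (simp add: LIMSEQ_const_iff)
    then show ?thesis by (simp add: L2_inner_def mult.commute)
  qed
  have "cauchy_int h z = F z" if "cmod z < 1" for z
    using cauchy_sums[OF L2_integrable[OF h(1)] that] a[OF that] sums_unique2 by (simp add: coef)
  then show ?thesis using h(1) mom by (intro bexI[of _ h]) (auto simp: H2_plus_iff)
qed

lemma H2_plus_cauchy_tendsto:
  "h \<in> H2_plus \<Longrightarrow> AE t in circle. ((\<lambda>r::real. cauchy_int h (of_real r * t)) \<longlongrightarrow> h t) (at_left 1)"
  by (intro cauchy_int_tendsto L2_integrable H2_plus_L2 H2_plus_moment)

section \<open>Outer functions and the zeros of boundary values\<close>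

text \<open>\<open>outer u\<close> is the outer function whose modulus has boundary values \<open>exp u\<close>.\<close>

definition outer :: "(complex \<Rightarrow> real) \<Rightarrow> complex \<Rightarrow> complex" where
  "outer u z = exp (2 * cauchy_int (\<lambda>t. of_real (u t)) z - of_real (\<integral>t. u t \<partial>circle))"

context
  fixes u :: "complex \<Rightarrow> real"
  assumes u: "integrable circle u"
begin

lemma outer_holomorphic: "outer u holomorphic_on ball 0 1"
  unfolding outer_def by (intro holomorphic_intros cauchy_int_holomorphic) (use u in simp)

text \<open>For real u the Poisson integral is twice the real part of the Cauchy integral minus the
  mean, which explains the exponent in \<open>outer\<close>.\<close>

lemma norm_outer: "cmod z < 1 \<Longrightarrow> cmod (outer u z) = exp (Re (poisson_int (\<lambda>t. of_real (u t)) z))"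
  using u by (simp add: outer_def poisson_int_eq)

lemma outer_zero: "outer u 0 = exp (of_real (\<integral>t. u t \<partial>circle))"
proof -
  have "cauchy_int (\<lambda>t. of_real (u t)) 0 = (\<integral>t. complex_of_real (u t) \<partial>circle)"
    unfolding cauchy_int_def by (intro Bochner_Integration.integral_cong) auto
  then show ?thesis by (simp add: outer_def)
qed

lemma outer_tendsto: "AE t in circle. ((\<lambda>r::real. cmod (outer u (of_real r * t))) \<longlongrightarrow> exp (u t)) (at_left 1)"
proof -
  have ui: "integrable circle (\<lambda>t. complex_of_real (u t))" using u by simp
  show ?thesis using poisson_int_tendsto[OF ui] AE_circle_norm
  proof eventually_elim
  case (elim t)
  have "((\<lambda>r::real. exp (Re (poisson_int (\<lambda>t. of_real (u t)) (of_real r * t)))) \<longlongrightarrow> exp (Re (of_real (u t)))) (at_left 1)"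
    by (intro tendsto_intros elim)
  moreover have "\<forall>\<^sub>F r in at_left (1::real). exp (Re (poisson_int (\<lambda>t. of_real (u t)) (of_real r * t))) = cmod (outer u (of_real r * t))"
    using eventually_at_left_real[of 0 1]
  proof (rule eventually_mono)
    fix r :: real assume "r \<in> {0<..<1}"
    then show "exp (Re (poisson_int (\<lambda>t. of_real (u t)) (of_real r * t))) = cmod (outer u (of_real r * t))"
      using elim by (subst norm_outer) (auto simp: norm_mult)
  qed simp
  ultimately show ?case by (simp add: Lim_transform_eventually)
  qed
qed

text \<open>The Poisson kernel is nonnegative with total mass 1, so an upper bound for u persists
  inside the disk.\<close>

lemma outer_bounded:
  assumes B: "AE t in circle. u t \<le> B" and z: "cmod z < 1"
  shows "cmod (outer u z) \<le> exp B"
proof -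
  define p where "p = (\<lambda>s. (1 - (norm z)\<^sup>2) / (norm (s - z))\<^sup>2)"
  have p0: "0 \<le> p s" for s using z by (simp add: p_def power_le_one)
  have I: "integrable circle (\<lambda>t. complex_of_real (u t * p t))"
    using integrable_poisson_kernel[of "\<lambda>t. of_real (u t)" z] u z by (simp add: p_def)
  have J: "integrable circle (\<lambda>t. complex_of_real (B * p t))"
    using integrable_poisson_kernel[of "\<lambda>t. of_real B" z] z by (simp add: p_def)
  have eq: "poisson_int (\<lambda>t. of_real (u t)) z = of_real (\<integral>t. u t * p t \<partial>circle)"
    unfolding poisson_int_def p_def integral_complex_of_real[symmetric] by simp
  have "complex_of_real B = of_real (\<integral>t. B * p t \<partial>circle)"
    using poisson_int_const[OF z, of "of_real B"]
    unfolding poisson_int_def p_def integral_complex_of_real[symmetric] by simp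
  then have Beq: "B = (\<integral>t. B * p t \<partial>circle)" by (simp only: of_real_eq_iff)
  have le: "(\<integral>t. u t * p t \<partial>circle) \<le> (\<integral>t. B * p t \<partial>circle)"
  proof (rule integral_mono_AE)
    show "AE t in circle. u t * p t \<le> B * p t" using B by eventually_elim (intro mult_right_mono p0)
  qed (use I J complex_of_real_integrable_eq in blast)+
  show ?thesis
    unfolding norm_outer[OF z] eq using ord_le_eq_trans[OF le Beq[symmetric]] by simp
qed

end

lemma bounded_H2_disk:
  assumes F: "F holomorphic_on ball 0 1" and B: "\<And>z. cmod z < 1 \<Longrightarrow> cmod (F z) \<le> B"
  shows "F \<in> H2_disk"
  unfolding H2_disk_def
proof (intro CollectI conjI F exI allI impI)
  fix r :: real assume r: "0 \<le> r \<and> r < 1"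
  have "(\<integral>t. (cmod (F (of_real r * t)))\<^sup>2 \<partial>circle) \<le> (\<integral>t. B\<^sup>2 \<partial>circle)"
  proof (rule integral_mono_AE)
    show "integrable circle (\<lambda>t. (cmod (F (of_real r * t)))\<^sup>2)"
      using r F by (intro L2_integrable_sq L2_sphere disk_circle_continuous) auto
    show "AE t in circle. (cmod (F (of_real r * t)))\<^sup>2 \<le> B\<^sup>2"
      using r by (intro AE_I2 power_mono B) (auto simp: norm_mult)
  qed simp
  then show "(\<integral>t. (cmod (F (of_real r * t)))\<^sup>2 \<partial>circle) \<le> B\<^sup>2" by simp
qed

text \<open>Suppose h vanishes on a set E of positive measure. Multiply by an outer function with
  value 1 at 0 that is large on E, where h does not see it, and has modulus exp (- c) elsewhere. The
  mean of h is kept while its L^1 norm is scaled by exp (- c), and c is arbitrary.\<close>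

theorem H2_plus_nonzero_AE:
  assumes h: "h \<in> H2_plus" and h0: "(\<integral>t. h t \<partial>circle) \<noteq> 0"
  shows "AE t in circle. h t \<noteq> 0"
proof (rule ccontr)
  assume nAE: "\<not> (AE t in circle. h t \<noteq> 0)"
  note hL = H2_plus_L2[OF h]
  note [measurable] = L2_measurable[OF hL]
  define E where "E = {t \<in> space circle. h t = 0}"
  have E [measurable]: "E \<in> sets circle" unfolding E_def by measurable
  define \<epsilon> where "\<epsilon> = measure circle E"
  have "E \<notin> null_sets circle"
  proof
    assume "E \<in> null_sets circle"
    then have "AE t in circle. t \<notin> E" by (rule AE_not_in)
    then have "AE t in circle. h t \<noteq> 0" using AE_space[of circle] by eventually_elim (auto simp: E_def)
    with nAE show False by simp
  qed
  then have \<epsilon>: "\<epsilon> > 0"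
    using E by (auto simp: \<epsilon>_def circle.emeasure_eq_measure null_sets_def zero_less_measure_iff)
  define F where "F = cauchy_int h"
  have FD: "F \<in> H2_disk" and Fhol: "F holomorphic_on ball 0 1"
    unfolding F_def using cauchy_int_H2_disk[OF hL] by (auto simp: H2_disk_def)
  have F0: "F 0 = (\<integral>t. h t \<partial>circle)"
    unfolding F_def cauchy_int_def by (intro Bochner_Integration.integral_cong) auto
  have FL: "(\<lambda>t. F (of_real (radius k) * t)) \<in> L2" for k
    using H2_disk_L2[OF FD] radius by metis
  define I where "I = (\<integral>t. cmod (h t) \<partial>circle)"
  have key: "cmod (F 0) \<le> exp (- c) * I" if c: "c \<ge> 0" for c :: real
  proof -
    \<comment> \<open>The value on E is balanced so that u has mean zero, hence \<open>G\<close> has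
      value 1 at 0; off E it is - c.\<close>
    define u where "u = (\<lambda>t. c * (indicator E t / \<epsilon> - 1) :: real)"
    have indI: "integrable circle (indicator E :: complex \<Rightarrow> real)"
      using E by (simp add: circle.emeasure_eq_measure less_top[symmetric])
    have uI: "integrable circle u" unfolding u_def using indI by auto
    have "(\<integral>t. u t \<partial>circle) = c * ((\<integral>t. indicator E t \<partial>circle) / \<epsilon> - 1)"
      unfolding u_def using indI by simp
    also have "(\<integral>t. indicator E t \<partial>circle) = \<epsilon>" by (simp add: \<epsilon>_def E_def Int_def conj_commute)
    finally have u0: "(\<integral>t. u t \<partial>circle) = 0" using \<epsilon> by simp
    define G where "G = outer u"
    have G0: "G 0 = 1" using outer_zero[OF uI] u0 by (simp add: G_def)
    have Ghol: "G holomorphic_on ball 0 1" unfolding G_def by (rule outer_holomorphic[OF uI])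
    define M where "M = exp (c / \<epsilon>)"
    have "AE t in circle. u t \<le> c / \<epsilon>"
      using c \<epsilon> by (intro AE_I2) (auto simp: u_def indicator_def field_simps)
    then have GM: "cmod (G z) \<le> M" if "cmod z < 1" for z
      unfolding G_def M_def using outer_bounded[OF uI _ that] by blast
    have GM': "cmod (G (of_real (radius k) * t)) \<le> M" if "norm t = 1" for k t
      using that radius[of k] by (intro GM) (simp add: norm_mult)
    have GL: "(\<lambda>t. G (of_real (radius k) * t)) \<in> L2" for k
      using radius by (intro L2_sphere disk_circle_continuous Ghol) auto
    define J where "J k = (\<integral>t. cmod (h t) * cmod (G (of_real (radius k) * t)) \<partial>circle)" for k
    define D where "D k = (\<integral>t. cmod 1 * cmod (F (of_real (radius k) * t) - h t) \<partial>circle)" for k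
    \<comment> \<open>Only \<open>F\<close> is split into h and a remainder. The bound M, large in
      c, multiplies D k, which tends to 0 for fixed c.\<close>
    have step: "cmod (F 0) \<le> M * D k + J k" for k
    proof -
      have "(\<integral>t. F (of_real (radius k) * t) * G (of_real (radius k) * t) \<partial>circle) = F 0 * G 0"
        by (rule circle_mean_value[of "\<lambda>z. F z * G z"]) (use Fhol Ghol radius in \<open>auto intro: holomorphic_intros\<close>)
      then have "cmod (F 0) = cmod (\<integral>t. F (of_real (radius k) * t) * G (of_real (radius k) * t) \<partial>circle)"
        by (simp add: G0)
      also have "\<dots> \<le> (\<integral>t. cmod (F (of_real (radius k) * t) * G (of_real (radius k) * t)) \<partial>circle)"
        by (rule integral_norm_bound)
      also have "\<dots> \<le> (\<integral>t. M * (cmod 1 * cmod (F (of_real (radius k) * t) - h t)) +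
          cmod (h t) * cmod (G (of_real (radius k) * t)) \<partial>circle)"
      proof (rule integral_mono_AE)
        show "integrable circle (\<lambda>t. cmod (F (of_real (radius k) * t) * G (of_real (radius k) * t)))"
          by (intro integrable_norm L2_mult_integrable FL GL)
        have i1: "integrable circle (\<lambda>t. F (of_real (radius k) * t) - h t)"
          using L2_integrable[OF FL[of k]] L2_integrable[OF hL] by simp
        have i2: "integrable circle (\<lambda>t. cmod (h t) * cmod (G (of_real (radius k) * t)))"
          using integrable_norm[OF L2_mult_integrable[OF hL GL[of k]]] by (simp add: norm_mult)
        show "integrable circle (\<lambda>t. M * (cmod 1 * cmod (F (of_real (radius k) * t) - h t)) +
            cmod (h t) * cmod (G (of_real (radius k) * t)))"
          using integrable_norm[OF i1] i2 by auto
        show "AE t in circle. cmod (F (of_real (radius k) * t) * G (of_real (radius k) * t)) \<le>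
            M * (cmod 1 * cmod (F (of_real (radius k) * t) - h t)) + cmod (h t) * cmod (G (of_real (radius k) * t))"
          using AE_circle_norm
        proof eventually_elim
          case (elim t)
          define x y where "x = F (of_real (radius k) * t)" and "y = G (of_real (radius k) * t)"
          have y: "cmod y \<le> M" using GM'[OF elim] by (simp add: y_def)
          have "cmod (x * y) \<le> (cmod (x - h t) + cmod (h t)) * cmod y"
            unfolding norm_mult using norm_triangle_ineq[of "x - h t" "h t"] by (intro mult_right_mono) auto
          also have "\<dots> \<le> M * cmod (x - h t) + cmod (h t) * cmod y"
            using mult_left_mono[OF y, of "cmod (x - h t)"] by (simp add: algebra_simps)
          finally show ?case by (simp add: x_def y_def)
        qed
      qed
      also have "\<dots> = M * D k + J k"
        unfolding D_def J_def
        using integrable_norm[OF L2_mult_integrable[OF hL GL[of k]]]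
          integrable_norm[OF Bochner_Integration.integrable_diff[OF L2_integrable[OF FL[of k]] L2_integrable[OF hL]]]
        by (simp add: norm_mult)
      finally show ?thesis .
    qed
    have D0: "D \<longlonglongrightarrow> 0"
      unfolding D_def
      by (rule H2_disk_tendsto[OF hL FD _ L2_const]) (use H2_plus_cauchy_tendsto[OF h] in \<open>simp add: F_def\<close>)
    have "(\<lambda>k. J k) \<longlonglongrightarrow> (\<integral>t. exp (- c) * cmod (h t) \<partial>circle)"
      unfolding J_def
    proof (rule integral_dominated_convergence[where w="\<lambda>t. M * cmod (h t)"])
      show "(\<lambda>t. exp (- c) * cmod (h t)) \<in> borel_measurable circle" by measurable
      show "(\<lambda>t. cmod (h t) * cmod (G (of_real (radius k) * t))) \<in> borel_measurable circle" for k
        using L2_measurable[OF GL[of k]] by measurable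
      show "integrable circle (\<lambda>t. M * cmod (h t))" using L2_integrable[OF hL] by auto
      show "AE t in circle. (\<lambda>k. cmod (h t) * cmod (G (of_real (radius k) * t))) \<longlonglongrightarrow> exp (- c) * cmod (h t)"
        using outer_tendsto[OF uI] AE_space[of circle]
      proof eventually_elim
        case (elim t)
        have "(\<lambda>k. cmod (G (of_real (radius k) * t))) \<longlonglongrightarrow> exp (u t)"
          unfolding G_def by (rule filterlim_compose[OF elim(1) radius_at_left])
        then have "(\<lambda>k. cmod (h t) * cmod (G (of_real (radius k) * t))) \<longlonglongrightarrow> cmod (h t) * exp (u t)"
          by (intro tendsto_intros)
        moreover have "cmod (h t) * exp (u t) = exp (- c) * cmod (h t)"
        proof (cases "h t = 0")
          case False
          then have "t \<notin> E" by (simp add: E_def)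
          then show ?thesis by (simp add: u_def)
        qed simp
        ultimately show ?case by simp
      qed
      show "AE t in circle. norm (cmod (h t) * cmod (G (of_real (radius k) * t))) \<le> M * cmod (h t)" for k
        using AE_circle_norm
      proof eventually_elim
        case (elim t)
        show ?case using mult_left_mono[OF GM'[OF elim, of k], of "cmod (h t)"] by (simp add: mult.commute)
      qed
    qed
    then have "(\<lambda>k. M * D k + J k) \<longlonglongrightarrow> M * 0 + exp (- c) * I"
      using D0 by (intro tendsto_intros) (simp_all add: I_def)
    then show ?thesis using step by (intro LIMSEQ_le_const[where X="\<lambda>k. M * D k + J k"]) auto
  qed
  have "(\<lambda>n. exp (- real n) * I) \<longlonglongrightarrow> 0" by real_asymp
  then have "cmod (F 0) \<le> 0" using key by (intro LIMSEQ_le_const) auto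
  then show False using h0 F0 by simp
qed

unbundle no Formal_Power_Series.fps_syntax

section \<open>The space \<open>L\<^sup>R\<close>\<close>

context semi_inner_space
begin

lemma closed_subspace_closure:
  assumes S: "S \<subseteq> V" "0 \<in> S" "\<And>x y. x \<in> S \<Longrightarrow> y \<in> S \<Longrightarrow> x + y \<in> S" "\<And>c x. x \<in> S \<Longrightarrow> sc c x \<in> S"
  shows "closed_subspace {f \<in> V. \<forall>e>0. \<exists>g\<in>S. nrm (f - g) < e}" (is "closed_subspace ?C")
  unfolding closed_subspace_def
proof (intro conjI ballI allI impI)
  show "?C \<subseteq> V" by blast
  show "0 \<in> ?C" using S(2) by (auto intro!: bexI[of _ 0])
next
  fix x y assume x: "x \<in> ?C" and y: "y \<in> ?C"
  have "\<exists>g\<in>S. nrm (x + y - g) < e" if "e > 0" for e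
  proof -
    have "e / 2 > 0" using that by simp
    then obtain g h where g: "g \<in> S" "nrm (x - g) < e / 2" and h: "h \<in> S" "nrm (y - h) < e / 2"
      using x y by blast
    have "nrm ((x - g) + (y - h)) \<le> nrm (x - g) + nrm (y - h)"
      using x y g h S by (intro nrm_triangle) auto
    then have "nrm (x + y - (g + h)) < e" using g h by (simp add: algebra_simps)
    then show ?thesis using S g h by blast
  qed
  then show "x + y \<in> ?C" using x y by simp
next
  fix c x assume x: "x \<in> ?C"
  have "\<exists>g\<in>S. nrm (sc c x - g) < e" if "e > 0" for e
  proof -
    have "e / (cmod c + 1) > 0" using that by (simp add: add_nonneg_pos)
    then obtain g where g: "g \<in> S" "nrm (x - g) < e / (cmod c + 1)"
      using x by blast
    have "nrm (sc c x - sc c g) = cmod c * nrm (x - g)"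
      using x g S by (auto simp: sc_diff[symmetric] nrm_sc)
    also have "\<dots> \<le> (cmod c + 1) * nrm (x - g)"
      using x g S by (intro mult_right_mono) auto
    also have "\<dots> < e" using g(2) by (simp add: pos_less_divide_eq add_nonneg_pos mult.commute)
    finally show ?thesis using S(4)[OF g(1)] by blast
  qed
  then show "sc c x \<in> ?C" using x by simp
next
  fix x assume x: "x \<in> V" and lim: "\<forall>e>0. \<exists>g\<in>?C. nrm (x - g) < e"
  have "\<exists>g\<in>S. nrm (x - g) < e" if "e > 0" for e
  proof -
    have e2: "e / 2 > 0" using that by simp
    then obtain h where h: "h \<in> ?C" "nrm (x - h) < e / 2" using lim by blast
    then obtain g where g: "g \<in> S" "nrm (h - g) < e / 2" using e2 by blast
    have "nrm (x - g) \<le> nrm (x - h) + nrm (h - g)"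
      using x h g S by (intro nrm_triangle_diff) auto
    then show ?thesis using g h by (intro bexI[of _ g]) auto
  qed
  then show "x \<in> ?C" using x by simp
qed

lemma closure_orthogonal:
  assumes S: "S \<subseteq> V" and f: "f \<in> V" "\<And>g. g \<in> S \<Longrightarrow> ip f g = 0"
    and x: "x \<in> V" "\<And>e. e > 0 \<Longrightarrow> \<exists>g\<in>S. nrm (x - g) < e"
  shows "ip f x = 0"
proof (rule ccontr)
  assume nz: "ip f x \<noteq> 0"
  define e where "e = cmod (ip f x) / (nrm f + 1)"
  have p: "nrm f + 1 > 0" using f by (simp add: add_nonneg_pos)
  then have "e > 0" using nz by (simp add: e_def)
  then obtain g where g: "g \<in> S" "nrm (x - g) < e" using x by blast
  have "ip f x = ip f (x - g)" using f x g S by (auto simp: ip_diff_right)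
  then have "cmod (ip f x) \<le> nrm f * nrm (x - g)" using Cauchy_Schwarz[of f "x - g"] f x g S by auto
  also have "\<dots> \<le> (nrm f + 1) * nrm (x - g)" using x g S by (intro mult_right_mono) auto
  also have "\<dots> < (nrm f + 1) * e" using g(2) p by simp
  also have "\<dots> = cmod (ip f x)" using p by (simp add: e_def)
  finally show False by simp
qed

lemma closed_subspace_orthogonal:
  assumes W: "W \<subseteq> V"
  shows "closed_subspace {f \<in> V. \<forall>g\<in>W. ip f g = 0}"
  unfolding closed_subspace_def
proof (intro conjI ballI allI impI)
  fix x assume x: "x \<in> V" and lim: "\<forall>e>0. \<exists>g\<in>{f \<in> V. \<forall>g\<in>W. ip f g = 0}. nrm (x - g) < e"
  have "ip g x = 0" if g: "g \<in> W" for g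
  proof (rule closure_orthogonal[where S="{f \<in> V. \<forall>g\<in>W. ip f g = 0}"])
    show "ip g f = 0" if "f \<in> {f \<in> V. \<forall>g\<in>W. ip f g = 0}" for f
      using that g W ip_cnj[of f g] by auto
  qed (use x lim g W in auto)
  then show "x \<in> {f \<in> V. \<forall>g\<in>W. ip f g = 0}"
    using x W ip_cnj[of _ x] by auto
qed (use W in \<open>auto simp: ip_simps subset_eq\<close>)

text \<open>The projections are given by their defining properties because \<open>LR_proj\<close>
  chooses representatives; contractivity then holds for every choice.\<close>

lemma orthogonal_proj_lipschitz:
  assumes W: "closed_subspace W" and a: "a \<in> V" "b \<in> V" and p: "p \<in> W" "q \<in> W"
    and pa: "\<And>g. g \<in> W \<Longrightarrow> ip (a - p) g = 0" and qb: "\<And>g. g \<in> W \<Longrightarrow> ip (b - q) g = 0"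
  shows "nrm (p - q) \<le> nrm (a - b)"
proof -
  note WV = csub_V[OF W]
  have pq: "p - q \<in> W" using p by (rule csub_diff[OF W])
  have "ip ((a - b) - (p - q)) (p - q) = ip (a - p) (p - q) - ip (b - q) (p - q)"
    using a p WV by (simp add: ip_simps)
  then have "ip (a - b) (p - q) = ip (p - q) (p - q)" using pa[OF pq] qb[OF pq] a p WV pq by (simp add: ip_diff_left)
  then have "complex_of_real ((nrm (p - q))\<^sup>2) = ip (a - b) (p - q)" using WV[OF pq] by (simp only: ip_self)
  then have "cmod (complex_of_real ((nrm (p - q))\<^sup>2)) \<le> nrm (a - b) * nrm (p - q)"
    using Cauchy_Schwarz[of "a - b" "p - q"] a WV[OF pq] by simp
  then have "nrm (p - q) * nrm (p - q) \<le> nrm (a - b) * nrm (p - q)"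
    unfolding norm_of_real by (simp add: power2_eq_square)
  then show ?thesis
    using nrm_nonneg[OF WV[OF pq]] a by (cases "nrm (p - q) = 0") auto
qed

end

section \<open>The weight matrix, its inverse and the weighted inner product\<close>

definition vmult :: "(complex \<Rightarrow> complex) \<Rightarrow> vfun \<Rightarrow> vfun" where
  "vmult c f = (\<lambda>t. c t *s f t)"

lemma vector2_eqI: "x $ 1 = y $ 1 \<Longrightarrow> x $ 2 = y $ 2 \<Longrightarrow> x = y" for x y :: "'a^2"
  by (simp add: vec_eq_iff forall_2)

lemma borel_measurable_vec_nth [measurable (raw)]:
  "f \<in> borel_measurable M \<Longrightarrow> (\<lambda>x. f x $ i) \<in> borel_measurable M" for f :: "'a \<Rightarrow> complex^2"
  by (rule borel_measurable_continuous_on[of "\<lambda>v. v $ i"]) (auto intro!: continuous_intros)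

lemma borel_measurable_vec2:
  fixes f :: "'a \<Rightarrow> complex^2"
  assumes "(\<lambda>x. f x $ 1) \<in> borel_measurable M" "(\<lambda>x. f x $ 2) \<in> borel_measurable M"
  shows "f \<in> borel_measurable M"
proof -
  have eq: "f = (\<lambda>x. axis 1 (f x $ 1) + axis 2 (f x $ 2))"
    by (auto simp: fun_eq_iff vec_eq_iff forall_2 axis_def)
  have "continuous_on UNIV (\<lambda>z::complex. axis i z :: complex^2)" for i
    unfolding axis_def
  proof (intro continuous_on_vec_lambda)
    show "continuous_on UNIV (\<lambda>z::complex. if j = i then z else 0)" for j
      by (cases "j = i") (auto intro: continuous_intros)
  qed
  then show ?thesis
    by (subst eq) (intro borel_measurable_add borel_measurable_continuous_on[of "axis _"] assms)
qed

lemma weight_mult_vector: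
  "weight R t *v v = vector [v $ 1 + cnj (R t) * v $ 2, R t * v $ 1 + v $ 2]"
  by (simp add: weight_def vec_eq_iff forall_2 matrix_vector_mult_def sum_2)

text \<open>For |R| < 1 the determinant 1 - |R|^2 is nonzero. Since \<open>matrix_inv\<close> is a
  choice, it is compared with an explicit two-sided inverse.\<close>

lemma matrix_inv_weight:
  assumes "cmod (R t) < 1"
  shows "matrix_inv (weight R t) *v v =
    vector [(v $ 1 - cnj (R t) * v $ 2) / (1 - (cmod (R t))\<^sup>2), (v $ 2 - R t * v $ 1) / (1 - (cmod (R t))\<^sup>2)]"
proof -
  define D where "D = complex_of_real (1 - (cmod (R t))\<^sup>2)"
  have "(cmod (R t))\<^sup>2 < 1" using assms by (simp add: abs_square_less_1)
  then have D: "D \<noteq> 0" by (simp add: D_def del: of_real_diff of_real_power)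
  have DR: "D = 1 - R t * cnj (R t)"
    by (simp only: D_def of_real_diff complex_norm_square of_real_1)
  define B :: "complex^2^2" where "B = vector [vector [1 / D, - cnj (R t) / D], vector [- R t / D, 1 / D]]"
  have 1: "weight R t ** B = mat 1"
    using D by (auto simp: weight_def B_def vec_eq_iff forall_2 matrix_matrix_mult_def sum_2 mat_def divide_simps)
      (auto simp: DR algebra_simps)
  have 2: "B ** weight R t = mat 1"
    using D by (auto simp: weight_def B_def vec_eq_iff forall_2 matrix_matrix_mult_def sum_2 mat_def divide_simps)
      (auto simp: DR algebra_simps)
  have inv: "matrix_inv (weight R t) = B"
  proof -
    have "weight R t ** matrix_inv (weight R t) = mat 1 \<and> matrix_inv (weight R t) ** weight R t = mat 1"
      unfolding matrix_inv_def by (rule someI[of _ B]) (use 1 2 in blast)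
    then have "matrix_inv (weight R t) ** weight R t = mat 1" by simp
    then have "matrix_inv (weight R t) ** (weight R t ** B) = B"
      by (simp add: matrix_mul_assoc)
    then show ?thesis by (simp add: 1)
  qed
  show ?thesis
    unfolding inv D_def[symmetric] by (rule vector2_eqI)
      (auto simp: B_def matrix_vector_mult_def sum_2 diff_divide_distrib)
qed

lemma LR_form_eq:
  assumes "cmod (R t) < 1"
  shows "LR_form R f g t =
    (cnj (g t $ 1) * (f t $ 1 - cnj (R t) * f t $ 2) + cnj (g t $ 2) * (f t $ 2 - R t * f t $ 1)) / (1 - (cmod (R t))\<^sup>2)"
  unfolding LR_form_def sum_2 matrix_inv_weight[of R t, OF assms] by (simp add: add_divide_distrib)

text \<open>Rests on completeness of \<open>circle\<close>. It yields measurability of expressions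
  that are only known explicitly where |R| < 1.\<close>

lemma circle_measurable_cong_AE:
  assumes f: "f \<in> borel_measurable circle" and eq: "AE t in circle. f t = g t"
  shows "g \<in> borel_measurable circle"
proof (rule measurableI)
  fix A :: "'a set" assume A: "A \<in> sets borel"
  show "g -` A \<inter> space circle \<in> sets circle"
  proof (rule circle.in_sets_AE)
    show "AE t in circle. (t \<in> f -` A \<inter> space circle) = (t \<in> g -` A \<inter> space circle)"
      using eq by eventually_elim auto
  qed (use measurable_sets[OF f A] in auto)
qed simp

locale LR_weight =
  fixes R :: "complex \<Rightarrow> complex"
  assumes Rm [measurable]: "R \<in> borel_measurable circle"
    and Rlog: "log_integrable circle (\<lambda>t. 1 - cmod (R t))"
begin

lemma R_lt_1: "AE t in circle. cmod (R t) < 1"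
  using Rlog by (simp add: log_integrable_def)

lemma R_le_1: "AE t in circle. cmod (R t) \<le> 1"
  using R_lt_1 by eventually_elim simp

definition comp2 :: "vfun \<Rightarrow> complex \<Rightarrow> complex" where
  "comp2 f t = (f t $ 2 - R t * f t $ 1) / of_real (sqrt (1 - (cmod (R t))\<^sup>2))"

text \<open>The factorization of the inverse weight: \<open>f \<mapsto> (f\<^sub>1, comp2 f)\<close> is an isometry into \<open>L\<^sup>2 \<oplus> L\<^sup>2\<close>.\<close>

lemma LR_form_split:
  assumes "cmod (R t) < 1"
  shows "LR_form R f g t = cnj (g t $ 1) * f t $ 1 + cnj (comp2 g t) * comp2 f t"
proof -
  define D where "D = complex_of_real (1 - (cmod (R t))\<^sup>2)"
  have p: "(cmod (R t))\<^sup>2 < 1" using assms by (simp add: abs_square_less_1)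
  then have D: "D \<noteq> 0" by (simp add: D_def del: of_real_diff of_real_power)
  have DR: "D = 1 - R t * cnj (R t)"
    by (simp only: D_def of_real_diff complex_norm_square of_real_1)
  have sq: "complex_of_real (sqrt (1 - (cmod (R t))\<^sup>2)) * of_real (sqrt (1 - (cmod (R t))\<^sup>2)) = D"
    unfolding of_real_mult[symmetric] D_def using p by simp
  have "cnj (comp2 g t) * comp2 f t = cnj (g t $ 2 - R t * g t $ 1) * (f t $ 2 - R t * f t $ 1) / D"
    unfolding comp2_def by (simp add: sq)
  moreover have "LR_form R f g t =
    (cnj (g t $ 1) * (f t $ 1 - cnj (R t) * f t $ 2) + cnj (g t $ 2) * (f t $ 2 - R t * f t $ 1)) / D"
    unfolding D_def by (rule LR_form_eq[of R t, OF assms])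
  moreover have "(cnj g1 * (f1 - cnj (R t) * f2) + cnj g2 * (f2 - R t * f1)) / D =
      cnj g1 * f1 + cnj (g2 - R t * g1) * (f2 - R t * f1) / D" for f1 f2 g1 g2
    using D by (simp add: divide_simps) (simp add: DR algebra_simps)
  ultimately show ?thesis by simp
qed

lemma comp2_measurable [measurable]: "f \<in> borel_measurable circle \<Longrightarrow> comp2 f \<in> borel_measurable circle"
  unfolding comp2_def
  by (intro borel_measurable_divide borel_measurable_diff borel_measurable_times borel_measurable_vec_nth
      borel_measurable_of_real borel_measurable_sqrt borel_measurable_power borel_measurable_norm Rm) auto

lemma LR_iff: "f \<in> LR R \<longleftrightarrow> f \<in> borel_measurable circle \<and> (\<lambda>t. f t $ 1) \<in> L2 \<and> comp2 f \<in> L2"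
proof (cases "f \<in> borel_measurable circle")
  case True
  note [measurable] = True
  have eq: "AE t in circle. complex_of_real ((cmod (f t $ 1))\<^sup>2 + (cmod (comp2 f t))\<^sup>2) = LR_form R f f t"
    using R_lt_1
    by eventually_elim (simp only: LR_form_split of_real_add complex_norm_square mult.commute)
  have "integrable circle (LR_form R f f) \<longleftrightarrow>
      integrable circle (\<lambda>t. complex_of_real ((cmod (f t $ 1))\<^sup>2 + (cmod (comp2 f t))\<^sup>2))"
    by (rule integrable_cong_AE)
      (use eq in \<open>auto intro: circle_measurable_cong_AE[OF _ eq] elim: eventually_mono\<close>)
  also have "\<dots> \<longleftrightarrow> integrable circle (\<lambda>t. (cmod (f t $ 1))\<^sup>2 + (cmod (comp2 f t))\<^sup>2)"
    by (rule complex_of_real_integrable_eq)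
  also have "\<dots> \<longleftrightarrow> integrable circle (\<lambda>t. (cmod (f t $ 1))\<^sup>2) \<and> integrable circle (\<lambda>t. (cmod (comp2 f t))\<^sup>2)"
  proof (intro iffI conjI)
    assume *: "integrable circle (\<lambda>t. (cmod (f t $ 1))\<^sup>2 + (cmod (comp2 f t))\<^sup>2)"
    show "integrable circle (\<lambda>t. (cmod (f t $ 1))\<^sup>2)" "integrable circle (\<lambda>t. (cmod (comp2 f t))\<^sup>2)"
      by (rule Bochner_Integration.integrable_bound[OF *], auto)+
  qed auto
  finally show ?thesis using True by (auto simp: LR_def L2_def)
qed (simp add: LR_def)

lemma
  assumes "f \<in> LR R"
  shows LR_measurable: "f \<in> borel_measurable circle"
    and LR_nth1: "(\<lambda>t. f t $ 1) \<in> L2"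
    and LR_comp2: "comp2 f \<in> L2"
  using assms by (auto simp: LR_iff)

text \<open>The factorization treats the entries asymmetrically; the second one is recovered as sqrt
  (1 - |R|^2) \<open>comp2 f\<close> plus R times the first, with bounded coefficients.\<close>

lemma LR_nth2:
  assumes f: "f \<in> LR R"
  shows "(\<lambda>t. f t $ 2) \<in> L2"
proof -
  note [measurable] = LR_measurable[OF f]
  have "(\<lambda>t. of_real (sqrt (1 - (cmod (R t))\<^sup>2)) * comp2 f t) \<in> L2"
  proof (rule L2_mult_bounded[OF LR_comp2[OF f], where B=1])
    show "AE t in circle. cmod (of_real (sqrt (1 - (cmod (R t))\<^sup>2))) \<le> 1"
      using R_lt_1 by eventually_elim (simp add: abs_square_le_1 real_sqrt_le_1_iff less_imp_le)
  qed simp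
  moreover have "(\<lambda>t. R t * f t $ 1) \<in> L2"
    by (rule L2_mult_bounded[OF LR_nth1[OF f] Rm R_le_1])
  ultimately have *: "(\<lambda>t. of_real (sqrt (1 - (cmod (R t))\<^sup>2)) * comp2 f t + R t * f t $ 1) \<in> L2"
    by (rule L2_add)
  have "AE t in circle. of_real (sqrt (1 - (cmod (R t))\<^sup>2)) * comp2 f t + R t * f t $ 1 = f t $ 2"
    using R_lt_1
  proof eventually_elim
    case (elim t)
    then have "(cmod (R t))\<^sup>2 < 1" by (simp add: abs_square_less_1)
    then show ?case by (simp add: comp2_def)
  qed
  then show ?thesis by (rule L2_cong_AE[OF *]) simp
qed

lemma LR_inner_split:
  assumes f: "f \<in> LR R" and g: "g \<in> LR R"
  shows "LR_inner R f g = L2_inner (\<lambda>t. f t $ 1) (\<lambda>t. g t $ 1) + L2_inner (comp2 f) (comp2 g)"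
proof -
  have i: "integrable circle (\<lambda>t. cnj (g t $ 1) * f t $ 1)" "integrable circle (\<lambda>t. cnj (comp2 g t) * comp2 f t)"
    by (rule L2_mult_integrable[OF L2_cnj[OF LR_nth1[OF g]] LR_nth1[OF f]],
        rule L2_mult_integrable[OF L2_cnj[OF LR_comp2[OF g]] LR_comp2[OF f]])
  have eq: "AE t in circle. cnj (g t $ 1) * f t $ 1 + cnj (comp2 g t) * comp2 f t = LR_form R f g t"
    using R_lt_1 by eventually_elim (simp add: LR_form_split)
  have "LR_inner R f g = (\<integral>t. cnj (g t $ 1) * f t $ 1 + cnj (comp2 g t) * comp2 f t \<partial>circle)"
    unfolding LR_inner_def
    by (rule integral_cong_AE) (use i eq in \<open>auto intro: circle_measurable_cong_AE[OF _ eq] elim: eventually_mono\<close>)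
  then show ?thesis using i by (simp add: L2_inner_def)
qed

lemma comp2_add: "comp2 (f + g) = comp2 f + comp2 g"
  by (auto simp: comp2_def fun_eq_iff distrib_left add_divide_distrib diff_divide_distrib)

lemma comp2_diff: "comp2 (f - g) = comp2 f - comp2 g"
  by (auto simp: comp2_def fun_eq_iff right_diff_distrib diff_divide_distrib)

lemma comp2_mult: "comp2 (\<lambda>t. c t *s f t) = (\<lambda>t. c t * comp2 f t)"
  by (auto simp: comp2_def fun_eq_iff right_diff_distrib diff_divide_distrib mult.left_commute)

lemma vmult_in_LR:
  assumes f: "f \<in> LR R" and c: "c \<in> borel_measurable circle" and B: "AE t in circle. cmod (c t) \<le> B"
  shows "vmult c f \<in> LR R"
  unfolding LR_iff vmult_def
proof (intro conjI)
  note [measurable] = c LR_measurable[OF f]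
  show "(\<lambda>t. c t *s f t) \<in> borel_measurable circle"
    by (rule borel_measurable_vec2) simp_all
  show "(\<lambda>t. (c t *s f t) $ 1) \<in> L2"
    using L2_mult_bounded[OF LR_nth1[OF f] c B] by simp
  show "comp2 (\<lambda>t. c t *s f t) \<in> L2"
    unfolding comp2_mult by (rule L2_mult_bounded[OF LR_comp2[OF f] c B])
qed

end

sublocale LR_weight \<subseteq> semi_inner_space "LR R" "\<lambda>c f t. c *s f t" "LR_inner R"
proof
  show z: "(0 :: vfun) \<in> LR R"
  proof -
    have "comp2 (\<lambda>t. 0) = (\<lambda>t. 0)" by (simp add: comp2_def fun_eq_iff)
    then show ?thesis by (simp add: LR_iff zero_fun_def)
  qed
  fix f g h :: vfun and c
  show "(\<lambda>t. (-1) *s f t) = - f" "(\<lambda>t. c *s (f - g) t) = (\<lambda>t. c *s f t) - (\<lambda>t. c *s g t)"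
    by (simp_all add: fun_eq_iff vec_eq_iff right_diff_distrib)
  assume f: "f \<in> LR R"
  show cf: "(\<lambda>t. c *s f t) \<in> LR R"
    using vmult_in_LR[OF f, of "\<lambda>_. c" "cmod c"] by (simp add: vmult_def)
  show "0 \<le> Re (LR_inner R f f)"
    using L2.ip_nonneg[OF LR_nth1[OF f]] L2.ip_nonneg[OF LR_comp2[OF f]] by (simp add: LR_inner_split[OF f f])
  assume g: "g \<in> LR R"
  show fg: "f + g \<in> LR R"
    unfolding LR_iff comp2_add
    using L2.add_in[OF LR_nth1[OF f] LR_nth1[OF g]] L2.add_in[OF LR_comp2[OF f] LR_comp2[OF g]]
      borel_measurable_add[OF LR_measurable[OF f] LR_measurable[OF g]]
    by (simp add: plus_fun_def)
  show "LR_inner R (\<lambda>t. c *s f t) g = c * LR_inner R f g"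
    using L2.ip_sc_left[OF LR_nth1[OF f] LR_nth1[OF g], of c] L2.ip_sc_left[OF LR_comp2[OF f] LR_comp2[OF g], of c]
    by (simp add: LR_inner_split[OF f g] LR_inner_split[OF cf g] comp2_mult distrib_left)
  show "LR_inner R g f = cnj (LR_inner R f g)"
    using L2.ip_cnj[OF LR_nth1[OF f] LR_nth1[OF g]] L2.ip_cnj[OF LR_comp2[OF f] LR_comp2[OF g]]
    by (simp add: LR_inner_split[OF f g] LR_inner_split[OF g f])
  assume h: "h \<in> LR R"
  show "LR_inner R (f + g) h = LR_inner R f h + LR_inner R g h"
    using L2.ip_add_left[OF LR_nth1[OF f] LR_nth1[OF g] LR_nth1[OF h]]
      L2.ip_add_left[OF LR_comp2[OF f] LR_comp2[OF g] LR_comp2[OF h]]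
    by (simp add: LR_inner_split[OF f h] LR_inner_split[OF g h] LR_inner_split[OF fg h] comp2_add)
      (simp add: plus_fun_def)
qed

context LR_weight
begin

lemma LR_norm_eq: "LR_norm R f = nrm f"
  by (simp add: LR_norm_def nrm_def)

lemma nrm_sq_split: "f \<in> LR R \<Longrightarrow> (nrm f)\<^sup>2 = (L2.nrm (\<lambda>t. f t $ 1))\<^sup>2 + (L2.nrm (comp2 f))\<^sup>2"
  by (simp add: nrm_sq LR_inner_split L2.nrm_sq LR_nth1 LR_comp2)

end

lemma L2_nrm_eq_0: "f \<in> L2 \<Longrightarrow> L2.nrm f = 0 \<longleftrightarrow> (AE t in circle. f t = 0)"
  using L2_nrm_sq[of f] integral_nonneg_eq_0_iff_AE[OF L2_integrable_sq, of f] zero_eq_power2[of "L2.nrm f"]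
  by simp

sublocale LR_weight \<subseteq> semi_hilbert "LR R" "\<lambda>c f t. c *s f t" "LR_inner R"
proof
  fix X :: "nat \<Rightarrow> vfun"
  assume X: "\<And>n. X n \<in> LR R" and cau: "\<And>e. e > 0 \<Longrightarrow> \<exists>N. \<forall>m\<ge>N. \<forall>n\<ge>N. nrm (X m - X n) < e"
  have sp: "(nrm (X m - f))\<^sup>2 = (L2.nrm ((\<lambda>t. X m t $ 1) - (\<lambda>t. f t $ 1)))\<^sup>2 + (L2.nrm (comp2 (X m) - comp2 f))\<^sup>2"
    if "f \<in> LR R" for m f
  proof -
    have "(\<lambda>t. (X m - f) t $ 1) = (\<lambda>t. X m t $ 1) - (\<lambda>t. f t $ 1)" by (auto simp: fun_eq_iff)
    then show ?thesis using nrm_sq_split[OF diff_in[OF X that], of m] by (simp only: comp2_diff)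
  qed
  have le: "L2.nrm ((\<lambda>t. X m t $ 1) - (\<lambda>t. X n t $ 1)) \<le> nrm (X m - X n)"
    "L2.nrm (comp2 (X m) - comp2 (X n)) \<le> nrm (X m - X n)" for m n
    by (rule power2_le_imp_le; use sp[OF X] X in simp)+
  have "\<exists>N. \<forall>m\<ge>N. \<forall>n\<ge>N. L2.nrm ((\<lambda>t. X m t $ 1) - (\<lambda>t. X n t $ 1)) < e"
    "\<exists>N. \<forall>m\<ge>N. \<forall>n\<ge>N. L2.nrm (comp2 (X m) - comp2 (X n)) < e" if "e > 0" for e
    using cau[OF that] le le_less_trans by blast+
  then obtain p q where p: "p \<in> L2" "(\<lambda>n. L2.nrm ((\<lambda>t. X n t $ 1) - p)) \<longlonglongrightarrow> 0"
    and q: "q \<in> L2" "(\<lambda>n. L2.nrm (comp2 (X n) - q)) \<longlonglongrightarrow> 0"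
    using L2.complete[of "\<lambda>n t. X n t $ 1"] L2.complete[of "\<lambda>n. comp2 (X n)"] LR_nth1[OF X] LR_comp2[OF X] by metis
  \<comment> \<open>The inverse of the isometry onto pairs: the first entry is p, and the second is
    chosen so that \<open>comp2 f\<close> equals q almost everywhere.\<close>
  define f :: vfun where "f = (\<lambda>t. vector [p t, R t * p t + of_real (sqrt (1 - (cmod (R t))\<^sup>2)) * q t])"
  note [measurable] = L2_measurable[OF p(1)] L2_measurable[OF q(1)]
  have fm [measurable]: "f \<in> borel_measurable circle"
    by (rule borel_measurable_vec2) (simp_all add: f_def)
  have f1: "(\<lambda>t. f t $ 1) = p" by (simp add: f_def fun_eq_iff)
  have f2: "AE t in circle. q t = comp2 f t"
    using R_lt_1
  proof eventually_elim
    case (elim t)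
    then have "(cmod (R t))\<^sup>2 < 1" by (simp add: abs_square_less_1)
    then show ?case by (simp add: comp2_def f_def)
  qed
  have c2: "comp2 f \<in> L2" by (rule L2_cong_AE[OF q(1) f2]) simp
  have fL: "f \<in> LR R" using fm p(1) c2 by (simp add: LR_iff f1)
  have "L2.nrm (q - comp2 f) = 0"
    using f2 by (subst L2_nrm_eq_0[OF L2.diff_in[OF q(1) c2]]) auto
  then have "L2.nrm (comp2 (X n) - comp2 f) \<le> L2.nrm (comp2 (X n) - q)" for n
    using L2.nrm_triangle_diff[OF LR_comp2[OF X] q(1) c2, of n] by simp
  then have "(nrm (X n - f))\<^sup>2 \<le> (L2.nrm ((\<lambda>t. X n t $ 1) - p))\<^sup>2 + (L2.nrm (comp2 (X n) - q))\<^sup>2" for n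
    unfolding sp[OF fL] f1 using c2 LR_comp2[OF X] by (intro add_left_mono power_mono) auto
  then have "nrm (X n - f) \<le> sqrt ((L2.nrm ((\<lambda>t. X n t $ 1) - p))\<^sup>2 + (L2.nrm (comp2 (X n) - q))\<^sup>2)" for n
    by (rule real_le_rsqrt)
  moreover have "(\<lambda>n. sqrt ((L2.nrm ((\<lambda>t. X n t $ 1) - p))\<^sup>2 + (L2.nrm (comp2 (X n) - q))\<^sup>2)) \<longlonglongrightarrow> sqrt (0\<^sup>2 + 0\<^sup>2)"
    by (intro tendsto_intros p q)
  ultimately have "(\<lambda>n. nrm (X n - f)) \<longlonglongrightarrow> 0"
    by (intro Lim_null_comparison[of "\<lambda>n. nrm (X n - f)"]) (use X fL in auto)
  then show "\<exists>x\<in>LR R. (\<lambda>n. nrm (X n - x)) \<longlonglongrightarrow> 0" using fL by blast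
qed

context LR_weight
begin

lemma nrm_eq_0_iff: "f \<in> LR R \<Longrightarrow> nrm f = 0 \<longleftrightarrow> (AE t in circle. f t = 0)"
proof -
  assume f: "f \<in> LR R"
  have "nrm f = 0 \<longleftrightarrow> (nrm f)\<^sup>2 = 0" by simp
  also have "\<dots> \<longleftrightarrow> L2.nrm (\<lambda>t. f t $ 1) = 0 \<and> L2.nrm (comp2 f) = 0"
    unfolding nrm_sq_split[OF f] by (simp add: add_nonneg_eq_0_iff)
  also have "\<dots> \<longleftrightarrow> (AE t in circle. f t $ 1 = 0) \<and> (AE t in circle. comp2 f t = 0)"
    using f by (simp add: L2_nrm_eq_0 LR_nth1 LR_comp2)
  also have "\<dots> \<longleftrightarrow> (AE t in circle. f t = 0)"
  proof (intro iffI; (elim conjE)?)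
    assume "AE t in circle. f t $ 1 = 0" "AE t in circle. comp2 f t = 0"
    then show "AE t in circle. f t = 0"
      using R_lt_1
    proof eventually_elim
      case (elim t)
      from elim(3) have "(cmod (R t))\<^sup>2 < 1" by (simp add: abs_square_less_1)
      with elim show ?case by (simp add: comp2_def vec_eq_iff forall_2)
    qed
  next
    assume "AE t in circle. f t = 0"
    then show "(AE t in circle. f t $ 1 = 0) \<and> (AE t in circle. comp2 f t = 0)"
      by (auto simp: comp2_def elim!: eventually_mono)
  qed
  finally show ?thesis .
qed

lemma nrm_diff_eq_0_iff: "f \<in> LR R \<Longrightarrow> g \<in> LR R \<Longrightarrow> nrm (f - g) = 0 \<longleftrightarrow> (AE t in circle. f t = g t)"
  by (simp add: nrm_eq_0_iff)

lemma LR_cong_AE: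
  assumes f: "f \<in> LR R" and eq: "AE t in circle. f t = g t"
  shows "g \<in> LR R"
proof -
  have m [measurable]: "g \<in> borel_measurable circle"
    by (rule circle_measurable_cong_AE[OF LR_measurable[OF f] eq])
  have "(\<lambda>t. g t $ 1) \<in> L2"
    by (rule L2_cong_AE[OF LR_nth1[OF f]]) (use eq in \<open>auto elim: eventually_mono\<close>)
  moreover have "comp2 g \<in> L2"
    by (rule L2_cong_AE[OF LR_comp2[OF f]]) (use eq in \<open>auto simp: comp2_def elim: eventually_mono\<close>)
  ultimately show ?thesis using m by (simp add: LR_iff)
qed

lemma LR_inner_vmult:
  assumes f: "f \<in> LR R" and g: "g \<in> LR R" and c: "c \<in> borel_measurable circle" and B: "AE t in circle. cmod (c t) \<le> B"
  shows "LR_inner R (vmult c f) g = LR_inner R f (vmult (\<lambda>t. cnj (c t)) g)"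
proof -
  have c': "(\<lambda>t. cnj (c t)) \<in> borel_measurable circle" "AE t in circle. cmod (cnj (c t)) \<le> B" using c B by auto
  show ?thesis
    unfolding LR_inner_split[OF vmult_in_LR[OF f c B] g] LR_inner_split[OF f vmult_in_LR[OF g c']]
    by (simp add: vmult_def comp2_mult L2_inner_def mult_ac)
qed

end

section \<open>Powers of t on the circle and their action on the Hardy spaces\<close>

lemma cnj_eq_inverse: "norm t = 1 \<Longrightarrow> cnj t = inverse t"
  using inverse_unique[of t "cnj t"] by (auto simp: complex_norm_square[symmetric])

lemma cnj_powi: "norm t = 1 \<Longrightarrow> cnj (t powi j) = t powi (- j)"
  by (simp add: cnj_eq_inverse power_int_minus power_int_inverse)

lemma cnj_powi': "norm t = 1 \<Longrightarrow> cnj t powi j = t powi (- j)"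
  by (simp add: cnj_eq_inverse power_int_minus power_int_inverse)

lemma powi_mult_powi: "norm t = 1 \<Longrightarrow> t powi i * t powi j = t powi (i + j)" for t :: complex
  by (subst power_int_add) auto

lemma powi_mult_powi_left: "norm t = 1 \<Longrightarrow> t powi i * (t powi j * z) = t powi (i + j) * z" for t :: complex
  by (simp add: mult.assoc[symmetric] powi_mult_powi)

lemma mult_powi: "norm t = 1 \<Longrightarrow> t * t powi j = t powi (1 + j)" for t :: complex
  using powi_mult_powi[of t 1 j] by simp

lemma borel_measurable_powi: "(\<lambda>t. t powi j) \<in> borel_measurable circle"
  by (intro borel_measurable_circle_sphere continuous_intros) auto

lemma norm_powi_circle: "AE t in circle. cmod (t powi j) \<le> 1"
  by (intro AE_I2) (simp add: norm_power_int)

lemma L2_powi: "f \<in> L2 \<Longrightarrow> (\<lambda>t. t powi j * f t) \<in> L2"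
  by (rule L2_mult_bounded[OF _ borel_measurable_powi norm_powi_circle])

lemma L2_powi_fun [simp]: "(\<lambda>t. t powi j) \<in> L2"
  using L2_powi[OF L2_const[of 1]] by simp

lemma H2_minus_mult_cnj_t:
  assumes f: "f \<in> H2_minus"
  shows "(\<lambda>t. t powi (-1) * f t) \<in> H2_minus"
  unfolding H2_minus_def
proof (intro CollectI conjI ballI)
  show "(\<lambda>t. t powi (-1) * f t) \<in> L2" by (rule L2_powi[OF H2_minus_L2[OF f]])
  fix g assume g: "g \<in> H2_plus"
  have "L2_inner (\<lambda>t. t powi (-1) * f t) g = L2_inner f (\<lambda>t. t * g t)"
    unfolding L2_inner_def
    by (intro Bochner_Integration.integral_cong refl) (simp add: cnj_eq_inverse power_int_minus mult_ac)
  then show "L2_inner (\<lambda>t. t powi (-1) * f t) g = 0"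
    using f H2_plus_mult_t[OF g] by (simp add: H2_minus_def)
qed

text \<open>Multiplication by t leads out of \<open>H2_minus\<close> only in the direction of the
  constants, which zero mean excludes: a test function g is its mean plus t g', with g' again in
  \<open>H2_plus\<close>.\<close>

lemma H2_minus_mult_tI:
  assumes u: "u \<in> L2" and m: "(\<lambda>t. t powi (-1) * u t) \<in> H2_minus" and z: "(\<integral>t. u t \<partial>circle) = 0"
  shows "u \<in> H2_minus"
  unfolding H2_minus_def
proof (intro CollectI conjI ballI u)
  fix g assume g: "g \<in> H2_plus"
  define c where "c = (\<integral>t. g t \<partial>circle)"
  define g' where "g' = (\<lambda>t. t powi (-1) * (g t - c))"
  have gc: "(\<lambda>t. g t - c) \<in> H2_plus" using H2_plus_add[OF g H2_plus_const[of "-c"]] by simp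
  have g'L: "g' \<in> L2" unfolding g'_def by (rule L2_powi[OF H2_plus_L2[OF gc]])
  have "(\<integral>t. g' t * t ^ j \<partial>circle) = 0" if "j \<ge> 1" for j
  proof -
    have "(\<integral>t. g' t * t ^ j \<partial>circle) = (\<integral>t. (g t - c) * t ^ (j - 1) \<partial>circle)"
    proof (intro Bochner_Integration.integral_cong refl)
      fix t assume "t \<in> space circle"
      then have "t \<noteq> 0" by auto
      moreover have "t ^ j = t * t ^ (j - 1)" using that by (cases j) auto
      ultimately show "g' t * t ^ j = (g t - c) * t ^ (j - 1)" by (simp add: g'_def power_int_minus)
    qed
    also have "\<dots> = 0"
    proof (cases "j = 1")
      case True
      then show ?thesis using L2_integrable[OF H2_plus_L2[OF g]] by (simp add: c_def)
    next
      case False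
      then show ?thesis using H2_plus_moment[OF gc, of "j - 1"] that by simp
    qed
    finally show ?thesis .
  qed
  then have g'H: "g' \<in> H2_plus" using g'L by (simp add: H2_plus_iff)
  have i1: "integrable circle (\<lambda>t. cnj c * u t)" using L2_integrable[OF u] by simp
  have i2: "integrable circle (\<lambda>t. cnj (g' t) * (t powi (-1) * u t))"
    by (rule L2_mult_integrable[OF L2_cnj[OF g'L] L2_powi[OF u]])
  have "L2_inner u g = (\<integral>t. cnj c * u t + cnj (g' t) * (t powi (-1) * u t) \<partial>circle)"
    unfolding L2_inner_def
  proof (intro Bochner_Integration.integral_cong refl)
    fix t assume "t \<in> space circle"
    then have t: "norm t = 1" "t \<noteq> 0" by auto
    show "cnj (g t) * u t = cnj c * u t + cnj (g' t) * (t powi (-1) * u t)"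
    proof -
      have ti: "t * (inverse t * z) = z" for z using t by simp
      show ?thesis using t by (simp add: g'_def power_int_minus cnj_eq_inverse algebra_simps ti)
    qed
  qed
  also have "\<dots> = cnj c * (\<integral>t. u t \<partial>circle) + L2_inner (\<lambda>t. t powi (-1) * u t) g'"
    using i1 i2 by (simp add: L2_inner_def)
  finally show "L2_inner u g = 0" using z m g'H by (simp add: H2_minus_def)
qed

context semi_hilbert
begin

text \<open>A closed subspace is its own double orthogonal complement. Membership in the closures
  \<open>Hc\<close> can thus be checked by orthogonality, without approximating sequences.\<close>

lemma closed_subspace_memI:
  assumes W: "closed_subspace W" and f: "f \<in> V"
    and perp: "\<And>g. g \<in> V \<Longrightarrow> (\<And>w. w \<in> W \<Longrightarrow> ip g w = 0) \<Longrightarrow> ip g f = 0"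
  shows "f \<in> W"
proof -
  obtain p where p: "p \<in> W" "\<And>g. g \<in> W \<Longrightarrow> ip (f - p) g = 0"
    using projection_exists[OF W f] by blast
  have pV: "p \<in> V" using csub_V[OF W p(1)] .
  have "ip (f - p) f = 0" by (rule perp) (use p pV f in auto)
  then have "ip (f - p) (f - p) = 0" using p f pV by (simp add: ip_diff_right)
  then have "nrm (f - p) = 0" by (simp add: nrm_def)
  then show ?thesis using csub_null[OF W p(1) f] by simp
qed

lemma projE:
  assumes W: "closed_subspace W" and f: "f \<in> V"
  obtains p where "p \<in> W" "\<And>g. g \<in> W \<Longrightarrow> ip (f - p) g = 0"
  using projection_exists[OF W f] by blast

end

context LR_weight
begin

lemma inner_AE_left:
  assumes f: "f \<in> LR R" and eq: "AE t in circle. f t = f' t" and g: "g \<in> LR R"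
  shows "LR_inner R f g = LR_inner R f' g"
proof (rule ip_cong_left)
  show f': "f' \<in> LR R" by (rule LR_cong_AE[OF f eq])
  show "nrm (f - f') = 0" unfolding nrm_diff_eq_0_iff[OF f f'] by (rule eq)
qed (use f g in auto)

lemma inner_AE_right:
  assumes f: "f \<in> LR R" and eq: "AE t in circle. f t = f' t" and g: "g \<in> LR R"
  shows "LR_inner R g f = LR_inner R g f'"
proof (rule ip_cong_right)
  show f': "f' \<in> LR R" by (rule LR_cong_AE[OF f eq])
  show "nrm (f - f') = 0" unfolding nrm_diff_eq_0_iff[OF f f'] by (rule eq)
qed (use f g in auto)

subsection \<open>Shifts and the conjugation symmetry\<close>

definition shift :: "int \<Rightarrow> vfun \<Rightarrow> vfun" where
  "shift j = vmult (\<lambda>t. t powi j)"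

lemma shift_in [simp]: "f \<in> LR R \<Longrightarrow> shift j f \<in> LR R"
  unfolding shift_def by (rule vmult_in_LR[OF _ borel_measurable_powi norm_powi_circle])

lemma shift_nth [simp]: "shift j f t $ i = t powi j * f t $ i"
  by (simp add: shift_def vmult_def)

lemma shift_shift_AE: "AE t in circle. shift i (shift j f) t = shift (i + j) f t"
  by (intro AE_I2) (simp add: vec_eq_iff powi_mult_powi_left)

lemma shift_0 [simp]: "shift 0 f = f"
  by (simp add: fun_eq_iff vec_eq_iff)

lemma shift_add: "shift j (f + g) = shift j f + shift j g"
  and shift_diff: "shift j (f - g) = shift j f - shift j g"
  and shift_scale: "shift j (\<lambda>t. c *s f t) = (\<lambda>t. c *s shift j f t)"
  by (simp_all add: fun_eq_iff vec_eq_iff algebra_simps)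

lemma inner_shift_left:
  assumes f: "f \<in> LR R" and g: "g \<in> LR R"
  shows "LR_inner R (shift j f) g = LR_inner R f (shift (- j) g)"
proof -
  have c: "(\<lambda>t. cnj (t powi j)) \<in> borel_measurable circle" "AE t in circle. cmod (cnj (t powi j)) \<le> 1"
    by (rule borel_measurable_cnj[OF borel_measurable_powi]) (auto intro!: AE_I2 simp: norm_power_int)
  have "LR_inner R (shift j f) g = LR_inner R f (vmult (\<lambda>t. cnj (t powi j)) g)"
    unfolding shift_def by (rule LR_inner_vmult[OF f g borel_measurable_powi norm_powi_circle])
  also have "\<dots> = LR_inner R f (shift (- j) g)"
    by (rule inner_AE_right[OF vmult_in_LR[OF g c] _ f])
      (intro AE_I2, simp add: vec_eq_iff vmult_def shift_def cnj_powi del: complex_cnj_power_int)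
  finally show ?thesis .
qed

lemma inner_shift_shift:
  assumes f: "f \<in> LR R" and g: "g \<in> LR R"
  shows "LR_inner R (shift j f) (shift j g) = LR_inner R f g"
proof -
  have "LR_inner R (shift j f) (shift j g) = LR_inner R f (shift (- j) (shift j g))"
    using f g by (simp add: inner_shift_left)
  also have "\<dots> = LR_inner R f (shift (- j + j) g)"
    by (rule inner_AE_right[OF _ shift_shift_AE f]) (use g in simp)
  finally show ?thesis by simp
qed

lemma nrm_shift: "f \<in> LR R \<Longrightarrow> nrm (shift j f) = nrm f"
  by (simp add: nrm_def inner_shift_shift)

text \<open>An antiunitary involution: the weight has equal diagonal entries and conjugate
  off-diagonal ones, so exchanging the entries and conjugating preserves it. Inner products come out
  with their arguments exchanged.\<close>

definition cflip :: "vfun \<Rightarrow> vfun" where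
  "cflip f = (\<lambda>t. vector [cnj (f t $ 2), cnj (f t $ 1)])"

lemma cflip_nth [simp]: "cflip f t $ 1 = cnj (f t $ 2)" "cflip f t $ 2 = cnj (f t $ 1)"
  by (simp_all add: cflip_def)

lemma cflip_cflip [simp]: "cflip (cflip f) = f"
  by (simp add: fun_eq_iff vec_eq_iff forall_2)

lemma LR_form_cflip: "cmod (R t) < 1 \<Longrightarrow> LR_form R (cflip f) (cflip g) t = LR_form R g f t"
  by (simp add: LR_form_eq[of R t] algebra_simps)

lemma LR_form_measurable:
  assumes "f \<in> borel_measurable circle" "g \<in> borel_measurable circle"
  shows "LR_form R f g \<in> borel_measurable circle"
proof (rule circle_measurable_cong_AE)
  show "AE t in circle. cnj (g t $ 1) * f t $ 1 + cnj (comp2 g t) * comp2 f t = LR_form R f g t"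
    using R_lt_1 by eventually_elim (simp add: LR_form_split)
  show "(\<lambda>t. cnj (g t $ 1) * f t $ 1 + cnj (comp2 g t) * comp2 f t) \<in> borel_measurable circle"
    by (intro borel_measurable_add borel_measurable_times borel_measurable_cnj borel_measurable_vec_nth
        comp2_measurable assms)
qed

lemma cflip_measurable: "f \<in> borel_measurable circle \<Longrightarrow> cflip f \<in> borel_measurable circle"
  by (rule borel_measurable_vec2) (simp_all add: borel_measurable_cnj borel_measurable_vec_nth)

lemma cflip_in [simp]:
  assumes f: "f \<in> LR R"
  shows "cflip f \<in> LR R"
  unfolding LR_def
proof (intro CollectI conjI cflip_measurable LR_measurable[OF f])
  show "integrable circle (LR_form R (cflip f) (cflip f))"
  proof (rule integrable_cong_AE_imp)
    show "integrable circle (LR_form R f f)" using f by (simp add: LR_def)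
    show "LR_form R (cflip f) (cflip f) \<in> borel_measurable circle"
      by (intro LR_form_measurable cflip_measurable LR_measurable[OF f])
    show "AE t in circle. LR_form R f f t = LR_form R (cflip f) (cflip f) t"
      using R_lt_1 by eventually_elim (simp add: LR_form_cflip)
  qed
qed

lemma inner_cflip_cflip:
  assumes f: "f \<in> LR R" and g: "g \<in> LR R"
  shows "LR_inner R (cflip f) (cflip g) = LR_inner R g f"
  unfolding LR_inner_def
proof (rule integral_cong_AE)
  show "AE t in circle. LR_form R (cflip f) (cflip g) t = LR_form R g f t"
    using R_lt_1 by eventually_elim (simp add: LR_form_cflip)
qed (use f g in \<open>auto intro!: LR_form_measurable LR_measurable\<close>)

subsection \<open>The subspaces\<close>

definition wvec :: "(complex \<Rightarrow> complex) \<Rightarrow> (complex \<Rightarrow> complex) \<Rightarrow> vfun" where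
  "wvec u v = (\<lambda>t. weight R t *v vector [u t, v t])"

lemma wvec_nth [simp]: "wvec u v t $ 1 = u t + cnj (R t) * v t" "wvec u v t $ 2 = R t * u t + v t"
  by (simp_all add: wvec_def weight_mult_vector)

lemma comp2_wvec:
  "AE t in circle. of_real (sqrt (1 - (cmod (R t))\<^sup>2)) * v t = comp2 (wvec u v) t"
  using R_lt_1
proof eventually_elim
  case (elim t)
  define s where "s = complex_of_real (sqrt (1 - (cmod (R t))\<^sup>2))"
  have p: "(cmod (R t))\<^sup>2 < 1" using elim by (simp add: abs_square_less_1)
  have "s * s = of_real (1 - (cmod (R t))\<^sup>2)"
    unfolding s_def of_real_mult[symmetric] using p by simp
  then have ss: "s * s = 1 - R t * cnj (R t)" by (simp only: of_real_diff complex_norm_square of_real_1)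
  have "s \<noteq> 0" using p by (simp add: s_def)
  moreover have "R t * u t + v t - R t * (u t + cnj (R t) * v t) = s * s * v t"
    unfolding ss by (simp add: algebra_simps)
  ultimately show ?case by (simp add: comp2_def s_def[symmetric])
qed

lemma wvec_in [simp]:
  assumes u: "u \<in> L2" and v: "v \<in> L2"
  shows "wvec u v \<in> LR R"
  unfolding LR_iff
proof (intro conjI)
  note m = Rm L2_measurable[OF u] L2_measurable[OF v]
  show M: "wvec u v \<in> borel_measurable circle"
    by (rule borel_measurable_vec2)
      (simp_all, (intro borel_measurable_add borel_measurable_times borel_measurable_cnj m)+)
  have "(\<lambda>t. cnj (R t) * v t) \<in> L2"
    by (rule L2_mult_bounded[OF v, where B=1]) (use R_le_1 Rm in \<open>auto intro: borel_measurable_cnj\<close>)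
  then show "(\<lambda>t. wvec u v t $ 1) \<in> L2" using L2_add[OF u] by simp
  have "(\<lambda>t. of_real (sqrt (1 - (cmod (R t))\<^sup>2)) * v t) \<in> L2"
  proof (rule L2_mult_bounded[OF v, where B=1])
    show "AE t in circle. cmod (of_real (sqrt (1 - (cmod (R t))\<^sup>2))) \<le> 1"
      using R_lt_1 by eventually_elim (simp add: abs_square_le_1 real_sqrt_le_1_iff less_imp_le)
  qed simp
  then show "comp2 (wvec u v) \<in> L2"
    by (rule L2_cong_AE[OF _ comp2_wvec comp2_measurable[OF M]])
qed

text \<open>The weight cancels against its inverse in the inner product, leaving an unweighted
  pairing of the components.\<close>

lemma inner_wvec:
  assumes f: "f \<in> LR R" and u: "u \<in> L2" and v: "v \<in> L2"
  shows "LR_inner R f (wvec u v) = L2_inner (\<lambda>t. f t $ 1) u + L2_inner (\<lambda>t. f t $ 2) v"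
proof -
  note w = wvec_in[OF u v]
  have i: "integrable circle (\<lambda>t. cnj (u t) * f t $ 1)" "integrable circle (\<lambda>t. cnj (v t) * f t $ 2)"
    using L2_mult_integrable[OF L2_cnj[OF u] LR_nth1[OF f]] L2_mult_integrable[OF L2_cnj[OF v] LR_nth2[OF f]] by auto
  have j: "integrable circle (\<lambda>t. cnj (wvec u v t $ 1) * f t $ 1)" "integrable circle (\<lambda>t. cnj (comp2 (wvec u v) t) * comp2 f t)"
    using L2_mult_integrable[OF L2_cnj[OF LR_nth1[OF w]] LR_nth1[OF f]]
      L2_mult_integrable[OF L2_cnj[OF LR_comp2[OF w]] LR_comp2[OF f]] by auto
  have "LR_inner R f (wvec u v) =
      (\<integral>t. cnj (wvec u v t $ 1) * f t $ 1 + cnj (comp2 (wvec u v) t) * comp2 f t \<partial>circle)"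
    unfolding LR_inner_split[OF f w] L2_inner_def by (rule Bochner_Integration.integral_add[OF j, symmetric])
  also have "\<dots> = (\<integral>t. cnj (u t) * f t $ 1 + cnj (v t) * f t $ 2 \<partial>circle)"
  proof (rule integral_cong_AE)
    show "AE t in circle. cnj (wvec u v t $ 1) * f t $ 1 + cnj (comp2 (wvec u v) t) * comp2 f t =
        cnj (u t) * f t $ 1 + cnj (v t) * f t $ 2"
      using comp2_wvec[of v u] R_lt_1
    proof eventually_elim
      case (elim t)
      define s where "s = complex_of_real (sqrt (1 - (cmod (R t))\<^sup>2))"
      have "(cmod (R t))\<^sup>2 < 1" using elim(2) by (simp add: abs_square_less_1)
      then have "s \<noteq> 0" by (simp add: s_def)
      then have sf: "s * comp2 f t = f t $ 2 - R t * f t $ 1" by (simp add: comp2_def s_def)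
      have "cnj (comp2 (wvec u v) t) * comp2 f t = cnj (v t) * (s * comp2 f t)"
        unfolding elim(1)[symmetric] by (simp add: s_def mult_ac)
      then show ?case unfolding sf by (simp add: algebra_simps)
    qed
  qed (use i j in auto)
  also have "\<dots> = L2_inner (\<lambda>t. f t $ 1) u + L2_inner (\<lambda>t. f t $ 2) v"
    unfolding L2_inner_def by (rule Bochner_Integration.integral_add[OF i])
  finally show ?thesis .
qed

definition gen :: "int \<Rightarrow> int \<Rightarrow> vfun set" where
  "gen n m = {wvec (\<lambda>t. t powi n * hp t) (\<lambda>t. cnj t powi m * hm t) | hp hm. hp \<in> H2_plus \<and> hm \<in> H2_minus}"

lemma Hc_eq: "Hc R n m = {f \<in> LR R. \<forall>e>0. \<exists>g\<in>gen n m. nrm (f - g) < e}"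
  by (simp add: Hc_def LR_closure_def gen_def wvec_def LR_norm_eq fun_diff_def)

lemma L2_cnj_powi: "f \<in> L2 \<Longrightarrow> (\<lambda>t. cnj t powi j * f t) \<in> L2"
proof (rule L2_mult_bounded[where B=1])
  show "(\<lambda>t. cnj t powi j) \<in> borel_measurable circle"
    by (intro borel_measurable_circle_sphere continuous_intros) auto
qed (auto intro!: AE_I2 simp: norm_power_int)

lemma powi_H2_L2:
  "hp \<in> H2_plus \<Longrightarrow> (\<lambda>t. t powi n * hp t) \<in> L2" "hm \<in> H2_minus \<Longrightarrow> (\<lambda>t. cnj t powi m * hm t) \<in> L2"
  by (auto intro: L2_powi[OF H2_plus_L2] L2_cnj_powi[OF H2_minus_L2])

lemma gen_LR: "gen n m \<subseteq> LR R"
  unfolding gen_def by (auto intro!: wvec_in powi_H2_L2)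

lemma Hc_csub: "closed_subspace (Hc R n m)"
  unfolding Hc_eq
proof (rule closed_subspace_closure[OF gen_LR])
  have "wvec (\<lambda>t. t powi n * 0) (\<lambda>t. cnj t powi m * 0) \<in> gen n m"
    unfolding gen_def
    by (intro CollectI exI[of _ "\<lambda>t. 0"] conjI refl H2_plus_const H2_minus_zero)
  moreover have "wvec (\<lambda>t. t powi n * 0) (\<lambda>t. cnj t powi m * 0) = 0"
    by (simp add: fun_eq_iff vec_eq_iff forall_2)
  ultimately show "0 \<in> gen n m" by simp
  fix x y assume "x \<in> gen n m" "y \<in> gen n m"
  then obtain a b c d where x: "x = wvec (\<lambda>t. t powi n * a t) (\<lambda>t. cnj t powi m * b t)" "a \<in> H2_plus" "b \<in> H2_minus"
    and y: "y = wvec (\<lambda>t. t powi n * c t) (\<lambda>t. cnj t powi m * d t)" "c \<in> H2_plus" "d \<in> H2_minus"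
    unfolding gen_def by blast
  have "x + y = wvec (\<lambda>t. t powi n * (a t + c t)) (\<lambda>t. cnj t powi m * (b t + d t))"
    by (simp add: x y fun_eq_iff vec_eq_iff forall_2 algebra_simps)
  then show "x + y \<in> gen n m"
    unfolding gen_def using H2_plus_add[OF x(2) y(2)] H2_minus_add[OF x(3) y(3)]
    by (intro CollectI exI[of _ "\<lambda>t. a t + c t"] exI[of _ "\<lambda>t. b t + d t"]) simp
next
  fix c x assume "x \<in> gen n m"
  then obtain a b where x: "x = wvec (\<lambda>t. t powi n * a t) (\<lambda>t. cnj t powi m * b t)" "a \<in> H2_plus" "b \<in> H2_minus"
    unfolding gen_def by blast
  have "(\<lambda>t. c *s x t) = wvec (\<lambda>t. t powi n * (c * a t)) (\<lambda>t. cnj t powi m * (c * b t))"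
    by (simp add: x fun_eq_iff vec_eq_iff forall_2 algebra_simps)
  then show "(\<lambda>t. c *s x t) \<in> gen n m"
    unfolding gen_def using H2_plus_scale[OF x(2), of c] H2_minus_scale[OF x(3), of c]
    by (intro CollectI exI[of _ "\<lambda>t. c * a t"] exI[of _ "\<lambda>t. c * b t"]) simp
qed

lemma Hc_LR: "f \<in> Hc R n m \<Longrightarrow> f \<in> LR R"
  by (simp add: Hc_eq)

lemma gen_Hc: "g \<in> gen n m \<Longrightarrow> g \<in> Hc R n m"
  using gen_LR by (auto simp: Hc_eq intro!: bexI[of _ g])

text \<open>Pairing with a generator is unweighted, so orthogonality splits into one condition on
  each component. For the second, orthogonality to \<open>H2_minus\<close> is tested on cnj t^j with
  j >= 1 and gives vanishing moments. Orthogonality to the generators passes to their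
  closure.\<close>

lemma Hc_perp_iff:
  assumes f: "f \<in> LR R"
  shows "(\<forall>g\<in>Hc R n m. LR_inner R f g = 0) \<longleftrightarrow>
    (\<lambda>t. t powi (- n) * f t $ 1) \<in> H2_minus \<and> (\<lambda>t. t powi m * f t $ 2) \<in> H2_plus"
proof -
  have i1: "L2_inner (\<lambda>t. f t $ 1) (\<lambda>t. t powi n * h t) = L2_inner (\<lambda>t. t powi (- n) * f t $ 1) h" for h
    unfolding L2_inner_def
    by (intro Bochner_Integration.integral_cong refl) (simp add: cnj_powi mult_ac del: complex_cnj_power_int)
  have i2: "L2_inner (\<lambda>t. f t $ 2) (\<lambda>t. cnj t powi m * h t) = L2_inner (\<lambda>t. t powi m * f t $ 2) h" for h
    unfolding L2_inner_def
    by (intro Bochner_Integration.integral_cong refl) (simp add: mult_ac)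
  have L: "(\<lambda>t. t powi (- n) * f t $ 1) \<in> L2" "(\<lambda>t. t powi m * f t $ 2) \<in> L2"
    by (intro L2_powi LR_nth1[OF f] LR_nth2[OF f])+
  have ig: "LR_inner R f (wvec (\<lambda>t. t powi n * hp t) (\<lambda>t. cnj t powi m * hm t)) =
      L2_inner (\<lambda>t. t powi (- n) * f t $ 1) hp + L2_inner (\<lambda>t. t powi m * f t $ 2) hm"
    if "hp \<in> H2_plus" "hm \<in> H2_minus" for hp hm
    unfolding inner_wvec[OF f powi_H2_L2(1)[OF that(1)] powi_H2_L2(2)[OF that(2)]] i1 i2 ..
  show ?thesis
  proof
    assume *: "\<forall>g\<in>Hc R n m. LR_inner R f g = 0"
    have g0: "LR_inner R f (wvec (\<lambda>t. t powi n * hp t) (\<lambda>t. cnj t powi m * hm t)) = 0"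
      if "hp \<in> H2_plus" "hm \<in> H2_minus" for hp hm
      using * gen_Hc that unfolding gen_def by blast
    have "L2_inner (\<lambda>t. t powi (- n) * f t $ 1) hp = 0" if "hp \<in> H2_plus" for hp
      using g0[OF that H2_minus_zero] ig[OF that H2_minus_zero] by (simp add: L2_inner_def)
    moreover have "(\<integral>t. t powi m * f t $ 2 * t ^ j \<partial>circle) = 0" if "j \<ge> 1" for j
    proof -
      have h: "(\<lambda>t. cnj (t * t ^ (j - 1))) \<in> H2_minus"
        by (intro cnj_mult_t_H2_minus) (simp add: H2_plus_iff power_add[symmetric] circle_moment_power)
      have "L2_inner (\<lambda>t. t powi m * f t $ 2) (\<lambda>t. cnj (t * t ^ (j - 1))) = 0"
        using g0[OF H2_plus_const[of 0] h] ig[OF H2_plus_const[of 0] h] by (simp add: L2_inner_def)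
      moreover have eq: "t * t ^ (j - 1) = t ^ j" for t :: complex using that by (cases j) auto
      have "L2_inner (\<lambda>t. t powi m * f t $ 2) (\<lambda>t. cnj (t * t ^ (j - 1))) = (\<integral>t. t powi m * f t $ 2 * t ^ j \<partial>circle)"
        unfolding L2_inner_def eq complex_cnj_cnj by (simp only: mult.commute)
      ultimately show ?thesis by simp
    qed
    ultimately show "(\<lambda>t. t powi (- n) * f t $ 1) \<in> H2_minus \<and> (\<lambda>t. t powi m * f t $ 2) \<in> H2_plus"
      using L by (simp add: H2_plus_iff H2_minus_def)
  next
    assume *: "(\<lambda>t. t powi (- n) * f t $ 1) \<in> H2_minus \<and> (\<lambda>t. t powi m * f t $ 2) \<in> H2_plus"
    have "LR_inner R f g = 0" if gg: "g \<in> gen n m" for g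
    proof -
      obtain hp hm where g: "g = wvec (\<lambda>t. t powi n * hp t) (\<lambda>t. cnj t powi m * hm t)" "hp \<in> H2_plus" "hm \<in> H2_minus"
        using gg unfolding gen_def by blast
      have "L2_inner (\<lambda>t. t powi m * f t $ 2) hm = cnj (L2_inner hm (\<lambda>t. t powi m * f t $ 2))"
        by (rule L2.ip_cnj[OF H2_minus_L2[OF g(3)] L(2)])
      then show ?thesis using * g ig[OF g(2,3)] by (simp add: H2_minus_def)
    qed
    note orth = this
    show "\<forall>g\<in>Hc R n m. LR_inner R f g = 0"
    proof
      fix x assume "x \<in> Hc R n m"
      then have x: "x \<in> LR R" "\<And>e. e > 0 \<Longrightarrow> \<exists>g\<in>gen n m. nrm (x - g) < e" by (simp_all add: Hc_eq)
      show "LR_inner R f x = 0" by (rule closure_orthogonal[OF gen_LR f orth x])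
    qed
  qed
qed

lemma Hc_memI:
  assumes f: "f \<in> LR R"
    and "\<And>g. g \<in> LR R \<Longrightarrow> (\<lambda>t. t powi (- n) * g t $ 1) \<in> H2_minus \<Longrightarrow> (\<lambda>t. t powi m * g t $ 2) \<in> H2_plus \<Longrightarrow>
      LR_inner R g f = 0"
  shows "f \<in> Hc R n m"
  using assms Hc_perp_iff by (intro closed_subspace_memI[OF Hc_csub f]) blast

lemma Hc_cong_AE:
  assumes f: "f \<in> Hc R n m" and eq: "AE t in circle. f t = g t"
  shows "g \<in> Hc R n m"
proof (rule csub_null[OF Hc_csub f])
  show g: "g \<in> LR R" by (rule LR_cong_AE[OF Hc_LR[OF f] eq])
  show "nrm (g - f) = 0"
    unfolding nrm_diff_eq_0_iff[OF g Hc_LR[OF f]] using eq by eventually_elim simp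
qed

lemma powi_Suc_eq: "norm t = 1 \<Longrightarrow> t powi (-1) * (t powi (- n) * z) = t powi (- (n + 1)) * z" for t :: complex
proof -
  assume t: "norm t = 1"
  have "-1 + - n = - (n + 1)" by simp
  then show ?thesis by (simp only: powi_mult_powi_left[OF t])
qed

lemma Hc_mono1: "f \<in> Hc R (n + 1) m \<Longrightarrow> f \<in> Hc R n m"
proof (rule Hc_memI[OF Hc_LR])
  assume f: "f \<in> Hc R (n + 1) m"
  then show "f \<in> Hc R (n + 1) m" .
  fix g assume g: "g \<in> LR R" and g1: "(\<lambda>t. t powi (- n) * g t $ 1) \<in> H2_minus" and g2: "(\<lambda>t. t powi m * g t $ 2) \<in> H2_plus"
  have "(\<lambda>t. t powi (- (n + 1)) * g t $ 1) \<in> H2_minus"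
  proof (rule H2_minus_cong_AE[OF H2_minus_mult_cnj_t[OF g1]])
    show "AE t in circle. t powi (-1) * (t powi (- n) * g t $ 1) = t powi (- (n + 1)) * g t $ 1"
      by (intro AE_I2 powi_Suc_eq) simp
    show "(\<lambda>t. t powi (- (n + 1)) * g t $ 1) \<in> borel_measurable circle"
      by (intro L2_measurable L2_powi LR_nth1 g)
  qed
  then show "LR_inner R g f = 0" using Hc_perp_iff[OF g, of "n + 1" m] g2 f by blast
qed

lemma Hc_shift: "f \<in> Hc R n m \<Longrightarrow> shift j f \<in> Hc R (n + j) (m - j)"
proof (rule Hc_memI)
  assume f: "f \<in> Hc R n m"
  then show "shift j f \<in> LR R" by (simp add: Hc_LR)
  fix g assume g: "g \<in> LR R" and g1: "(\<lambda>t. t powi (- (n + j)) * g t $ 1) \<in> H2_minus"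
    and g2: "(\<lambda>t. t powi (m - j) * g t $ 2) \<in> H2_plus"
  have "(\<lambda>t. t powi (- n) * shift (- j) g t $ 1) \<in> H2_minus"
  proof (rule H2_minus_cong_AE[OF g1])
    show "AE t in circle. t powi (- (n + j)) * g t $ 1 = t powi (- n) * shift (- j) g t $ 1"
      by (intro AE_I2) (simp add: powi_mult_powi_left)
    show "(\<lambda>t. t powi (- n) * shift (- j) g t $ 1) \<in> borel_measurable circle"
      by (intro L2_measurable L2_powi LR_nth1 shift_in g)
  qed
  moreover have "(\<lambda>t. t powi m * shift (- j) g t $ 2) \<in> H2_plus"
  proof (rule H2_plus_cong_AE[OF g2])
    show "AE t in circle. t powi (m - j) * g t $ 2 = t powi m * shift (- j) g t $ 2"
      by (intro AE_I2) (simp add: powi_mult_powi_left)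
    show "(\<lambda>t. t powi m * shift (- j) g t $ 2) \<in> borel_measurable circle"
      by (intro L2_measurable L2_powi LR_nth2 shift_in g)
  qed
  ultimately have "LR_inner R (shift (- j) g) f = 0"
    using Hc_perp_iff[OF shift_in[OF g], of n m] f by blast
  then show "LR_inner R g (shift j f) = 0" using inner_shift_left[OF g Hc_LR[OF f], of "- j"] by simp
qed

text \<open>Conjugation exchanges the two Hardy spaces up to one factor t, because the constants
  belong to \<open>H2_plus\<close>; this factor is the offset of 1 in the indices.\<close>

lemma Hc_cflip: "f \<in> Hc R n m \<Longrightarrow> cflip f \<in> Hc R (m + 1) (n - 1)"
proof (rule Hc_memI)
  assume f: "f \<in> Hc R n m"
  then show "cflip f \<in> LR R" by (simp add: Hc_LR)
  fix g assume g: "g \<in> LR R" and g1: "(\<lambda>t. t powi (- (m + 1)) * g t $ 1) \<in> H2_minus"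
    and g2: "(\<lambda>t. t powi (n - 1) * g t $ 2) \<in> H2_plus"
  have "(\<lambda>t. t powi (- n) * cflip g t $ 1) \<in> H2_minus"
  proof (rule H2_minus_cong_AE[OF cnj_mult_t_H2_minus[OF g2]])
    show "AE t in circle. cnj (t * (t powi (n - 1) * g t $ 2)) = t powi (- n) * cflip g t $ 1"
    proof (rule AE_I2)
      fix t assume "t \<in> space circle"
      then have t: "norm t = 1" by simp
      have "t * (t powi (n - 1) * g t $ 2) = t powi n * g t $ 2" using t by (simp add: mult.assoc[symmetric] mult_powi)
      then show "cnj (t * (t powi (n - 1) * g t $ 2)) = t powi (- n) * cflip g t $ 1"
        by (simp only: complex_cnj_mult cnj_powi[OF t] cflip_nth)
    qed
    show "(\<lambda>t. t powi (- n) * cflip g t $ 1) \<in> borel_measurable circle"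
      by (intro L2_measurable L2_powi LR_nth1 cflip_in g)
  qed
  moreover have "(\<lambda>t. t powi m * cflip g t $ 2) \<in> H2_plus"
  proof (rule H2_plus_cong_AE[OF cnj_mult_t_H2_plus[OF g1]])
    show "AE t in circle. cnj (t * (t powi (- (m + 1)) * g t $ 1)) = t powi m * cflip g t $ 2"
    proof (rule AE_I2)
      fix t assume "t \<in> space circle"
      then have t: "norm t = 1" by simp
      have "t * (t powi (- (m + 1)) * g t $ 1) = t powi (- m) * g t $ 1" using t by (simp add: mult.assoc[symmetric] mult_powi)
      then show "cnj (t * (t powi (- (m + 1)) * g t $ 1)) = t powi m * cflip g t $ 2"
        by (simp only: complex_cnj_mult cnj_powi[OF t] cflip_nth minus_minus)
    qed
    show "(\<lambda>t. t powi m * cflip g t $ 2) \<in> borel_measurable circle"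
      by (intro L2_measurable L2_powi LR_nth2 cflip_in g)
  qed
  ultimately have "LR_inner R (cflip g) f = 0"
    using Hc_perp_iff[OF cflip_in[OF g], of n m] f by blast
  then show "LR_inner R g (cflip f) = 0"
    using inner_cflip_cflip[OF cflip_in[OF g] Hc_LR[OF f]] ip_cnj[OF cflip_in[OF g] Hc_LR[OF f]] by simp
qed

end

section \<open>The reflection exchanging the two defect spaces\<close>

context LR_weight
begin

text \<open>The shift by n - m - 1 undoes the change of indices made by \<open>cflip\<close>, so
  that the larger subspace is mapped to itself and the two smaller ones are exchanged.\<close>

definition reflect :: "int \<Rightarrow> int \<Rightarrow> vfun \<Rightarrow> vfun" where
  "reflect n m f = shift (n - m - 1) (cflip f)"

lemma reflect_in [simp]: "f \<in> LR R \<Longrightarrow> reflect n m f \<in> LR R"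
  by (simp add: reflect_def)

lemma inner_reflect_reflect: "f \<in> LR R \<Longrightarrow> g \<in> LR R \<Longrightarrow> LR_inner R (reflect n m f) (reflect n m g) = LR_inner R g f"
  by (simp add: reflect_def inner_shift_shift inner_cflip_cflip)

lemma nrm_reflect: "f \<in> LR R \<Longrightarrow> nrm (reflect n m f) = nrm f"
  by (simp add: nrm_def inner_reflect_reflect)

lemma reflect_reflect_AE: "AE t in circle. reflect n m (reflect n m f) t = f t"
proof (rule AE_I2)
  fix t assume "t \<in> space circle"
  then have t: "norm t = 1" by simp
  have "t powi j * cnj (t powi j * cnj z) = z" for j z
    unfolding complex_cnj_mult cnj_powi[OF t] complex_cnj_cnj powi_mult_powi_left[OF t] by simp
  then show "reflect n m (reflect n m f) t = f t"
    by (simp add: reflect_def vec_eq_iff forall_2 del: complex_cnj_mult complex_cnj_power_int)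
qed

lemma reflect_Hc:
  assumes f: "f \<in> Hc R n m"
  shows "reflect n m f \<in> Hc R n m"
  using Hc_shift[OF Hc_cflip[OF f], of "n - m - 1"] by (simp add: reflect_def)

lemma reflect_Hc1:
  assumes f: "f \<in> Hc R (n + 1) m"
  shows "reflect n m f \<in> Hc R n (m + 1)"
  using Hc_shift[OF Hc_cflip[OF f], of "n - m - 1"] by (simp add: reflect_def algebra_simps)

lemma reflect_Hc2:
  assumes f: "f \<in> Hc R n (m + 1)"
  shows "reflect n m f \<in> Hc R (n + 1) m"
  using Hc_shift[OF Hc_cflip[OF f], of "n - m - 1"] by (simp add: reflect_def algebra_simps)

lemma Hc_mono2: "f \<in> Hc R n (m + 1) \<Longrightarrow> f \<in> Hc R n m"
  by (rule Hc_cong_AE[OF reflect_Hc[OF Hc_mono1[OF reflect_Hc2]] reflect_reflect_AE])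

lemma e_plus_wvec: "e_plus R n = wvec (\<lambda>t. t powi n) (\<lambda>t. 0)"
  by (simp add: e_plus_def fun_eq_iff vec_eq_iff forall_2)

lemma e_plus_Hc: "e_plus R n \<in> Hc R n m"
proof (rule gen_Hc)
  have "e_plus R n = wvec (\<lambda>t. t powi n * 1) (\<lambda>t. cnj t powi m * 0)" by (simp add: e_plus_wvec)
  then show "e_plus R n \<in> gen n m"
    unfolding gen_def using H2_plus_const[of 1] H2_minus_zero
    by (intro CollectI exI[of _ "\<lambda>t. 1"] exI[of _ "\<lambda>t. 0"]) simp
qed

lemma e_plus_in [simp]: "e_plus R n \<in> LR R"
  by (rule Hc_LR[OF e_plus_Hc])

lemma inner_e_plus: "f \<in> LR R \<Longrightarrow> LR_inner R f (e_plus R n) = L2_inner (\<lambda>t. f t $ 1) (\<lambda>t. t powi n)"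
  by (simp add: e_plus_wvec inner_wvec) (simp add: L2_inner_def)

lemma shift_e_plus_AE: "AE t in circle. shift j (e_plus R n) t = e_plus R (n + j) t"
  by (intro AE_I2) (simp add: e_plus_def vec_eq_iff forall_2 powi_mult_powi powi_mult_powi_left add.commute)

lemma reflect_e_plus_AE: "AE t in circle. reflect n m (e_plus R n) t = e_minus R m t"
proof (rule AE_I2)
  fix t assume "t \<in> space circle"
  then have t: "norm t = 1" by simp
  show "reflect n m (e_plus R n) t = e_minus R m t"
    using t by (simp add: reflect_def e_plus_def e_minus_def vec_eq_iff forall_2 powi_mult_powi powi_mult_powi_left
        cnj_powi' mult_ac)
qed

lemma e_minus_in [simp]: "e_minus R m \<in> LR R"
  by (rule LR_cong_AE[OF reflect_in[OF e_plus_in] reflect_e_plus_AE[of m m]])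

text \<open>Orthogonality to the smaller subspace puts t^(- n - 1) times the first entry of h into
  \<open>H2_minus\<close>. Orthogonality to \<open>e_plus\<close> gives the zero mean needed to
  raise the exponent by 1, so h is orthogonal to all of \<open>Hc R n m\<close>, which contains it.
  The defect is thus at most one-dimensional.\<close>

lemma Hc_defect_zero:
  assumes h: "h \<in> Hc R n m" and orth: "\<And>g. g \<in> Hc R (n + 1) m \<Longrightarrow> LR_inner R h g = 0"
    and e: "LR_inner R h (e_plus R n) = 0"
  shows "nrm h = 0"
proof -
  have hL: "h \<in> LR R" by (rule Hc_LR[OF h])
  have 1: "(\<lambda>t. t powi (- (n + 1)) * h t $ 1) \<in> H2_minus" and 2: "(\<lambda>t. t powi m * h t $ 2) \<in> H2_plus"
    using Hc_perp_iff[OF hL, of "n + 1" m] orth by auto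
  have "(\<lambda>t. t powi (- n) * h t $ 1) \<in> H2_minus"
  proof (rule H2_minus_mult_tI)
    show L: "(\<lambda>t. t powi (- n) * h t $ 1) \<in> L2" by (intro L2_powi LR_nth1 hL)
    show "(\<lambda>t. t powi (-1) * (t powi (- n) * h t $ 1)) \<in> H2_minus"
    proof (rule H2_minus_cong_AE[OF 1])
      show "AE t in circle. t powi (- (n + 1)) * h t $ 1 = t powi (-1) * (t powi (- n) * h t $ 1)"
        by (rule AE_I2, rule powi_Suc_eq[symmetric]) simp
    qed (intro L2_measurable L2_powi L)
    have "(\<integral>t. t powi (- n) * h t $ 1 \<partial>circle) = L2_inner (\<lambda>t. h t $ 1) (\<lambda>t. t powi n)"
      unfolding L2_inner_def
      by (intro Bochner_Integration.integral_cong refl) (simp add: cnj_powi del: complex_cnj_power_int)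
    then show "(\<integral>t. t powi (- n) * h t $ 1 \<partial>circle) = 0"
      using e inner_e_plus[OF hL] by simp
  qed
  then have "LR_inner R h h = 0" using 2 Hc_perp_iff[OF hL, of n m] h by blast
  then show ?thesis by (simp add: nrm_def)
qed

text \<open>Here the integrability of log (1 - |R|) produces g in \<open>H2_plus\<close> with |g| =
  1 - |R| on the circle and nonzero mean. The smallness of g where |R| is near 1 keeps (t^n cnj g,
  0) in the weighted space.\<close>

lemma e_plus_not_orthogonal:
  obtains f where "f \<in> LR R" "\<And>g. g \<in> Hc R (n + 1) m \<Longrightarrow> LR_inner R f g = 0" "LR_inner R f (e_plus R n) \<noteq> 0"
proof -
  define u where "u = (\<lambda>t. ln (1 - cmod (R t)))"
  have u: "integrable circle u" using Rlog by (simp add: u_def log_integrable_def)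
  have u0: "AE t in circle. u t \<le> 0"
    using R_lt_1 by eventually_elim (simp add: u_def)
  define G where "G = outer u"
  have G1: "cmod (G z) \<le> 1" if "cmod z < 1" for z
    unfolding G_def using outer_bounded[OF u u0 that] by simp
  have "G \<in> H2_disk"
    using G1 outer_holomorphic[OF u] unfolding G_def by (intro bounded_H2_disk) auto
  then obtain g where g: "g \<in> H2_plus" "\<And>z. cmod z < 1 \<Longrightarrow> cauchy_int g z = G z"
    using H2_disk_boundary by blast
  note gL = H2_plus_L2[OF g(1)]
  have "(\<integral>t. g t \<partial>circle) = cauchy_int g 0"
    unfolding cauchy_int_def by (intro Bochner_Integration.integral_cong) auto
  also have "\<dots> \<noteq> 0" using g(2)[of 0] outer_zero[OF u] by (simp add: G_def)
  finally have g0: "(\<integral>t. g t \<partial>circle) \<noteq> 0" .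
  have gnorm: "AE t in circle. cmod (g t) = 1 - cmod (R t)"
    using H2_plus_cauchy_tendsto[OF g(1)] outer_tendsto[OF u] AE_circle_norm R_lt_1
  proof eventually_elim
    case (elim t)
    have "\<forall>\<^sub>F r in at_left (1::real). cauchy_int g (of_real r * t) = G (of_real r * t)"
      using eventually_at_left_real[of 0 1]
      by (rule eventually_mono) (use elim(3) in \<open>auto intro!: g(2) simp: norm_mult\<close>)
    then have "((\<lambda>r. G (of_real r * t)) \<longlongrightarrow> g t) (at_left (1::real))"
      by (rule Lim_transform_eventually[OF elim(1)])
    then have "((\<lambda>r. cmod (G (of_real r * t))) \<longlongrightarrow> cmod (g t)) (at_left (1::real))" by (rule tendsto_norm)
    then have "cmod (g t) = exp (u t)"
      using tendsto_unique[OF _ _ elim(2)] unfolding G_def by simp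
    then show ?case using elim(4) by (simp add: u_def)
  qed
  define f :: vfun where "f = (\<lambda>t. vector [t powi n * cnj (g t), 0])"
  have f1: "f t $ 1 = t powi n * cnj (g t)" and f2: "f t $ 2 = 0" for t by (simp_all add: f_def)
  have f1L: "(\<lambda>t. f t $ 1) \<in> L2" unfolding f1 by (intro L2_powi L2_cnj gL)
  have fm: "f \<in> borel_measurable circle"
    by (rule borel_measurable_vec2) (use L2_measurable[OF f1L] in \<open>simp_all add: f2\<close>)
  have "(\<lambda>t. comp2 f t * 1) \<in> L2"
  proof (rule L2_mult_bounded[OF L2_const comp2_measurable[OF fm]])
    show "AE t in circle. cmod (comp2 f t) \<le> 1"
      using gnorm R_lt_1 AE_circle_norm
    proof eventually_elim
      case (elim t)
      define x where "x = cmod (R t)"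
      have x: "0 \<le> x" "x < 1" using elim by (auto simp: x_def)
      have sq: "0 < 1 - x\<^sup>2" using x by (simp add: abs_square_less_1)
      have "cmod (comp2 f t) = x * (1 - x) / sqrt (1 - x\<^sup>2)"
        using elim sq unfolding comp2_def f1 f2 x_def by (simp add: norm_divide norm_mult norm_power_int)
      also have "\<dots> \<le> 1"
      proof -
        have "(x * (1 - x))\<^sup>2 \<le> (1 - x)\<^sup>2" using x by (intro power_mono) (auto simp: mult_left_le_one_le)
        also have "\<dots> = (1 - x) * (1 - x)" by (simp add: power2_eq_square)
        also have "\<dots> \<le> (1 - x) * (1 + x)" using x by (intro mult_left_mono) auto
        also have "\<dots> = 1 - x\<^sup>2" by (simp add: power2_eq_square algebra_simps)
        finally have "x * (1 - x) \<le> sqrt (1 - x\<^sup>2)" by (rule real_le_rsqrt)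
        then show ?thesis using sq by simp
      qed
      finally show ?case .
    qed
  qed
  then have fL: "f \<in> LR R" using fm f1L by (simp add: LR_iff)
  have "(\<lambda>t. t powi (- (n + 1)) * f t $ 1) \<in> H2_minus"
  proof (rule H2_minus_cong_AE[OF cnj_mult_t_H2_minus[OF g(1)]])
    show "AE t in circle. cnj (t * g t) = t powi (- (n + 1)) * f t $ 1"
    proof (rule AE_I2)
      fix t assume "t \<in> space circle"
      then have t: "norm t = 1" by simp
      have "- (n + 1) + n = -1" by simp
      then show "cnj (t * g t) = t powi (- (n + 1)) * f t $ 1"
        unfolding f1 powi_mult_powi_left[OF t] using t by (simp add: cnj_eq_inverse power_int_minus)
    qed
    show "(\<lambda>t. t powi (- (n + 1)) * f t $ 1) \<in> borel_measurable circle"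
      by (intro L2_measurable L2_powi f1L)
  qed
  moreover have "(\<lambda>t. t powi m * f t $ 2) \<in> H2_plus" by (simp add: f2)
  ultimately have "\<And>g. g \<in> Hc R (n + 1) m \<Longrightarrow> LR_inner R f g = 0"
    using Hc_perp_iff[OF fL, of "n + 1" m] by blast
  moreover have "LR_inner R f (e_plus R n) = cnj (\<integral>t. g t \<partial>circle)"
    unfolding inner_e_plus[OF fL] L2_inner_def Bochner_Integration.integral_cnj[symmetric]
  proof (intro Bochner_Integration.integral_cong refl)
    fix t assume "t \<in> space circle"
    then have t: "norm t = 1" by simp
    show "cnj (t powi n) * f t $ 1 = cnj (g t)"
      unfolding f1 cnj_powi[OF t] powi_mult_powi_left[OF t] by simp
  qed
  ultimately show ?thesis using that[OF fL] g0 by simp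
qed

subsection \<open>The defect vectors\<close>

lemma LR_proj_props:
  assumes W: "closed_subspace W" and f: "f \<in> LR R"
  shows LR_proj_in: "LR_proj R W f \<in> W" and LR_proj_orth: "g \<in> W \<Longrightarrow> LR_inner R (f - LR_proj R W f) g = 0"
proof -
  obtain p where p: "p \<in> W" "\<And>g. g \<in> W \<Longrightarrow> LR_inner R (f - p) g = 0" using projE[OF W f] by blast
  have "LR_proj R W f \<in> W \<and> (\<forall>g\<in>W. LR_inner R (\<lambda>t. f t - LR_proj R W f t) g = 0)"
    unfolding LR_proj_def by (rule someI[of _ p]) (use p in \<open>simp add: fun_diff_def\<close>)
  then show "LR_proj R W f \<in> W" "g \<in> W \<Longrightarrow> LR_inner R (f - LR_proj R W f) g = 0"
    by (simp_all add: fun_diff_def)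
qed

text \<open>The property chosen by \<open>Kc\<close>, isolated so that it can be proved for shifted
  and reflected vectors and combined with uniqueness.\<close>

definition is_K :: "int \<Rightarrow> int \<Rightarrow> vfun \<Rightarrow> bool" where
  "is_K n m K \<longleftrightarrow> K \<in> LR_ominus R (Hc R n m) (Hc R (n + 1) m) \<and> LR_norm R K = 1 \<and> cpos (LR_inner R (e_plus R n) K)"

lemma is_K_iff: "is_K n m K \<longleftrightarrow> K \<in> Hc R n m \<and> (\<forall>g\<in>Hc R (n + 1) m. LR_inner R K g = 0) \<and> nrm K = 1 \<and>
    cpos (LR_inner R (e_plus R n) K)"
  by (auto simp: is_K_def LR_ominus_def LR_norm_eq)

text \<open>The witness is the normalized component of \<open>e_plus\<close> orthogonal to the
  smaller subspace. Its pairing with \<open>e_plus\<close> is the norm of that component, which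
  \<open>e_plus_not_orthogonal\<close> shows to be nonzero.\<close>

lemma is_K_exists: "\<exists>K. is_K n m K"
proof -
  let ?e = "e_plus R n" and ?W = "Hc R (n + 1) m"
  define p where "p = LR_proj R ?W ?e"
  have p: "p \<in> ?W" "\<And>g. g \<in> ?W \<Longrightarrow> LR_inner R (?e - p) g = 0"
    unfolding p_def using LR_proj_props[OF Hc_csub e_plus_in] by auto
  define v where "v = ?e - p"
  have v: "v \<in> Hc R n m" unfolding v_def by (rule csub_diff[OF Hc_csub e_plus_Hc Hc_mono1[OF p(1)]])
  note vL = Hc_LR[OF v] and pL = Hc_LR[OF p(1)]
  have "nrm v \<noteq> 0"
  proof
    assume "nrm v = 0"
    obtain f where f: "f \<in> LR R" "\<And>g. g \<in> ?W \<Longrightarrow> LR_inner R f g = 0" "LR_inner R f ?e \<noteq> 0"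
      using e_plus_not_orthogonal[of n m] by blast
    have "LR_inner R f ?e = LR_inner R f p"
      by (rule ip_cong_right) (use \<open>nrm v = 0\<close> f pL in \<open>auto simp: v_def\<close>)
    then show False using f p by simp
  qed
  then have pos: "nrm v > 0" using vL by (simp add: less_le)
  define K where "K = (\<lambda>t. of_real (1 / nrm v) *s v t)"
  have K: "K \<in> Hc R n m" unfolding K_def by (rule csub_sc[OF Hc_csub v])
  have "LR_inner R v g = 0" if "g \<in> ?W" for g using p(2)[OF that] by (simp only: v_def)
  then have "\<forall>g\<in>?W. LR_inner R K g = 0"
    using vL unfolding K_def by (auto simp: ip_sc_left Hc_LR)
  moreover have "nrm K = 1" unfolding K_def using nrm_sc[OF vL, of "of_real (1 / nrm v)"] pos by (simp add: norm_divide)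
  moreover have "LR_inner R ?e K = of_real (nrm v)"
  proof -
    have "LR_inner R ?e v = LR_inner R v v + LR_inner R p v"
      using vL pL by (simp add: ip_add_left[symmetric] v_def)
    also have "LR_inner R p v = 0" using p ip_cnj[OF vL pL] by (simp add: v_def)
    also have "LR_inner R v v = of_real ((nrm v)\<^sup>2)" by (rule ip_self[OF vL])
    finally show ?thesis using vL pos by (simp add: K_def ip_sc_right power2_eq_square)
  qed
  ultimately have "is_K n m K" using K pos by (simp add: is_K_iff cpos_def)
  then show ?thesis by blast
qed

lemma is_K_Kc: "is_K n m (Kc R n m)"
  using someI_ex[OF is_K_exists[of n m]] unfolding is_K_def Kc_def .

text \<open>One-dimensionality of the defect with \<open>K\<close> as the test vector: a multiple of
  \<open>K\<close> is subtracted to reach orthogonality to \<open>e_plus\<close>.\<close>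

lemma defect_zero:
  assumes K: "is_K n m K" and h: "h \<in> Hc R n m" "\<And>g. g \<in> Hc R (n + 1) m \<Longrightarrow> LR_inner R h g = 0"
    and z: "LR_inner R h K = 0"
  shows "nrm h = 0"
proof -
  have KH: "K \<in> Hc R n m" and Ko: "\<And>g. g \<in> Hc R (n + 1) m \<Longrightarrow> LR_inner R K g = 0" and K1: "nrm K = 1"
    and Kp: "LR_inner R (e_plus R n) K \<noteq> 0"
    using K by (auto simp: is_K_iff cpos_def)
  note KL = Hc_LR[OF KH] and hL = Hc_LR[OF h(1)]
  have Kp': "LR_inner R K (e_plus R n) \<noteq> 0" using Kp ip_cnj[OF e_plus_in KL] by simp
  define c where "c = LR_inner R h (e_plus R n) / LR_inner R K (e_plus R n)"
  let ?w = "h - (\<lambda>t. c *s K t)"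
  have "nrm ?w = 0"
  proof (rule Hc_defect_zero)
    show "?w \<in> Hc R n m" by (intro csub_diff[OF Hc_csub] csub_sc[OF Hc_csub] h KH)
    show "LR_inner R ?w g = 0" if "g \<in> Hc R (n + 1) m" for g
      using that hL KL h(2) Ko by (simp add: ip_diff_left ip_sc_left Hc_LR)
    show "LR_inner R ?w (e_plus R n) = 0"
      using hL KL Kp' by (simp add: ip_diff_left ip_sc_left c_def)
  qed
  then have "LR_inner R ?w K = 0" using ip_eq_0_null hL KL by simp
  moreover have "LR_inner R K K = 1" using ip_self[OF KL] K1 by simp
  ultimately have "c = 0" using hL KL z by (simp add: ip_diff_left ip_sc_left)
  then have "?w = h" by (simp add: fun_eq_iff vec_eq_iff)
  then show ?thesis using \<open>nrm ?w = 0\<close> by simp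
qed

text \<open>Two unit vectors in a one-dimensional space differ by a phase c, and the two positive
  pairings with \<open>e_plus\<close> make c a positive real number.\<close>

lemma is_K_unique:
  assumes K: "is_K n m K" and K': "is_K n m K'"
  shows "AE t in circle. K t = K' t"
proof -
  have 1: "K \<in> Hc R n m" "\<And>g. g \<in> Hc R (n + 1) m \<Longrightarrow> LR_inner R K g = 0" "nrm K = 1" "cpos (LR_inner R (e_plus R n) K)"
    using K by (auto simp: is_K_iff)
  have 2: "K' \<in> Hc R n m" "\<And>g. g \<in> Hc R (n + 1) m \<Longrightarrow> LR_inner R K' g = 0" "nrm K' = 1" "cpos (LR_inner R (e_plus R n) K')"
    using K' by (auto simp: is_K_iff)
  note L = Hc_LR[OF 1(1)] Hc_LR[OF 2(1)]
  define c where "c = LR_inner R K' K"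
  let ?w = "K' - (\<lambda>t. c *s K t)"
  have KK: "LR_inner R K K = 1" using ip_self[OF L(1)] 1(3) by simp
  have w0: "nrm ?w = 0"
  proof (rule defect_zero[OF K])
    show "?w \<in> Hc R n m" by (intro csub_diff[OF Hc_csub] csub_sc[OF Hc_csub] 1 2)
    show "LR_inner R ?w g = 0" if "g \<in> Hc R (n + 1) m" for g
      using that L 1(2) 2(2) by (simp add: ip_diff_left ip_sc_left Hc_LR)
    show "LR_inner R ?w K = 0" using L KK by (simp add: ip_diff_left ip_sc_left c_def)
  qed
  have cK: "(\<lambda>t. c *s K t) \<in> LR R" using L by simp
  have "nrm K' = nrm (\<lambda>t. c *s K t)" by (rule nrm_cong[OF L(2) cK w0])
  then have c1: "cmod c = 1" using L 1 2 by (simp add: nrm_sc)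
  have eq: "LR_inner R (e_plus R n) K' = cnj c * LR_inner R (e_plus R n) K"
    using ip_cong_right[OF L(2) cK e_plus_in w0] L by (simp add: ip_sc_right)
  obtain x y where xy: "LR_inner R (e_plus R n) K = of_real x" "x > 0" "LR_inner R (e_plus R n) K' = of_real y" "y > 0"
    using 1(4) 2(4) by (auto simp: cpos_def elim!: Reals_cases)
  have "cnj c = of_real (y / x)" using eq xy by (simp add: field_simps)
  then have c: "c = of_real (y / x)" by (metis complex_cnj_cnj complex_cnj_complex_of_real)
  have "cmod (of_real (y / x)) = 1" using c1 unfolding c .
  then have "\<bar>y / x\<bar> = 1" by (simp only: norm_of_real)
  moreover have "y / x > 0" using xy by simp
  ultimately have "y / x = 1" by linarith
  then have "c = 1" using c by simp
  then have "(\<lambda>t. c *s K t) = K" by (simp add: fun_eq_iff)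
  then have "nrm (K' - K) = 0" using w0 by simp
  then have "AE t in circle. K' t = K t" using nrm_diff_eq_0_iff[OF L(2) L(1)] by simp
  then show ?thesis by eventually_elim simp
qed

text \<open>Multiplication by t^(n - k) is unitary and carries the subspaces and
  \<open>e_plus\<close> for the pair (k, l) to those for (n, m), so uniqueness applies.\<close>

lemma Kc_shift:
  assumes "k + l = n + m"
  shows "AE t in circle. shift (n - k) (Kc R k l) t = Kc R n m t"
proof -
  have K: "is_K k l (Kc R k l)" by (rule is_K_Kc)
  have lm: "l - (n - k) = m" using assms by simp
  have KH: "Kc R k l \<in> Hc R k l" using K by (simp add: is_K_iff)
  note KL = Hc_LR[OF KH]
  have "is_K n m (shift (n - k) (Kc R k l))"
    unfolding is_K_iff
  proof (intro conjI ballI)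
    show "shift (n - k) (Kc R k l) \<in> Hc R n m" using Hc_shift[OF KH, of "n - k"] lm by simp
    fix g assume g: "g \<in> Hc R (n + 1) m"
    have "n + 1 + - (n - k) = k + 1" "m - - (n - k) = l" using assms by simp_all
    then have "shift (- (n - k)) g \<in> Hc R (k + 1) l" using Hc_shift[OF g, of "- (n - k)"] by (simp only:)
    then show "LR_inner R (shift (n - k) (Kc R k l)) g = 0"
      using inner_shift_left[OF KL Hc_LR[OF g]] K by (simp add: is_K_iff)
  next
    show "nrm (shift (n - k) (Kc R k l)) = 1" using K KL by (simp add: nrm_shift is_K_iff)
    have "LR_inner R (e_plus R n) (shift (n - k) (Kc R k l)) = LR_inner R (shift (n - k) (e_plus R k)) (shift (n - k) (Kc R k l))"
      by (rule inner_AE_left[symmetric]) (use shift_e_plus_AE[of "n - k" k] KL in auto)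
    also have "\<dots> = LR_inner R (e_plus R k) (Kc R k l)" using KL by (simp add: inner_shift_shift)
    finally show "cpos (LR_inner R (e_plus R n) (shift (n - k) (Kc R k l)))" using K by (simp add: is_K_iff)
  qed
  then show ?thesis by (rule is_K_unique[OF _ is_K_Kc])
qed

definition is_Kt :: "int \<Rightarrow> int \<Rightarrow> vfun \<Rightarrow> bool" where
  "is_Kt n m K \<longleftrightarrow> K \<in> LR_ominus R (Hc R n m) (Hc R n (m + 1)) \<and> LR_norm R K = 1 \<and> cpos (LR_inner R K (e_minus R m))"

lemma is_Kt_iff: "is_Kt n m K \<longleftrightarrow> K \<in> Hc R n m \<and> (\<forall>g\<in>Hc R n (m + 1). LR_inner R K g = 0) \<and> nrm K = 1 \<and>
    cpos (LR_inner R K (e_minus R m))"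
  by (auto simp: is_Kt_def LR_ominus_def LR_norm_eq)

lemma inner_reflect_left:
  assumes f: "f \<in> LR R" and g: "g \<in> LR R"
  shows "LR_inner R (reflect n m f) g = LR_inner R (reflect n m g) f"
proof -
  have "LR_inner R (reflect n m f) g = LR_inner R (reflect n m f) (reflect n m (reflect n m g))"
    by (rule inner_AE_right[symmetric]) (use reflect_reflect_AE f g in auto)
  then show ?thesis using f g by (simp add: inner_reflect_reflect)
qed

text \<open>The reflection sends \<open>e_plus\<close> to \<open>e_minus\<close> and, being
  antiunitary, exchanges the arguments of the pairing; this matches the opposite orders in the two
  normalizations.\<close>

lemma is_K_reflect: "is_K n m K \<Longrightarrow> is_Kt n m (reflect n m K)"
  unfolding is_Kt_iff
proof (intro conjI ballI)
  assume K: "is_K n m K"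
  then have KH: "K \<in> Hc R n m" by (simp add: is_K_iff)
  note KL = Hc_LR[OF KH]
  show "reflect n m K \<in> Hc R n m" by (rule reflect_Hc[OF KH])
  show "LR_inner R (reflect n m K) g = 0" if g: "g \<in> Hc R n (m + 1)" for g
  proof -
    have "LR_inner R K (reflect n m g) = 0" using K reflect_Hc2[OF g] by (simp add: is_K_iff)
    then show ?thesis
      unfolding inner_reflect_left[OF KL Hc_LR[OF g]] using ip_cnj[OF KL reflect_in[OF Hc_LR[OF g]]] by simp
  qed
  show "nrm (reflect n m K) = 1" using K KL by (simp add: is_K_iff nrm_reflect)
  have "LR_inner R (reflect n m K) (e_minus R m) = LR_inner R (reflect n m K) (reflect n m (e_plus R n))"
    by (rule inner_AE_right[symmetric]) (use reflect_e_plus_AE KL in auto)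
  then show "cpos (LR_inner R (reflect n m K) (e_minus R m))"
    using K KL by (simp add: inner_reflect_reflect is_K_iff)
qed

lemma is_Kt_reflect: "is_Kt n m K \<Longrightarrow> is_K n m (reflect n m K)"
  unfolding is_K_iff
proof (intro conjI ballI)
  assume K: "is_Kt n m K"
  then have KH: "K \<in> Hc R n m" by (simp add: is_Kt_iff)
  note KL = Hc_LR[OF KH]
  show "reflect n m K \<in> Hc R n m" by (rule reflect_Hc[OF KH])
  show "LR_inner R (reflect n m K) g = 0" if g: "g \<in> Hc R (n + 1) m" for g
  proof -
    have "LR_inner R K (reflect n m g) = 0" using K reflect_Hc1[OF g] by (simp add: is_Kt_iff)
    then show ?thesis
      unfolding inner_reflect_left[OF KL Hc_LR[OF g]] using ip_cnj[OF KL reflect_in[OF Hc_LR[OF g]]] by simp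
  qed
  show "nrm (reflect n m K) = 1" using K KL by (simp add: is_Kt_iff nrm_reflect)
  have "LR_inner R (e_plus R n) (reflect n m K) = cnj (LR_inner R (reflect n m K) (e_plus R n))"
    using KL by (intro ip_cnj) auto
  also have "LR_inner R (reflect n m K) (e_plus R n) = LR_inner R (reflect n m (e_plus R n)) K"
    using KL by (intro inner_reflect_left) auto
  also have "\<dots> = LR_inner R (e_minus R m) K"
    by (rule inner_AE_left) (use reflect_e_plus_AE KL in auto)
  also have "cnj (LR_inner R (e_minus R m) K) = LR_inner R K (e_minus R m)"
    using KL by (intro ip_cnj[symmetric]) auto
  finally show "cpos (LR_inner R (e_plus R n) (reflect n m K))" using K by (simp add: is_Kt_iff)
qed

lemma is_Kt_Kc_tilde: "is_Kt n m (Kc_tilde R n m)"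
proof -
  have "\<exists>K. is_Kt n m K" using is_K_reflect[OF is_K_Kc] by blast
  then show ?thesis using someI_ex[of "is_Kt n m"] unfolding is_Kt_def Kc_tilde_def by blast
qed

lemma Kc_tilde_reflect: "AE t in circle. Kc_tilde R n m t = reflect n m (Kc R n m) t"
proof -
  have "AE t in circle. reflect n m (Kc_tilde R n m) t = Kc R n m t"
    by (rule is_K_unique[OF is_Kt_reflect[OF is_Kt_Kc_tilde] is_K_Kc])
  then show ?thesis using reflect_reflect_AE[of n m "Kc_tilde R n m"]
    by eventually_elim (metis reflect_def shift_def vmult_def cflip_def)
qed

lemma defect_tilde_zero:
  assumes h: "h \<in> Hc R n m" "\<And>g. g \<in> Hc R n (m + 1) \<Longrightarrow> LR_inner R h g = 0"
    and z: "LR_inner R h (Kc_tilde R n m) = 0"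
  shows "nrm h = 0"
proof -
  note hL = Hc_LR[OF h(1)]
  have KtL: "Kc_tilde R n m \<in> LR R" using is_Kt_Kc_tilde[of n m] by (auto simp: is_Kt_iff intro: Hc_LR)
  have "nrm (reflect n m h) = 0"
  proof (rule defect_zero[OF is_Kt_reflect[OF is_Kt_Kc_tilde] reflect_Hc[OF h(1)]])
    show "LR_inner R (reflect n m h) g = 0" if g: "g \<in> Hc R (n + 1) m" for g
      using h(2)[OF reflect_Hc1[OF g]] ip_cnj[OF hL reflect_in[OF Hc_LR[OF g]]]
      by (simp add: inner_reflect_left[OF hL Hc_LR[OF g]])
    show "LR_inner R (reflect n m h) (reflect n m (Kc_tilde R n m)) = 0"
      using z ip_cnj[OF hL KtL] by (simp add: inner_reflect_reflect hL KtL)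
  qed
  then show ?thesis using nrm_reflect[OF hL] by simp
qed

end

lemma H2_disk_radial_limit:
  assumes F: "F \<in> H2_disk"
  obtains h where "h \<in> H2_plus" "(\<integral>t. h t \<partial>circle) = F 0"
    "AE t in circle. ((\<lambda>r::real. F (of_real r * t)) \<longlongrightarrow> h t) (at_left 1)"
proof -
  obtain h where h: "h \<in> H2_plus" "\<And>z. cmod z < 1 \<Longrightarrow> cauchy_int h z = F z"
    using H2_disk_boundary[OF F] by blast
  have "(\<integral>t. h t \<partial>circle) = cauchy_int h 0"
    unfolding cauchy_int_def by (intro Bochner_Integration.integral_cong) auto
  then have "(\<integral>t. h t \<partial>circle) = F 0" using h(2)[of 0] by simp
  moreover have "AE t in circle. ((\<lambda>r::real. F (of_real r * t)) \<longlongrightarrow> h t) (at_left 1)"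
    using H2_plus_cauchy_tendsto[OF h(1)] AE_circle_norm
  proof eventually_elim
    case (elim t)
    have "\<forall>\<^sub>F r in at_left (1::real). cauchy_int h (of_real r * t) = F (of_real r * t)"
      using eventually_at_left_real[of 0 1]
      by (rule eventually_mono) (use elim(2) in \<open>auto intro!: h(2) simp: norm_mult\<close>)
    then show ?case by (rule Lim_transform_eventually[OF elim(1)])
  qed
  ultimately show ?thesis using that h(1) by blast
qed

section \<open>Resolvents and the colligations\<close>

context LR_weight
begin

lemma UR_eq_shift: "UR f = shift 1 f"
  by (simp add: UR_def fun_eq_iff vec_eq_iff)

text \<open>Multiplication by 1 / t qualifies as the adjoint, and the difference of two candidates
  is orthogonal to itself.\<close>

lemma U_star_AE:
  assumes h: "h \<in> LR R"
  shows "U_star R h \<in> LR R" "AE t in circle. U_star R h t = shift (-1) h t"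
proof -
  have "U_star R h \<in> LR R \<and> (\<forall>f\<in>LR R. LR_inner R (UR f) h = LR_inner R f (U_star R h))"
    unfolding U_star_def LR_adjoint_def
    by (rule someI[of _ "shift (-1) h"]) (use h in \<open>simp add: UR_eq_shift inner_shift_left\<close>)
  then have U: "U_star R h \<in> LR R" "\<And>f. f \<in> LR R \<Longrightarrow> LR_inner R f (shift (-1) h) = LR_inner R f (U_star R h)"
    using h by (auto simp: UR_eq_shift inner_shift_left)
  show "U_star R h \<in> LR R" by (rule U(1))
  define d where "d = U_star R h - shift (-1) h"
  have dL: "d \<in> LR R" unfolding d_def using U(1) h by simp
  have "LR_inner R d d = 0" using U(2)[OF dL] dL U(1) h by (simp add: d_def ip_diff_right)
  then have "nrm d = 0" by (simp add: nrm_def)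
  then show "AE t in circle. U_star R h t = shift (-1) h t"
    using U(1) h by (simp add: d_def nrm_diff_eq_0_iff)
qed

end

locale LR_colligation = LR_weight +
  fixes n m :: int
begin

abbreviation "H \<equiv> Hc R n m"
abbreviation "H1 \<equiv> Hc R (n + 1) m"
abbreviation "H2 \<equiv> Hc R n (m + 1)"
abbreviation "K \<equiv> Kc R n m"
abbreviation "Kt \<equiv> Kc_tilde R n m"

lemma K_H: "K \<in> H" and K_orth: "g \<in> H1 \<Longrightarrow> LR_inner R K g = 0" and nrm_K: "nrm K = 1"
  and e_plus_K: "LR_inner R (e_plus R n) K \<noteq> 0"
  using is_K_Kc[of n m] by (auto simp: is_K_iff cpos_def)

lemma Kt_H: "Kt \<in> H" and Kt_orth: "g \<in> H2 \<Longrightarrow> LR_inner R Kt g = 0" and nrm_Kt: "nrm Kt = 1"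
  using is_Kt_Kc_tilde[of n m] by (auto simp: is_Kt_iff)

lemma K_in [simp]: "K \<in> LR R" and Kt_in [simp]: "Kt \<in> LR R"
  using Hc_LR[OF K_H] Hc_LR[OF Kt_H] by auto

lemma H_LR: "f \<in> H \<Longrightarrow> f \<in> LR R" by (rule Hc_LR)

lemma K_K: "LR_inner R K K = 1" and Kt_Kt: "LR_inner R Kt Kt = 1"
  using ip_self[OF K_in] ip_self[OF Kt_in] by (simp_all add: nrm_K nrm_Kt)

lemma K_orth': "g \<in> H1 \<Longrightarrow> LR_inner R g K = 0"
  using K_orth[of g] ip_cnj[OF K_in Hc_LR, of g "n + 1" m] by simp

lemma Kt_orth': "g \<in> H2 \<Longrightarrow> LR_inner R g Kt = 0"
  using Kt_orth[of g] ip_cnj[OF Kt_in Hc_LR, of g n "m + 1"] by simp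

lemma shift_H2: "g \<in> H2 \<Longrightarrow> shift 1 g \<in> H1"
  using Hc_shift[of g n "m + 1" 1] by simp

lemma shift_H1: "g \<in> H1 \<Longrightarrow> shift (-1) g \<in> H2"
  using Hc_shift[of g "n + 1" m "-1"] by simp

definition dK :: "vfun \<Rightarrow> vfun" where
  "dK g = g - (\<lambda>t. LR_inner R g K *s K t)"

lemma dK_in [simp]: "g \<in> LR R \<Longrightarrow> dK g \<in> LR R"
  by (simp add: dK_def)

text \<open>Codimension one: the difference between \<open>dK g\<close> and the projection of g onto
  \<open>H1\<close> lies in the defect space and is orthogonal to \<open>K\<close>, hence is
  null.\<close>

lemma dK_H1:
  assumes g: "g \<in> H"
  shows "dK g \<in> H1"
proof -
  note gL = H_LR[OF g]
  define p where "p = LR_proj R H1 g"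
  have p: "p \<in> H1" "\<And>h. h \<in> H1 \<Longrightarrow> LR_inner R (g - p) h = 0"
    unfolding p_def using LR_proj_props[OF Hc_csub gL] by auto
  note pL = Hc_LR[OF p(1)]
  have gp: "g - p \<in> H" by (rule csub_diff[OF Hc_csub g Hc_mono1[OF p(1)]])
  have ck: "(\<lambda>t. LR_inner R g K *s K t) \<in> H" by (rule csub_sc[OF Hc_csub K_H])
  have "nrm (dK g - p) = 0"
  proof (rule defect_zero[OF is_K_Kc])
    have eq: "dK g - p = (g - p) - (\<lambda>t. LR_inner R g K *s K t)"
      by (rule ext) (simp add: dK_def)
    show "dK g - p \<in> H" unfolding eq by (rule csub_diff[OF Hc_csub gp ck])
    show "LR_inner R (dK g - p) h = 0" if h: "h \<in> H1" for h
      using p(2)[OF h] K_orth[OF h] gL pL Hc_LR[OF h] by (simp add: dK_def ip_diff_left ip_sc_left)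
    show "LR_inner R (dK g - p) K = 0"
      using gL pL K_orth'[OF p(1)] by (simp add: dK_def ip_diff_left ip_sc_left K_K)
  qed
  then show ?thesis by (rule csub_null[OF Hc_csub p(1) dK_in[OF gL]])
qed

text \<open>\<open>bshift\<close> is \<open>U\<^sub>R\<^sup>*\<close> following the projection onto \<open>\<check>\<H>\<^sub>n\<^sub>+\<^sub>1\<^sub>,\<^sub>m\<close>; it represents \<open>A\<^sub>0\<^sup>*\<close>.\<close>

definition bshift :: "vfun \<Rightarrow> vfun" where
  "bshift g = shift (-1) (dK g)"

lemma bshift_in [simp]: "g \<in> LR R \<Longrightarrow> bshift g \<in> LR R"
  by (simp add: bshift_def)

lemma bshift_H2: "g \<in> H \<Longrightarrow> bshift g \<in> H2"
  unfolding bshift_def by (intro shift_H1 dK_H1)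

lemma bshift_H: "g \<in> H \<Longrightarrow> bshift g \<in> H"
  by (rule Hc_mono2[OF bshift_H2])

lemma bshift_diff:
  assumes "f \<in> LR R" "g \<in> LR R"
  shows "bshift (f - g) = bshift f - bshift g"
proof -
  have "dK (f - g) = dK f - dK g"
  proof (rule ext)
    fix t
    have c: "LR_inner R (f - g) K = LR_inner R f K - LR_inner R g K" by (rule ip_diff_left[OF assms K_in])
    show "dK (f - g) t = (dK f - dK g) t"
      unfolding dK_def c by (rule vector2_eqI) (simp_all add: algebra_simps)
  qed
  then show ?thesis by (simp add: bshift_def shift_diff)
qed

lemma bshift_scale:
  assumes "f \<in> LR R"
  shows "bshift (\<lambda>t. c *s f t) = (\<lambda>t. c *s bshift f t)"
proof -
  have "dK (\<lambda>t. c *s f t) = (\<lambda>t. c *s dK f t)"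
  proof (rule ext)
    fix t
    have e: "LR_inner R (\<lambda>t. c *s f t) K = c * LR_inner R f K" by (rule ip_sc_left[OF assms K_in])
    show "dK (\<lambda>t. c *s f t) t = c *s dK f t"
      unfolding dK_def e by (rule vector2_eqI) (simp_all add: algebra_simps)
  qed
  then show ?thesis by (simp add: bshift_def shift_scale)
qed

text \<open>Energy balance of the colligation: what the state loses in one step is the component
  along \<open>K\<close> that leaves through the output.\<close>

lemma nrm_sq_bshift:
  assumes g: "g \<in> LR R"
  shows "(nrm (bshift g))\<^sup>2 = (nrm g)\<^sup>2 - (cmod (LR_inner R g K))\<^sup>2"
proof -
  define c where "c = LR_inner R g K"
  have "(nrm (bshift g))\<^sup>2 = (nrm (dK g))\<^sup>2" using g by (simp add: bshift_def nrm_shift)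
  also have "\<dots> = (nrm g)\<^sup>2 + (cmod c)\<^sup>2 - 2 * Re (cnj c * c)"
    using g by (simp add: dK_def nrm_sq_diff nrm_sc nrm_K ip_sc_right c_def[symmetric] power_mult_distrib)
  also have "Re (cnj c * c) = (cmod c)\<^sup>2"
    using complex_norm_square[of c] by (metis Re_complex_of_real mult.commute)
  finally show ?thesis by (simp add: c_def)
qed

lemma nrm_bshift_le: "g \<in> LR R \<Longrightarrow> nrm (bshift g) \<le> nrm g"
  by (rule power2_le_imp_le) (simp_all add: nrm_sq_bshift)

text \<open>In the pairing with U p, where p lies in \<open>H2\<close>, only the \<open>H1\<close>
  part of g matters, because U maps \<open>H2\<close> into \<open>H1\<close>. The adjoint of U takes
  that part back into \<open>H2\<close>, so the projection may be dropped.\<close>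

lemma A0_star_AE:
  assumes g: "g \<in> H"
  shows "AE t in circle. A0_star R n m g t = bshift g t"
proof -
  note gL = H_LR[OF g]
  have adj: "LR_inner R (A0 R n m f) g = LR_inner R f (bshift g)" if f: "f \<in> H" for f
  proof -
    note fL = H_LR[OF f]
    define p where "p = LR_proj R H2 f"
    have p: "p \<in> H2" "\<And>h. h \<in> H2 \<Longrightarrow> LR_inner R (f - p) h = 0"
      unfolding p_def using LR_proj_props[OF Hc_csub fL] by auto
    note pL = Hc_LR[OF p(1)]
    have "LR_inner R (A0 R n m f) g = LR_inner R (shift 1 p) g"
      by (simp add: A0_def UR_eq_shift p_def)
    also have "\<dots> = LR_inner R (shift 1 p) (dK g)"
      using K_orth'[OF shift_H2[OF p(1)]] pL gL by (simp add: dK_def ip_diff_right ip_sc_right)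
    also have "\<dots> = LR_inner R p (bshift g)"
      using pL gL by (simp add: bshift_def inner_shift_left)
    also have "\<dots> = LR_inner R f (bshift g)"
      using p(2)[OF bshift_H2[OF g]] pL fL gL by (simp add: ip_diff_left)
    finally show ?thesis .
  qed
  have "A0_star R n m g \<in> H \<and> (\<forall>f\<in>H. LR_inner R (A0 R n m f) g = LR_inner R f (A0_star R n m g))"
    unfolding A0_star_def LR_adjoint_def
    by (rule someI[of _ "bshift g"]) (use adj bshift_H[OF g] in auto)
  then have A: "A0_star R n m g \<in> H" "\<And>f. f \<in> H \<Longrightarrow> LR_inner R f (bshift g) = LR_inner R f (A0_star R n m g)"
    using adj by auto
  define d where "d = A0_star R n m g - bshift g"
  have dH: "d \<in> H" unfolding d_def by (rule csub_diff[OF Hc_csub A(1) bshift_H[OF g]])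
  have "LR_inner R d d = 0" using A(2)[OF dH] H_LR[OF dH] H_LR[OF A(1)] gL by (simp add: d_def ip_diff_right)
  then have "nrm d = 0" by (simp add: nrm_def)
  then show ?thesis using H_LR[OF A(1)] gL by (simp add: d_def nrm_diff_eq_0_iff)
qed

lemma resolvent_A0_star:
  assumes v: "v \<in> H" and z: "cmod \<zeta> < 1"
  defines "x \<equiv> resolvent H (A0_star R n m) \<zeta> v"
  shows "x \<in> H" "nrm (x - (\<lambda>t. \<zeta> *s bshift x t) - v) = 0"
proof -
  have iff: "(AE t in circle. y t - \<zeta> *s A0_star R n m y t = v t) \<longleftrightarrow> nrm (y - (\<lambda>t. \<zeta> *s bshift y t) - v) = 0"
    if y: "y \<in> H" for y
  proof -
    have L: "y - (\<lambda>t. \<zeta> *s bshift y t) \<in> LR R" using H_LR[OF y] by simp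
    have "(AE t in circle. y t - \<zeta> *s A0_star R n m y t = v t) \<longleftrightarrow> (AE t in circle. (y - (\<lambda>t. \<zeta> *s bshift y t)) t = v t)"
    proof (intro iffI)
      assume "AE t in circle. y t - \<zeta> *s A0_star R n m y t = v t"
      then show "AE t in circle. (y - (\<lambda>t. \<zeta> *s bshift y t)) t = v t"
        using A0_star_AE[OF y] by eventually_elim simp
    next
      assume "AE t in circle. (y - (\<lambda>t. \<zeta> *s bshift y t)) t = v t"
      then show "AE t in circle. y t - \<zeta> *s A0_star R n m y t = v t"
        using A0_star_AE[OF y] by eventually_elim simp
    qed
    then show ?thesis unfolding nrm_diff_eq_0_iff[OF L H_LR[OF v]] .
  qed
  have "\<exists>y\<in>H. nrm (y - (\<lambda>t. \<zeta> *s bshift y t) - v) = 0"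
  proof (rule resolvent_exists[OF Hc_csub bshift_H _ z v])
    show "nrm (bshift y - bshift w) \<le> nrm (y - w)" if "y \<in> H" "w \<in> H" for y w
      using nrm_bshift_le[of "y - w"] that by (simp add: bshift_diff[symmetric] H_LR)
  qed
  then obtain y where y: "y \<in> H" "nrm (y - (\<lambda>t. \<zeta> *s bshift y t) - v) = 0" by blast
  then have yA: "AE t in circle. y t - \<zeta> *s A0_star R n m y t = v t" using iff[OF y(1)] by blast
  have "x \<in> H \<and> (AE t in circle. x t - \<zeta> *s A0_star R n m x t = v t)"
    unfolding x_def resolvent_def by (rule someI[of _ y]) (intro conjI y(1) yA)
  then show x: "x \<in> H" and "nrm (x - (\<lambda>t. \<zeta> *s bshift x t) - v) = 0" using iff[of x] by blast+
qed

text \<open>The output function of the colligation with initial state v. Both a and, up to the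
  factor \<zeta>, b are of this form.\<close>

definition cfun :: "vfun \<Rightarrow> complex \<Rightarrow> complex" where
  "cfun v \<zeta> = LR_inner R (resolvent H (A0_star R n m) \<zeta> v) K"

lemma bshift_pow_H: "v \<in> H \<Longrightarrow> (bshift ^^ j) v \<in> H"
  by (induction j) (auto intro: bshift_H)

text \<open>The energy balance summed over N steps; it makes the Taylor coefficients of
  \<open>cfun\<close> square summable and so puts \<open>cfun\<close> into the Hardy space.\<close>

lemma bshift_pow_sum:
  assumes v: "v \<in> H"
  shows "(nrm ((bshift ^^ N) v))\<^sup>2 + (\<Sum>j<N. (cmod (LR_inner R ((bshift ^^ j) v) K))\<^sup>2) = (nrm v)\<^sup>2"
proof (induction N)
  case (Suc N)
  have "(nrm (bshift ((bshift ^^ N) v)))\<^sup>2 = (nrm ((bshift ^^ N) v))\<^sup>2 - (cmod (LR_inner R ((bshift ^^ N) v) K))\<^sup>2"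
    by (rule nrm_sq_bshift[OF H_LR[OF bshift_pow_H[OF v]]])
  then show ?case using Suc by simp
qed simp

text \<open>The resolvent satisfies its equation only up to a null vector, so the expansion is done
  with scalars: pairing the equation with \<open>K\<close> after j steps gives a recursion whose
  remainder \<zeta>^N b_N tends to 0.\<close>

lemma cfun_sums:
  assumes v: "v \<in> H" and z: "cmod \<zeta> < 1"
  shows "(\<lambda>j. LR_inner R ((bshift ^^ j) v) K * \<zeta> ^ j) sums cfun v \<zeta>"
proof -
  define x where "x = resolvent H (A0_star R n m) \<zeta> v"
  have xH: "x \<in> H" and x0: "nrm (x - (\<lambda>t. \<zeta> *s bshift x t) - v) = 0"
    unfolding x_def by (rule resolvent_A0_star[OF v z])+
  define a where "a j = LR_inner R ((bshift ^^ j) v) K" for j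
  define b where "b j = LR_inner R ((bshift ^^ j) x) K" for j
  have PL: "(bshift ^^ j) y \<in> LR R" if "y \<in> H" for y j by (rule H_LR[OF bshift_pow_H[OF that]])
  have PS: "(bshift ^^ j) (bshift x) = (bshift ^^ Suc j) x" for j by (simp add: funpow_swap1)
  have null: "nrm ((bshift ^^ j) x - (\<lambda>t. \<zeta> *s (bshift ^^ Suc j) x t) - (bshift ^^ j) v) = 0" for j
  proof (induction j)
    case 0
    then show ?case using x0 by (simp add: fun_diff_def)
  next
    case (Suc j)
    have m: "(bshift ^^ j) x \<in> LR R" "(bshift ^^ Suc j) x \<in> LR R" "(bshift ^^ j) v \<in> LR R"
      using PL[OF xH] PL[OF v] by blast+
    have "bshift ((bshift ^^ j) x - (\<lambda>t. \<zeta> *s (bshift ^^ Suc j) x t) - (bshift ^^ j) v) =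
        (bshift ^^ Suc j) x - (\<lambda>t. \<zeta> *s (bshift ^^ Suc (Suc j)) x t) - (bshift ^^ Suc j) v"
      using m by (simp add: bshift_diff bshift_scale)
    moreover have "nrm (bshift ((bshift ^^ j) x - (\<lambda>t. \<zeta> *s (bshift ^^ Suc j) x t) - (bshift ^^ j) v)) \<le> 0"
      by (rule ord_le_eq_trans[OF nrm_bshift_le Suc]) (intro diff_in sc_in m)
    moreover have "0 \<le> nrm (bshift ((bshift ^^ j) x - (\<lambda>t. \<zeta> *s (bshift ^^ Suc j) x t) - (bshift ^^ j) v))"
      using m by (intro nrm_nonneg bshift_in diff_in sc_in)
    ultimately show ?case by (metis order_antisym)
  qed
  have rec: "b j = a j + \<zeta> * b (Suc j)" for j
  proof -
    have m: "(bshift ^^ j) x \<in> LR R" "(bshift ^^ Suc j) x \<in> LR R" "(bshift ^^ j) v \<in> LR R"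
      using PL[OF xH] PL[OF v] by blast+
    have "LR_inner R ((bshift ^^ j) x - (\<lambda>t. \<zeta> *s (bshift ^^ Suc j) x t) - (bshift ^^ j) v) K = 0"
      by (rule ip_eq_0_null[OF _ K_in null]) (use m in \<open>intro diff_in sc_in\<close>)
    then have "b j - \<zeta> * b (Suc j) - a j = 0"
      using m unfolding a_def b_def by (simp only: ip_diff_left ip_sc_left diff_in sc_in K_in)
    then show ?thesis by (simp add: algebra_simps)
  qed
  have part: "(\<Sum>j<N. a j * \<zeta> ^ j) = b 0 - \<zeta> ^ N * b N" for N
  proof (induction N)
    case (Suc N)
    have "\<zeta> ^ N * b N = \<zeta> ^ N * a N + \<zeta> ^ Suc N * b (Suc N)"
      by (subst rec[of N]) (simp add: distrib_left mult_ac)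
    then show ?case using Suc by (simp add: mult_ac)
  qed simp
  have "(\<lambda>N. \<zeta> ^ N * b N) \<longlonglongrightarrow> 0"
  proof (rule Lim_null_comparison)
    have "cmod (b N) \<le> nrm x" for N
    proof -
      have "cmod (b N) \<le> nrm ((bshift ^^ N) x) * nrm K"
        unfolding b_def by (rule Cauchy_Schwarz[OF PL[OF xH] K_in])
      moreover have "(nrm ((bshift ^^ N) x))\<^sup>2 \<le> (nrm x)\<^sup>2"
        using bshift_pow_sum[OF xH, of N] sum_nonneg[of "{..<N}" "\<lambda>j. (cmod (LR_inner R ((bshift ^^ j) x) K))\<^sup>2"] by simp
      then have "nrm ((bshift ^^ N) x) \<le> nrm x" by (rule power2_le_imp_le) (simp add: H_LR xH)
      ultimately show ?thesis by (simp add: nrm_K)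
    qed
    then have "norm (\<zeta> ^ N * b N) \<le> cmod \<zeta> ^ N * nrm x" for N
      by (simp add: norm_mult norm_power mult_left_mono)
    then show "\<forall>\<^sub>F N in sequentially. norm (\<zeta> ^ N * b N) \<le> cmod \<zeta> ^ N * nrm x" by simp
    show "(\<lambda>N. cmod \<zeta> ^ N * nrm x) \<longlonglongrightarrow> 0"
      using tendsto_mult_right[OF LIMSEQ_power_zero[of "cmod \<zeta>"], of "nrm x"] z by simp
  qed
  then have "(\<lambda>N. \<Sum>j<N. a j * \<zeta> ^ j) \<longlonglongrightarrow> b 0 - 0"
    unfolding part by (intro tendsto_intros)
  then show ?thesis by (simp add: sums_def a_def b_def cfun_def x_def)
qed

lemma cfun_H2_disk: "v \<in> H \<Longrightarrow> cfun v \<in> H2_disk"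
proof (rule power_series_H2_disk[OF cfun_sums])
  assume v: "v \<in> H"
  show "(\<Sum>j<N. (cmod (LR_inner R ((bshift ^^ j) v) K))\<^sup>2) \<le> (nrm v)\<^sup>2" for N
    using bshift_pow_sum[OF v, of N] zero_le_power2[of "nrm ((bshift ^^ N) v)"] by linarith
qed

lemma cfun_0: "v \<in> H \<Longrightarrow> cfun v 0 = LR_inner R v K"
  using cfun_sums[of v 0] powser_sums_zero[of "\<lambda>j. LR_inner R ((bshift ^^ j) v) K"] sums_unique2 by fastforce

lemma ac_eq: "ac R n m = cfun (e_plus R n)" and bc_eq: "bc R n m \<zeta> = \<zeta> * cfun Kt \<zeta>"
  by (simp_all add: ac_def bc_def cfun_def fun_eq_iff)

end

section \<open>The feedback coupling of the two colligations\<close>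

context LR_colligation
begin

context
  fixes \<zeta> :: complex
  assumes z: "cmod \<zeta> < 1"
begin

text \<open>In operator form, \<open>U_star\<close> applied to (I - \<zeta>
  \<open>U_star\<close>)^-1 K, since 1 / (t - \<zeta>) = cnj t / (1 - \<zeta> cnj t) on the
  circle.\<close>

definition yK :: vfun where
  "yK = vmult (\<lambda>t. 1 / (t - \<zeta>)) K"

lemma cauchy_factor_LR:
  assumes f: "f \<in> LR R"
  shows "vmult (\<lambda>t. 1 / (t - \<zeta>)) f \<in> LR R"
proof (rule vmult_in_LR[OF f])
  show "(\<lambda>t. 1 / (t - \<zeta>)) \<in> borel_measurable circle"
    using z by (intro borel_measurable_circle_sphere continuous_intros) auto
  show "AE t in circle. cmod (1 / (t - \<zeta>)) \<le> 1 / (1 - cmod \<zeta>)"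
  proof (rule AE_I2)
    fix t assume "t \<in> space circle"
    then have "1 - cmod \<zeta> \<le> cmod (t - \<zeta>)" using norm_triangle_ineq2[of t \<zeta>] by simp
    then show "cmod (1 / (t - \<zeta>)) \<le> 1 / (1 - cmod \<zeta>)"
      using z by (simp add: norm_divide frac_le)
  qed
qed

lemma yK_in [simp]: "yK \<in> LR R"
  unfolding yK_def by (rule cauchy_factor_LR) simp

text \<open>With Z the inverse of I - \<zeta> \<open>U_star\<close>, these are
  <\<open>U_star\<close> Z K, Kt> and <Z K, K>; the latter is expanded as 1 + \<zeta>
  <\<open>U_star\<close> Z K, K> so that both use the vector \<open>yK\<close>.\<close>

definition pz :: complex where "pz = LR_inner R yK Kt"
definition kz :: complex where "kz = 1 + \<zeta> * LR_inner R yK K"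

lemma yK_eq: "AE t in circle. yK t = (shift (-1) K + (\<lambda>t. \<zeta> *s shift (-1) yK t)) t"
proof (rule AE_I2)
  fix t assume "t \<in> space circle"
  then have t: "t \<noteq> 0" "t \<noteq> \<zeta>" using z by auto
  have eq: "1 / (t - \<zeta>) = inverse t + \<zeta> * (inverse t * (1 / (t - \<zeta>)))" using t by (simp add: field_simps)
  have eq': "1 / (t - \<zeta>) * w = inverse t * w + \<zeta> * (inverse t * (1 / (t - \<zeta>) * w))" for w
    using arg_cong[OF eq, of "\<lambda>u. u * w"] by (simp only: distrib_right mult.assoc)
  have "yK t $ i = 1 / (t - \<zeta>) * K t $ i" for i
    by (simp add: yK_def vmult_def)
  moreover have "(shift (-1) K + (\<lambda>t. \<zeta> *s shift (-1) yK t)) t $ i =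
      inverse t * K t $ i + \<zeta> * (inverse t * (1 / (t - \<zeta>) * K t $ i))" for i
    by (simp add: yK_def vmult_def power_int_minus)
  ultimately show "yK t = (shift (-1) K + (\<lambda>t. \<zeta> *s shift (-1) yK t)) t"
    unfolding vec_eq_iff using eq' by metis
qed

lemma inner_yK:
  assumes g: "g \<in> LR R"
  shows "LR_inner R yK g = LR_inner R (shift (-1) K) g + \<zeta> * LR_inner R (shift (-1) yK) g"
proof -
  have "LR_inner R yK g = LR_inner R (shift (-1) K + (\<lambda>t. \<zeta> *s shift (-1) yK t)) g"
    by (rule inner_AE_left[OF yK_in yK_eq g])
  then show ?thesis using g by (simp add: ip_add_left ip_sc_left)
qed

definition yH :: vfun where "yH = LR_proj R H yK"
definition yP :: vfun where "yP = yK - yH"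

lemma yH_H: "yH \<in> H"
  unfolding yH_def by (rule LR_proj_in[OF Hc_csub yK_in])

lemma yH_in [simp]: "yH \<in> LR R" by (rule Hc_LR[OF yH_H])

lemma yP_in [simp]: "yP \<in> LR R" by (simp add: yP_def)

lemma yP_orth: "g \<in> H \<Longrightarrow> LR_inner R yP g = 0"
  unfolding yP_def yH_def by (rule LR_proj_orth[OF Hc_csub yK_in])

lemma inner_yH: "g \<in> H \<Longrightarrow> LR_inner R yH g = LR_inner R yK g"
  using yP_orth[of g] Hc_LR[of g] by (simp add: yP_def ip_diff_left)

lemma yK_split: "yK = yH + yP"
  by (simp add: yP_def)

text \<open>On \<open>H\<close> the adjoint of U differs from \<open>A0_star\<close> by a rank-one
  map: the component along \<open>K\<close> is sent to the image of \<open>K\<close>.\<close>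

lemma bshift_yH:
  assumes g: "g \<in> LR R"
  shows "LR_inner R (shift (-1) yH) g = LR_inner R (bshift yH) g + LR_inner R yK K * LR_inner R (shift (-1) K) g"
proof -
  have "shift (-1) yH = bshift yH + (\<lambda>t. LR_inner R yH K *s shift (-1) K t)"
    by (simp add: bshift_def dK_def shift_diff shift_scale)
  then show ?thesis
    using g inner_yH[OF K_H] by (simp add: ip_add_left ip_sc_left)
qed

lemma null_contraction:
  assumes d: "d \<in> LR R" and eq: "nrm (d - (\<lambda>t. \<zeta> *s bshift d t)) = 0"
  shows "nrm d = 0"
proof -
  have B: "(\<lambda>t. \<zeta> *s bshift d t) \<in> LR R" using d by simp
  have "nrm d = nrm (\<lambda>t. \<zeta> *s bshift d t)" by (rule nrm_cong[OF d B eq])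
  also have "\<dots> = cmod \<zeta> * nrm (bshift d)" using d by (simp add: nrm_sc)
  also have "\<dots> \<le> cmod \<zeta> * nrm d" using d by (intro mult_left_mono nrm_bshift_le) auto
  finally have "(1 - cmod \<zeta>) * nrm d \<le> 0" by (simp add: algebra_simps)
  then have "nrm d \<le> 0" using z by (simp add: mult_le_0_iff)
  then show ?thesis using nrm_nonneg[OF d] by linarith
qed

text \<open>Inner channel. The vector w = (I - \<zeta> \<open>A0_star\<close>) \<open>yH\<close> is
  orthogonal to \<open>H2\<close>, hence a multiple of \<open>Kt\<close>, and the factor is
  \<open>pz\<close>. So \<open>yH\<close> is \<open>pz\<close> times the resolvent vector that
  defines b, and pairing with \<open>K\<close> gives the relation.\<close>

lemma kz_bc: "kz = 1 + pz * bc R n m \<zeta>"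
proof -
  define x where "x = resolvent H (A0_star R n m) \<zeta> Kt"
  have xH: "x \<in> H" and x0: "nrm (x - (\<lambda>t. \<zeta> *s bshift x t) - Kt) = 0"
    unfolding x_def by (rule resolvent_A0_star[OF Kt_H z])+
  note xL = Hc_LR[OF xH]
  define w where "w = yH - (\<lambda>t. \<zeta> *s bshift yH t)"
  have wH: "w \<in> H" unfolding w_def by (intro csub_diff[OF Hc_csub] csub_sc[OF Hc_csub] yH_H bshift_H)
  note wL = Hc_LR[OF wH]
  have worth: "LR_inner R w g = 0" if g: "g \<in> H2" for g
  proof -
    note gL = Hc_LR[OF g]
    have sg: "shift 1 g \<in> H1" by (rule shift_H2[OF g])
    have s1: "LR_inner R (shift (-1) f) g = LR_inner R f (shift 1 g)" if "f \<in> LR R" for f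
      using inner_shift_left[OF that gL, of "-1"] by simp
    \<comment> \<open>U g lies in \<open>H1\<close>, which is orthogonal to \<open>K\<close> and
      contained in \<open>H\<close>; the inhomogeneous term drops out and \<open>yK\<close> may be
      replaced by \<open>yH\<close>.\<close>
    have "LR_inner R yH g = \<zeta> * LR_inner R yH (shift 1 g)"
      using inner_yK[OF gL] K_orth[OF sg] inner_yH[OF Hc_mono2[OF g]] inner_yH[OF Hc_mono1[OF sg]]
      by (simp add: s1)
    moreover have "LR_inner R (bshift yH) g = LR_inner R yH (shift 1 g)"
      using bshift_yH[OF gL] K_orth[OF sg] by (simp add: s1)
    ultimately show ?thesis using gL by (simp add: w_def ip_diff_left ip_sc_left)
  qed
  have "LR_inner R w Kt = pz"
    using inner_yH[OF Kt_H] Kt_orth'[OF bshift_H2[OF yH_H]] by (simp add: w_def ip_diff_left ip_sc_left pz_def)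
  then have wKt: "nrm (w - (\<lambda>t. pz *s Kt t)) = 0"
  proof (intro defect_tilde_zero)
    show "w - (\<lambda>t. pz *s Kt t) \<in> H" by (intro csub_diff[OF Hc_csub] csub_sc[OF Hc_csub] wH Kt_H)
    show "LR_inner R (w - (\<lambda>t. pz *s Kt t)) g = 0" if "g \<in> H2" for g
      using worth[OF that] Kt_orth[OF that] wL Hc_LR[OF that] by (simp add: ip_diff_left ip_sc_left)
    show "LR_inner R (w - (\<lambda>t. pz *s Kt t)) Kt = 0" if "LR_inner R w Kt = pz"
      using that wL by (simp add: ip_diff_left ip_sc_left Kt_Kt)
  qed
  define d where "d = yH - (\<lambda>t. pz *s x t)"
  have dL: "d \<in> LR R" using xL by (simp add: d_def)
  define u where "u = x - (\<lambda>t. \<zeta> *s bshift x t) - Kt"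
  have uL: "u \<in> LR R" using xL by (simp add: u_def)
  have "d - (\<lambda>t. \<zeta> *s bshift d t) = (w - (\<lambda>t. pz *s Kt t)) - (\<lambda>t. pz *s u t)"
    using xL by (intro ext vector2_eqI) (simp_all add: d_def w_def u_def bshift_diff bshift_scale algebra_simps)
  moreover have "nrm ((w - (\<lambda>t. pz *s Kt t)) - (\<lambda>t. pz *s u t)) = 0"
  proof -
    have "nrm ((w - (\<lambda>t. pz *s Kt t)) - (\<lambda>t. pz *s u t)) \<le> nrm (w - (\<lambda>t. pz *s Kt t)) + nrm (- (\<lambda>t. pz *s u t))"
      using nrm_triangle[of "w - (\<lambda>t. pz *s Kt t)" "- (\<lambda>t. pz *s u t)"] wL uL by simp
    also have "\<dots> = 0"
    proof -
      have "nrm u = 0" unfolding u_def by (rule x0)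
      then show ?thesis using wKt uL by (simp add: nrm_sc)
    qed
    finally have le: "nrm ((w - (\<lambda>t. pz *s Kt t)) - (\<lambda>t. pz *s u t)) \<le> 0" .
    have "0 \<le> nrm ((w - (\<lambda>t. pz *s Kt t)) - (\<lambda>t. pz *s u t))"
      by (intro nrm_nonneg diff_in sc_in wL uL Kt_in)
    then show ?thesis by (rule antisym[OF le])
  qed
  ultimately have "nrm d = 0" using null_contraction[OF dL] by simp
  then have "LR_inner R d K = 0" using ip_eq_0_null[OF dL K_in] by simp
  then have "LR_inner R yK K = pz * LR_inner R x K"
    using xL inner_yH[OF K_H] by (simp add: d_def ip_diff_left ip_sc_left)
  then show ?thesis by (simp add: kz_def bc_def x_def mult_ac)
qed

lemma H_perp_eq: "H_perp R n m = {f \<in> LR R. \<forall>g\<in>H. LR_inner R f g = 0}"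
  by (simp add: H_perp_def LR_ominus_def)

lemma H_perp_csub: "closed_subspace (H_perp R n m)"
  unfolding H_perp_eq by (rule closed_subspace_orthogonal) (auto intro: Hc_LR)

lemma H_perp_LR: "f \<in> H_perp R n m \<Longrightarrow> f \<in> LR R"
  by (simp add: H_perp_eq)

lemma H_perp_orth: "f \<in> H_perp R n m \<Longrightarrow> g \<in> H \<Longrightarrow> LR_inner R g f = 0"
  using ip_cnj[of f g] Hc_LR[of g n m] by (auto simp: H_perp_eq)

lemma inner_proj_perp:
  assumes f: "f \<in> LR R" and g: "g \<in> H_perp R n m"
  shows "LR_inner R (LR_proj R (H_perp R n m) f) g = LR_inner R f g"
  using LR_proj_orth[OF H_perp_csub f g] f H_perp_LR[OF g] H_perp_LR[OF LR_proj_in[OF H_perp_csub f]]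
  by (simp add: ip_diff_left)

lemma inner_U_star: "f \<in> LR R \<Longrightarrow> g \<in> LR R \<Longrightarrow> LR_inner R (U_star R f) g = LR_inner R (shift (-1) f) g"
  by (intro inner_AE_left U_star_AE)

text \<open>Outer channel. Projected to the complement of \<open>H\<close>, the equation for
  \<open>yK\<close> says that \<open>yP\<close> solves the equation of the resolvent vector x in
  \<omega> with right-hand side multiplied by \<open>kz\<close>, because \<open>yH\<close> feeds the
  complement only through its component along \<open>K\<close>. Hence \<open>yP\<close> is
  \<open>kz\<close> times x.\<close>

lemma pz_omegac: "pz = kz * omegac R n m \<zeta>"
proof -
  let ?P = "H_perp R n m"
  define v where "v = LR_proj R ?P (U_star R K)"
  note UL = U_star_AE(1)
  have vP: "v \<in> ?P" unfolding v_def by (rule LR_proj_in[OF H_perp_csub UL[OF K_in]])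
  have AP: "A_perp R n m f \<in> ?P" if "f \<in> ?P" for f
    unfolding A_perp_def by (rule LR_proj_in[OF H_perp_csub UL[OF H_perp_LR[OF that]]])
  define x where "x = resolvent ?P (A_perp R n m) \<zeta> v"
  have iff: "(AE t in circle. y t - \<zeta> *s A_perp R n m y t = v t) \<longleftrightarrow> nrm (y - (\<lambda>t. \<zeta> *s A_perp R n m y t) - v) = 0"
    if y: "y \<in> ?P" for y
  proof -
    have L: "y - (\<lambda>t. \<zeta> *s A_perp R n m y t) \<in> LR R" using H_perp_LR[OF y] H_perp_LR[OF AP[OF y]] by simp
    show ?thesis using nrm_diff_eq_0_iff[OF L H_perp_LR[OF vP]] by simp
  qed
  have "\<exists>y\<in>?P. nrm (y - (\<lambda>t. \<zeta> *s A_perp R n m y t) - v) = 0"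
  proof (rule resolvent_exists[OF H_perp_csub AP _ z vP])
    fix f g assume f: "f \<in> ?P" and g: "g \<in> ?P"
    note fL = H_perp_LR[OF f] and gL = H_perp_LR[OF g]
    have "nrm (A_perp R n m f - A_perp R n m g) \<le> nrm (U_star R f - U_star R g)"
    proof (rule orthogonal_proj_lipschitz[OF H_perp_csub UL[OF fL] UL[OF gL] AP[OF f] AP[OF g]])
      show "LR_inner R (U_star R f - A_perp R n m f) h = 0" if "h \<in> ?P" for h
        unfolding A_perp_def by (rule LR_proj_orth[OF H_perp_csub UL[OF fL] that])
      show "LR_inner R (U_star R g - A_perp R n m g) h = 0" if "h \<in> ?P" for h
        unfolding A_perp_def by (rule LR_proj_orth[OF H_perp_csub UL[OF gL] that])
    qed
    also have "\<dots> = nrm (shift (-1) (f - g))"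
    proof (rule nrm_cong)
      have "AE t in circle. (U_star R f - U_star R g) t = shift (-1) (f - g) t"
        using U_star_AE(2)[OF fL] U_star_AE(2)[OF gL] by eventually_elim (simp add: shift_diff)
      then show "nrm (U_star R f - U_star R g - shift (-1) (f - g)) = 0"
        using nrm_diff_eq_0_iff[of "U_star R f - U_star R g" "shift (-1) (f - g)"] UL[OF fL] UL[OF gL] fL gL by simp
    qed (use UL[OF fL] UL[OF gL] fL gL in auto)
    also have "\<dots> = nrm (f - g)" using fL gL by (simp add: nrm_shift)
    finally show "nrm (A_perp R n m f - A_perp R n m g) \<le> nrm (f - g)" .
  qed
  then obtain y where y: "y \<in> ?P" "nrm (y - (\<lambda>t. \<zeta> *s A_perp R n m y t) - v) = 0" by blast
  then have yA: "AE t in circle. y t - \<zeta> *s A_perp R n m y t = v t" using iff[OF y(1)] by blast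
  have "x \<in> ?P \<and> (AE t in circle. x t - \<zeta> *s A_perp R n m x t = v t)"
    unfolding x_def resolvent_def by (rule someI[of _ y]) (intro conjI y(1) yA)
  then have xP: "x \<in> ?P" and x0: "nrm (x - (\<lambda>t. \<zeta> *s A_perp R n m x t) - v) = 0" using iff[of x] by blast+
  note xL = H_perp_LR[OF xP]
  have inner_x: "LR_inner R x g = LR_inner R (shift (-1) K) g + \<zeta> * LR_inner R (shift (-1) x) g" if g: "g \<in> ?P" for g
  proof -
    note gL = H_perp_LR[OF g]
    have "LR_inner R (x - (\<lambda>t. \<zeta> *s A_perp R n m x t) - v) g = 0"
      by (rule ip_eq_0_null[OF _ gL x0]) (use xL H_perp_LR[OF vP] H_perp_LR[OF AP[OF xP]] in auto)
    then have "LR_inner R x g - \<zeta> * LR_inner R (A_perp R n m x) g - LR_inner R v g = 0"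
      using xL gL H_perp_LR[OF vP] H_perp_LR[OF AP[OF xP]] by (simp only: ip_diff_left ip_sc_left diff_in sc_in)
    then have "LR_inner R x g = LR_inner R v g + \<zeta> * LR_inner R (A_perp R n m x) g"
      by (simp add: algebra_simps)
    also have "LR_inner R v g = LR_inner R (shift (-1) K) g"
      using inner_proj_perp[OF UL[OF K_in] g] inner_U_star[OF K_in gL] by (simp add: v_def)
    also have "LR_inner R (A_perp R n m x) g = LR_inner R (shift (-1) x) g"
      using inner_proj_perp[OF UL[OF xL] g] inner_U_star[OF xL gL] by (simp add: A_perp_def)
    finally show ?thesis .
  qed
  have yPP: "yP \<in> ?P" by (simp add: H_perp_eq yP_orth)
  have inner_y: "LR_inner R yP g = kz * LR_inner R (shift (-1) K) g + \<zeta> * LR_inner R (shift (-1) yP) g" if g: "g \<in> ?P" for g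
  proof -
    note gL = H_perp_LR[OF g]
    have "LR_inner R (shift (-1) yK) g = LR_inner R (shift (-1) yH) g + LR_inner R (shift (-1) yP) g"
      using gL by (subst yK_split) (simp add: shift_add ip_add_left)
    moreover have "LR_inner R (bshift yH) g = 0" by (rule H_perp_orth[OF g bshift_H[OF yH_H]])
    moreover have "LR_inner R yP g = LR_inner R yK g"
      using H_perp_orth[OF g yH_H] gL by (simp add: yP_def ip_diff_left)
    ultimately show ?thesis
      using inner_yK[OF gL] bshift_yH[OF gL] by (simp add: kz_def algebra_simps)
  qed
  define d where "d = yP - (\<lambda>t. kz *s x t)"
  have dP: "d \<in> ?P" unfolding d_def by (intro csub_diff[OF H_perp_csub] csub_sc[OF H_perp_csub] yPP xP)
  note dL = H_perp_LR[OF dP]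
  \<comment> \<open>Both equations hold only in pairings with vectors of the complement; the
    difference d itself as test vector gives (nrm d)^2 <= |\<zeta>| (nrm d)^2, so d is null.\<close>
  have "LR_inner R d d = \<zeta> * LR_inner R (shift (-1) d) d"
  proof -
    have E1: "LR_inner R (shift (-1) d) d = LR_inner R (shift (-1) yP) d - kz * LR_inner R (shift (-1) x) d"
      using dL xL by (subst (1) d_def) (simp add: shift_diff shift_scale ip_diff_left ip_sc_left)
    have E2: "LR_inner R d d = LR_inner R yP d - kz * LR_inner R x d"
      using dL xL by (subst (1) d_def) (simp add: ip_diff_left ip_sc_left)
    show ?thesis unfolding E1 unfolding E2 inner_y[OF dP] inner_x[OF dP] by (simp add: algebra_simps)
  qed
  then have "cmod (complex_of_real ((nrm d)\<^sup>2)) = cmod \<zeta> * cmod (LR_inner R (shift (-1) d) d)"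
    unfolding ip_self[OF dL, symmetric] by (simp add: norm_mult)
  also have "\<dots> \<le> cmod \<zeta> * (nrm d * nrm d)"
    using Cauchy_Schwarz[OF shift_in[OF dL, of "-1"] dL] dL by (intro mult_left_mono) (auto simp: nrm_shift)
  finally have "(1 - cmod \<zeta>) * (nrm d)\<^sup>2 \<le> 0" unfolding norm_of_real by (simp add: algebra_simps power2_eq_square)
  then have "nrm d = 0" using z by (simp add: mult_le_0_iff)
  then have "nrm (shift (-1) d) = 0" using dL by (simp add: nrm_shift)
  then have "LR_inner R (shift (-1) d) Kt = 0" using ip_eq_0_null[OF shift_in[OF dL] Kt_in] by blast
  then have s: "LR_inner R (shift (-1) yP) Kt = kz * LR_inner R (shift (-1) x) Kt"
    using xL by (simp add: d_def shift_diff shift_scale ip_diff_left ip_sc_left)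
  have "LR_inner R (shift (-1) yK) Kt = LR_inner R (shift (-1) yH) Kt + LR_inner R (shift (-1) yP) Kt"
    by (subst yK_split) (simp add: shift_add ip_add_left)
  \<comment> \<open>In the pairing with \<open>Kt\<close> the term \<open>bshift yH\<close>
    vanishes, because it lies in \<open>H2\<close>.\<close>
  then have "pz = kz * (LR_inner R (shift (-1) K) Kt + \<zeta> * LR_inner R (shift (-1) x) Kt)"
    using inner_yK[OF Kt_in] bshift_yH[OF Kt_in] Kt_orth'[OF bshift_H2[OF yH_H]] s
    by (simp add: pz_def kz_def algebra_simps)
  moreover have "omegac R n m \<zeta> = LR_inner R (shift (-1) K) Kt + \<zeta> * LR_inner R (shift (-1) x) Kt"
    unfolding omegac_def x_def[unfolded v_def, symmetric] v_def[symmetric] x_def[symmetric]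
    by (simp add: inner_U_star xL)
  ultimately show ?thesis by simp
qed

end

end

section \<open>Boundary values\<close>

context LR_colligation
begin

definition phi :: "complex \<Rightarrow> complex" where
  "phi t = t powi n * cnj (K t $ 1)"

text \<open>Read off from the first entry of \<open>Kt\<close>; the reflection shows that it equals
  t^m times the second entry of \<open>K\<close>. In this form its Cauchy integral is a pairing with
  a multiple of \<open>e_plus\<close>.\<close>

definition psi :: "complex \<Rightarrow> complex" where
  "psi t = t powi (n - 1) * cnj (Kt t $ 1)"

lemma phi_L2: "phi \<in> L2" and psi_L2: "psi \<in> L2"
  unfolding phi_def psi_def by (intro L2_powi L2_cnj LR_nth1 K_in Kt_in)+

lemma phi_H2_plus: "phi \<in> H2_plus"
proof -
  have "(\<lambda>t. t powi (- (n + 1)) * K t $ 1) \<in> H2_minus"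
    using Hc_perp_iff[OF K_in, of "n + 1" m] K_orth by blast
  then show ?thesis
  proof (rule H2_plus_cong_AE[OF cnj_mult_t_H2_plus])
    show "AE t in circle. cnj (t * (t powi (- (n + 1)) * K t $ 1)) = phi t"
    proof (rule AE_I2)
      fix t assume "t \<in> space circle"
      then have t: "norm t = 1" by simp
      have "t * (t powi (- (n + 1)) * w) = t powi (- n) * w" for w
        using t by (simp add: mult.assoc[symmetric] mult_powi)
      then show "cnj (t * (t powi (- (n + 1)) * K t $ 1)) = phi t"
        by (simp only: phi_def complex_cnj_mult cnj_powi[OF t] minus_minus)
    qed
  qed (rule L2_measurable[OF phi_L2])
qed

lemma psi_H2_plus: "psi \<in> H2_plus"
proof -
  have "(\<lambda>t. t powi (- n) * Kt t $ 1) \<in> H2_minus"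
    using Hc_perp_iff[OF Kt_in, of n "m + 1"] Kt_orth by blast
  then show ?thesis
  proof (rule H2_plus_cong_AE[OF cnj_mult_t_H2_plus])
    show "AE t in circle. cnj (t * (t powi (- n) * Kt t $ 1)) = psi t"
    proof (rule AE_I2)
      fix t assume "t \<in> space circle"
      then have t: "norm t = 1" by simp
      have "1 + - n = - (n - 1)" by simp
      then have "t * (t powi (- n) * w) = t powi (- (n - 1)) * w" for w
        using t by (simp only: mult.assoc[symmetric] mult_powi)
      then show "cnj (t * (t powi (- n) * Kt t $ 1)) = psi t"
        by (simp only: psi_def complex_cnj_mult cnj_powi[OF t] minus_minus)
    qed
  qed (rule L2_measurable[OF psi_L2])
qed

text \<open>\<open>e_plus\<close> is the weight applied to (t^n, 0), so only the first entry of g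
  survives. With a Cauchy kernel for c this turns Cauchy integrals into inner products.\<close>

lemma inner_vmult_e_plus:
  assumes g: "g \<in> LR R" and c: "c \<in> L2" and ce: "(\<lambda>t. c t * t powi n) \<in> L2"
  shows "LR_inner R (vmult c (e_plus R n)) g = (\<integral>t. t powi n * cnj (g t $ 1) * c t \<partial>circle)"
proof -
  let ?u = "\<lambda>t. c t * t powi n"
  have eq: "vmult c (e_plus R n) = wvec ?u (\<lambda>t. 0)"
    by (simp add: vmult_def e_plus_def fun_eq_iff vec_eq_iff forall_2)
  have "LR_inner R (wvec ?u (\<lambda>t. 0)) g = cnj (LR_inner R g (wvec ?u (\<lambda>t. 0)))"
    by (rule ip_cnj[OF g wvec_in[OF ce L2_const]])
  also have "LR_inner R g (wvec ?u (\<lambda>t. 0)) = L2_inner (\<lambda>t. g t $ 1) ?u"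
    using inner_wvec[OF g ce L2_const[of 0]] by (simp add: L2_inner_def)
  also have "cnj \<dots> = (\<integral>t. t powi n * cnj (g t $ 1) * c t \<partial>circle)"
    unfolding L2_inner_def Bochner_Integration.integral_cnj[symmetric] by (simp add: mult_ac)
  finally show ?thesis by (simp only: eq)
qed

section \<open>Cauchy integrals of phi and psi in terms of the colligations\<close>

context
  fixes \<zeta> :: complex
  assumes z: "cmod \<zeta> < 1"
begin

lemma cauchy_factor_L2: "(\<lambda>t. 1 / (t - \<zeta>)) \<in> L2" "(\<lambda>t. t / (t - \<zeta>)) \<in> L2"
  "(\<lambda>t. 1 / (t - \<zeta>) * t powi n) \<in> L2" "(\<lambda>t. t / (t - \<zeta>) * t powi n) \<in> L2"
  using z by (intro L2_sphere continuous_intros; force)+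

definition xe :: vfun where
  "xe = resolvent H (A0_star R n m) \<zeta> (e_plus R n)"

lemma xe_H: "xe \<in> H" and xe_eq: "nrm (xe - (\<lambda>t. \<zeta> *s bshift xe t) - e_plus R n) = 0"
  unfolding xe_def by (rule resolvent_A0_star[OF e_plus_Hc z])+

lemma xe_in [simp]: "xe \<in> LR R" by (rule H_LR[OF xe_H])

lemma inner_xe: "LR_inner R xe K = ac R n m \<zeta>"
  by (simp add: ac_def xe_def)

text \<open>Resolvent identity for a rank-one perturbation: on \<open>H\<close> the adjoint of U is
  \<open>A0_star\<close> plus the map that sends the component along \<open>K\<close> to the image
  of \<open>K\<close>. Hence the resolvent of the full adjoint at \<open>e_plus\<close> is
  \<open>xe\<close> corrected by \<zeta> <xe, K> \<open>yK\<close>, and <xe, K> is a.\<close>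

lemma vmult_e_plus_AE:
  "AE t in circle. vmult (\<lambda>t. t / (t - \<zeta>)) (e_plus R n) t = (xe + (\<lambda>t. (\<zeta> * ac R n m \<zeta>) *s yK \<zeta> t)) t"
proof -
  have "AE t in circle. (xe - (\<lambda>t. \<zeta> *s bshift xe t)) t = e_plus R n t"
    using xe_eq nrm_diff_eq_0_iff[of "xe - (\<lambda>t. \<zeta> *s bshift xe t)" "e_plus R n"] by simp
  then show ?thesis using AE_circle_norm
  proof eventually_elim
    case (elim t)
    have t: "t \<noteq> 0" "t \<noteq> \<zeta>" "t - \<zeta> \<noteq> 0" using elim(2) z by auto
    have e: "e_plus R n t $ i = xe t $ i - \<zeta> * (inverse t * (xe t $ i - ac R n m \<zeta> * K t $ i))" for i
      using arg_cong[OF elim(1), of "\<lambda>v. v $ i"]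
      by (simp add: bshift_def dK_def inner_xe power_int_minus)
    have "t / (t - \<zeta>) * (x - \<zeta> * (inverse t * (x - a * k))) = x + \<zeta> * a * (1 / (t - \<zeta>) * k)" for x a k
      using t by (simp add: field_simps)
    then show ?case
      by (simp add: vec_eq_iff vmult_def yK_def[OF z] e del: times_divide_eq_left times_divide_eq_right mult_1_left)
  qed
qed

lemma cauchy_int_phi: "cauchy_int phi \<zeta> = ac R n m \<zeta> * kz \<zeta>"
proof -
  have "cauchy_int phi \<zeta> = LR_inner R (vmult (\<lambda>t. t / (t - \<zeta>)) (e_plus R n)) K"
    unfolding inner_vmult_e_plus[OF K_in cauchy_factor_L2(2,4)] cauchy_int_def phi_def ..
  also have "\<dots> = LR_inner R (xe + (\<lambda>t. (\<zeta> * ac R n m \<zeta>) *s yK \<zeta> t)) K"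
  proof (rule inner_AE_left[symmetric, OF _ _ K_in])
    show "AE t in circle. (xe + (\<lambda>t. (\<zeta> * ac R n m \<zeta>) *s yK \<zeta> t)) t = vmult (\<lambda>t. t / (t - \<zeta>)) (e_plus R n) t"
      using vmult_e_plus_AE by eventually_elim simp
  qed (use yK_in[OF z] in simp)
  also have "\<dots> = ac R n m \<zeta> * kz \<zeta>"
    using yK_in[OF z] by (simp add: ip_add_left ip_sc_left inner_xe kz_def[OF z] algebra_simps)
  finally show ?thesis .
qed

text \<open>The exponent n - 1 cancels the t in the Cauchy kernel, so one further adjoint of U acts
  before pairing with \<open>Kt\<close>. The term \<open>bshift xe\<close> lies in \<open>H2\<close>
  and drops out.\<close>

lemma cauchy_int_psi: "cauchy_int psi \<zeta> = ac R n m \<zeta> * pz \<zeta>"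
proof -
  let ?f = "xe + (\<lambda>t. (\<zeta> * ac R n m \<zeta>) *s yK \<zeta> t)"
  note yL = yK_in[OF z]
  have "cauchy_int psi \<zeta> = (\<integral>t. t powi n * cnj (Kt t $ 1) * (1 / (t - \<zeta>)) \<partial>circle)"
    unfolding cauchy_int_def
  proof (intro Bochner_Integration.integral_cong refl)
    fix t assume "t \<in> space circle"
    then have t: "norm t = 1" by simp
    have "t powi (n - 1) * t = t powi n" using powi_mult_powi[OF t, of "n - 1" 1] by simp
    then have "t powi (n - 1) * w * (t / d) = t powi n * w * (1 / d)" for w d
      by (metis mult.assoc mult.commute times_divide_eq_right mult.right_neutral)
    then show "psi t * (t / (t - \<zeta>)) = t powi n * cnj (Kt t $ 1) * (1 / (t - \<zeta>))"
      by (simp only: psi_def)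
  qed
  also have "\<dots> = LR_inner R (vmult (\<lambda>t. 1 / (t - \<zeta>)) (e_plus R n)) Kt"
    by (rule inner_vmult_e_plus[OF Kt_in cauchy_factor_L2(1,3), symmetric])
  also have "\<dots> = LR_inner R (shift (-1) ?f) Kt"
  proof (rule inner_AE_left[symmetric, OF _ _ Kt_in])
    show "AE t in circle. shift (-1) ?f t = vmult (\<lambda>t. 1 / (t - \<zeta>)) (e_plus R n) t"
      using vmult_e_plus_AE AE_circle_norm
    proof eventually_elim
      case (elim t)
      have t: "t \<noteq> 0" using elim(2) by auto
      have "shift (-1) ?f t $ i = inverse t * (?f t $ i)" for i
        by (simp only: shift_nth power_int_minus power_int_1_right)
      also have "inverse t * (?f t $ i) = inverse t * (t / (t - \<zeta>) * e_plus R n t $ i)" for i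
        unfolding elim(1)[symmetric] by (simp add: vmult_def)
      also have "inverse t * (t / (t - \<zeta>) * e_plus R n t $ i) = vmult (\<lambda>t. 1 / (t - \<zeta>)) (e_plus R n) t $ i" for i
        using t by (simp add: vmult_def)
      finally have "shift (-1) ?f t $ i = vmult (\<lambda>t. 1 / (t - \<zeta>)) (e_plus R n) t $ i" for i .
      then show ?case by (intro vector2_eqI)
    qed
  qed (use yL in simp)
  also have "\<dots> = LR_inner R (shift (-1) xe) Kt + \<zeta> * ac R n m \<zeta> * LR_inner R (shift (-1) (yK \<zeta>)) Kt"
    using yL by (simp add: shift_add shift_scale ip_add_left ip_sc_left)
  also have "LR_inner R (shift (-1) xe) Kt = ac R n m \<zeta> * LR_inner R (shift (-1) K) Kt"
  proof -
    have "shift (-1) xe = bshift xe + (\<lambda>t. ac R n m \<zeta> *s shift (-1) K t)"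
      by (simp add: bshift_def dK_def shift_diff shift_scale inner_xe)
    then show ?thesis using Kt_orth'[OF bshift_H2[OF xe_H]] by (simp add: ip_add_left ip_sc_left)
  qed
  finally show ?thesis using inner_yK[OF z Kt_in] by (simp add: pz_def[OF z] algebra_simps)
qed

lemma cauchy_int_psi_omegac: "cauchy_int psi \<zeta> = cauchy_int phi \<zeta> * omegac R n m \<zeta>"
  unfolding cauchy_int_psi cauchy_int_phi using pz_omegac[OF z] by simp

lemma cauchy_int_phi_ac: "cauchy_int phi \<zeta> - cauchy_int psi \<zeta> * bc R n m \<zeta> = ac R n m \<zeta>"
  unfolding cauchy_int_psi cauchy_int_phi using kz_bc[OF z] by (simp add: algebra_simps)

end

lemma ac_0: "ac R n m 0 \<noteq> 0"
  unfolding ac_eq cfun_0[OF e_plus_Hc] by (rule e_plus_K)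

text \<open>Its mean is the Cauchy integral at 0, which is a(0) because \<open>kz\<close> is 1
  there.\<close>

lemma phi_nonzero: "AE t in circle. phi t \<noteq> 0"
proof (rule H2_plus_nonzero_AE[OF phi_H2_plus])
  have "(\<integral>t. phi t \<partial>circle) = cauchy_int phi 0"
    unfolding cauchy_int_def by (intro Bochner_Integration.integral_cong) auto
  then show "(\<integral>t. phi t \<partial>circle) \<noteq> 0"
    using ac_0 by (simp add: cauchy_int_phi kz_def)
qed

lemma eventually_radius_circle:
  assumes "norm t = 1" "\<And>z. cmod z < 1 \<Longrightarrow> P z"
  shows "\<forall>\<^sub>F r in at_left (1::real). P (of_real r * t)"
  using eventually_at_left_real[of 0 1]
  by (rule eventually_mono) (use assms in \<open>auto simp: norm_mult\<close>)

text \<open>Off a null set the radial limits of a, of b and of the two Cauchy integrals exist;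
  \<open>bval\<close> is computed from them by uniqueness of limits, with \<omega> as a quotient,
  and the two disk relations pass to the boundary.\<close>

theorem boundary_relations:
  defines "a \<equiv> bval (ac R n m)" and "b \<equiv> bval (bc R n m)" and "\<omega> \<equiv> bval (omegac R n m)"
  shows "AE t in circle. phi t = a t / (1 - b t * \<omega> t) \<and> psi t = a t * \<omega> t / (1 - b t * \<omega> t)"
proof -
  obtain \<alpha> where \<alpha>: "\<alpha> \<in> H2_plus" "(\<integral>t. \<alpha> t \<partial>circle) = ac R n m 0"
    "AE t in circle. ((\<lambda>r::real. ac R n m (of_real r * t)) \<longlongrightarrow> \<alpha> t) (at_left 1)"
    unfolding ac_eq by (rule H2_disk_radial_limit[OF cfun_H2_disk[OF e_plus_Hc]])
  have \<alpha>0: "AE t in circle. \<alpha> t \<noteq> 0"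
    using ac_0 by (intro H2_plus_nonzero_AE \<alpha>(1)) (simp add: \<alpha>(2))
  obtain \<beta> where \<beta>: "AE t in circle. ((\<lambda>r::real. cfun Kt (of_real r * t)) \<longlongrightarrow> \<beta> t) (at_left 1)"
    by (rule H2_disk_radial_limit[OF cfun_H2_disk[OF Kt_H]])
  have nt: "at_left (1::real) \<noteq> bot" by simp
  show ?thesis
    using \<alpha>(3) \<alpha>0 \<beta> phi_nonzero AE_circle_norm
      H2_plus_cauchy_tendsto[OF phi_H2_plus] H2_plus_cauchy_tendsto[OF psi_H2_plus]
  proof eventually_elim
    case (elim t)
    note lim_a = elim(1) and lim_phi = elim(6) and lim_psi = elim(7)
    have "((\<lambda>r::real. (of_real r * t) * cfun Kt (of_real r * t)) \<longlongrightarrow> (of_real 1 * t) * \<beta> t) (at_left 1)"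
      by (intro tendsto_intros elim(3))
    then have lim_b: "((\<lambda>r::real. bc R n m (of_real r * t)) \<longlongrightarrow> t * \<beta> t) (at_left 1)"
      by (simp add: bc_eq)
    have lim_q: "((\<lambda>r::real. cauchy_int psi (of_real r * t) / cauchy_int phi (of_real r * t)) \<longlongrightarrow> psi t / phi t) (at_left 1)"
      by (intro tendsto_divide lim_phi lim_psi elim(4))
    have "\<forall>\<^sub>F r in at_left (1::real). cauchy_int phi (of_real r * t) \<noteq> 0"
      by (rule tendsto_imp_eventually_ne[OF lim_phi elim(4)])
    moreover have "\<forall>\<^sub>F r in at_left (1::real). cauchy_int psi (of_real r * t) =
        cauchy_int phi (of_real r * t) * omegac R n m (of_real r * t)"
      by (rule eventually_radius_circle[OF elim(5) cauchy_int_psi_omegac])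
    ultimately have ev: "\<forall>\<^sub>F r in at_left (1::real). cauchy_int psi (of_real r * t) / cauchy_int phi (of_real r * t) = omegac R n m (of_real r * t)"
      by eventually_elim simp
    have lim_w: "((\<lambda>r::real. omegac R n m (of_real r * t)) \<longlongrightarrow> psi t / phi t) (at_left 1)"
      by (rule Lim_transform_eventually[OF lim_q ev])
    have A: "a t = \<alpha> t" and B: "b t = t * \<beta> t" and W: "\<omega> t = psi t / phi t"
      unfolding a_def b_def \<omega>_def bval_def by (rule tendsto_Lim[OF nt] lim_a lim_b lim_w)+
    have "((\<lambda>r::real. cauchy_int phi (of_real r * t) - cauchy_int psi (of_real r * t) * bc R n m (of_real r * t))
        \<longlongrightarrow> phi t - psi t * (t * \<beta> t)) (at_left 1)"
      by (intro tendsto_intros lim_phi lim_psi lim_b)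
    moreover have "\<forall>\<^sub>F r in at_left (1::real). cauchy_int phi (of_real r * t) - cauchy_int psi (of_real r * t) * bc R n m (of_real r * t)
        = ac R n m (of_real r * t)"
      by (rule eventually_radius_circle[OF elim(5) cauchy_int_phi_ac])
    ultimately have "((\<lambda>r::real. ac R n m (of_real r * t)) \<longlongrightarrow> phi t - psi t * (t * \<beta> t)) (at_left 1)"
      by (rule Lim_transform_eventually)
    then have "phi t - psi t * b t = a t"
      unfolding A B using tendsto_unique[OF nt lim_a] by simp
    moreover have psi: "psi t = \<omega> t * phi t" using elim(4) by (simp add: W)
    ultimately have eq: "phi t * (1 - b t * \<omega> t) = a t" by (simp add: algebra_simps)
    \<comment> \<open>A zero of this factor would force a(t) = 0, which is excluded almost
      everywhere.\<close>
    then have "1 - b t * \<omega> t \<noteq> 0" using elim(2) A by auto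
    then have "phi t = a t / (1 - b t * \<omega> t)" using eq by (simp add: nonzero_eq_divide_eq)
    then show ?case using psi by (simp add: mult.commute)
  qed
qed

text \<open>The relations determine the first entries of both vectors through \<phi> and \<psi>; the
  reflection carries these to the second entries.\<close>

theorem boundary_formulas:
  defines "a \<equiv> bval (ac R n m)" and "b \<equiv> bval (bc R n m)" and "\<omega> \<equiv> bval (omegac R n m)"
  shows "AE t in circle.
    K t = vector [t powi n * cnj (a t) / (1 - cnj (\<omega> t) * cnj (b t)), cnj t powi m * a t * \<omega> t / (1 - b t * \<omega> t)] \<and>
    Kt t = cnj t *s vector [t powi n * cnj (a t) * cnj (\<omega> t) / (1 - cnj (\<omega> t) * cnj (b t)),
      cnj t powi m * a t / (1 - b t * \<omega> t)]"
  using boundary_relations Kc_tilde_reflect[of n m] AE_circle_norm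
  unfolding a_def[symmetric] b_def[symmetric] \<omega>_def[symmetric]
proof eventually_elim
  case (elim t)
  note t = elim(3)
  have pc: "t powi i * cnj (t powi i * cnj w) = w" for i w
    unfolding complex_cnj_mult cnj_powi[OF t] complex_cnj_cnj powi_mult_powi_left[OF t] by simp
  have K1: "K t $ 1 = t powi n * cnj (phi t)" unfolding phi_def pc ..
  have Kt1: "Kt t $ 1 = t powi (n - 1) * cnj (psi t)" unfolding psi_def pc ..
  have "Kt t $ 1 = t powi (n - m - 1) * cnj (K t $ 2)" "Kt t $ 2 = t powi (n - m - 1) * cnj (K t $ 1)"
    unfolding elim(2) by (simp_all add: reflect_def)
  then have "K t $ 2 = t powi (n - m - 1) * cnj (Kt t $ 1)" using pc by metis
  also have "\<dots> = t powi (n - m - 1) * (t powi (- (n - 1)) * psi t)"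
    unfolding Kt1 complex_cnj_mult cnj_powi[OF t] complex_cnj_cnj ..
  also have "\<dots> = t powi (- m) * psi t"
    unfolding powi_mult_powi_left[OF t] by simp
  finally have K2: "K t $ 2 = t powi (- m) * psi t" .
  have "Kt t $ 2 = t powi (n - m - 1) * (t powi (- n) * phi t)"
    unfolding \<open>Kt t $ 2 = _\<close> K1 complex_cnj_mult cnj_powi[OF t] complex_cnj_cnj ..
  also have "\<dots> = t powi (- m - 1) * phi t"
    unfolding powi_mult_powi_left[OF t] by simp
  finally have Kt2: "Kt t $ 2 = t powi (- m - 1) * phi t" .
  have ct: "cnj t = t powi (-1)" by (simp add: cnj_eq_inverse[OF t] power_int_minus)
  have e: "-1 + n = n - 1" "-1 + - m = - m - 1" by simp_all
  have s1: "cnj t * (t powi n * w) = t powi (n - 1) * w" for w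
    by (simp only: ct powi_mult_powi_left[OF t] e)
  have s2: "cnj t * (t powi (- m) * w) = t powi (- m - 1) * w" for w
    by (simp only: ct powi_mult_powi_left[OF t] e)
  have ph: "phi t = a t / (1 - b t * \<omega> t)" and ps: "psi t = a t * \<omega> t / (1 - b t * \<omega> t)"
    using elim(1) by auto
  have cph: "cnj (phi t) = cnj (a t) / (1 - cnj (\<omega> t) * cnj (b t))"
    and cps: "cnj (psi t) = cnj (a t) * cnj (\<omega> t) / (1 - cnj (\<omega> t) * cnj (b t))"
    unfolding ph ps by (simp_all add: mult.commute)
  show ?case
  proof
    show "K t = vector [t powi n * cnj (a t) / (1 - cnj (\<omega> t) * cnj (b t)), cnj t powi m * a t * \<omega> t / (1 - b t * \<omega> t)]"
      by (rule vector2_eqI) (simp_all add: K1 cph K2 ps cnj_powi'[OF t] mult.assoc)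
    show "Kt t = cnj t *s vector [t powi n * cnj (a t) * cnj (\<omega> t) / (1 - cnj (\<omega> t) * cnj (b t)),
        cnj t powi m * a t / (1 - b t * \<omega> t)]"
      by (rule vector2_eqI)
        (simp_all add: Kt1 cps Kt2 ph cnj_powi'[OF t] s1[symmetric] s2[symmetric] mult.assoc del: complex_cnj_power_int)
  qed
qed

end

text \<open>Shifting is compatible with the reflections of the two index pairs: the exponents k - m
  - 1 and n - l - 1 that arise agree because k + l = n + m. So the statement for \<open>Kc\<close>
  carries over.\<close>

lemma (in LR_weight) Kc_tilde_shift:
  assumes "k + l = n + m"
  shows "AE t in circle. shift (n - k) (Kc_tilde R k l) t = Kc_tilde R n m t"
  using Kc_shift[OF assms] Kc_tilde_reflect[of k l] Kc_tilde_reflect[of n m] AE_circle_norm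
proof eventually_elim
  case (elim t)
  note t = elim(4)
  have e: "n - m - 1 + - (n - k) = n - k + (k - l - 1)" using assms by simp
  have "t powi (n - k) * (t powi (k - l - 1) * cnj w) = t powi (n - m - 1) * cnj (t powi (n - k) * w)" for w
    unfolding complex_cnj_mult cnj_powi[OF t] powi_mult_powi_left[OF t] e ..
  then show ?case
    unfolding elim(3) using elim(2) elim(1)[symmetric]
    by (intro vector2_eqI) (simp_all add: reflect_def del: complex_cnj_mult complex_cnj_power_int)
qed

theorem mainTheorem3:
  fixes R :: "complex \<Rightarrow> complex" and n m k l :: int
    and a b \<omega> :: "complex \<Rightarrow> complex"
  assumes "R \<in> borel_measurable circle"
    and "AE t in circle. cmod (R t) \<le> 1"
    and "log_integrable circle (\<lambda>t. 1 - cmod (R t))"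
    and "k + l = n + m"
  defines "a \<equiv> bval (ac R k l)" and "b \<equiv> bval (bc R k l)" and "\<omega> \<equiv> bval (omegac R k l)"
  shows "(AE t in circle. Kc R n m t =
            vector [t powi n * cnj (a t) / (1 - cnj (\<omega> t) * cnj (b t)),
                    cnj t powi m * a t * \<omega> t / (1 - b t * \<omega> t)]) \<and>
         (AE t in circle. Kc_tilde R n m t =
            cnj t *s vector [t powi n * cnj (a t) * cnj (\<omega> t) / (1 - cnj (\<omega> t) * cnj (b t)),
                             cnj t powi m * a t / (1 - b t * \<omega> t)])"
proof -
  \<comment> \<open>The analytic functions are taken at the pair (k, l) and are not compared with
    those at (n, m); instead the two vectors at (k, l), where the formulas hold, are multiplied by
    t^(n - k).\<close>
  interpret LR_colligation R k l
    using assms by unfold_locales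
  have lm: "- l + (n - k) = - m" using assms(4) by simp
  have p1: "t powi (n - k) * (t powi k * w) = t powi n * w" if "norm t = 1" for t w :: complex
    using powi_mult_powi_left[OF that, of "n - k" k w] by simp
  have p2: "t powi (n - k) * (cnj t powi l * w) = cnj t powi m * w" if "norm t = 1" for t w :: complex
    using powi_mult_powi_left[OF that, of "n - k" "- l" w] lm by (simp add: cnj_powi'[OF that] add.commute)
  note F = boundary_formulas[folded a_def b_def \<omega>_def]
  show ?thesis
  proof
    show "AE t in circle. Kc R n m t =
            vector [t powi n * cnj (a t) / (1 - cnj (\<omega> t) * cnj (b t)),
                    cnj t powi m * a t * \<omega> t / (1 - b t * \<omega> t)]"
      using F Kc_shift[OF assms(4)] AE_circle_norm
    proof eventually_elim
      case (elim t)
      show ?case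
        unfolding elim(2)[symmetric]
        by (intro vector2_eqI) (simp_all add: elim(1)[THEN conjunct1] mult.assoc p1[OF elim(3)] p2[OF elim(3)]
            flip: times_divide_eq_right)
    qed
    show "AE t in circle. Kc_tilde R n m t =
            cnj t *s vector [t powi n * cnj (a t) * cnj (\<omega> t) / (1 - cnj (\<omega> t) * cnj (b t)),
                             cnj t powi m * a t / (1 - b t * \<omega> t)]"
      using F Kc_tilde_shift[OF assms(4)] AE_circle_norm
    proof eventually_elim
      case (elim t)
      have c: "t powi (n - k) * (cnj t * w) = cnj t * (t powi (n - k) * w)" for w by (simp only: mult.left_commute)
      show ?case
        unfolding elim(2)[symmetric]
        by (intro vector2_eqI) (simp_all add: elim(1)[THEN conjunct2] c mult.assoc p1[OF elim(3)] p2[OF elim(3)]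
            flip: times_divide_eq_right)
    qed
  qed
qed

end
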